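(* For each finite $\Lambda\subset V$ define the state $\widetilde\varphi_\Lambda$ on $\mathcal A_V$ by $$\widetilde\varphi_\Lambda(a):=\varphi^0\big(K_{\Lambda\cup\vec\partial_0\Lambda}^*\,a\,K_{\Lambda\cup\vec\partial_0\Lambda}\big),\qquad a\in\mathcal A_V .$$ Then the net $\{\widetilde\varphi_\Lambda\}$, indexed by the finite subsets $\Lambda$ of $V$, converges in the weak-* topology. Moreover, the limiting state $\varphi$ is a backward quantum Markov field on $\mathcal A_V$ with respect to the tessellation $V_0$.
   Context: **Graph.** $G=(V,E)$ is a simple non-oriented graph that is infinite, connected and locally finite. Write $x\sim y$ if $\{x,y\}\in E$, and $N_y=\{x\in V: x\sim y\}$ (so $y\notin N_y$). For $\Lambda\subset V$: $\Lambda^c=V\setminus\Lambda$; $\partial\Lambda=\{x\in\Lambda:\exists y\in\Lambda^c,\ x\sim y\}$; $\vec\partial\Lambda=\{y\in\Lambda^c:\exists x\in\Lambda,\ x\sim y\}$; $\overline\Lambda=\Lambda\cup\vec\partial\Lambda$. Write $\Lambda\subset\subset\Lambda'$ if $\overline\Lambda\subset\Lambda'$. The finite subsets of $V$ are ordered by inclusion. **Tessellation.** Fix $y_1\in V$ and put $V_{0,1}=\{y_1\}$. Inductively let $V_n=\bigcup_{y\in V_{0,n}}(\{y\}\cup N_y)$ and $V_{0,n+1}=V_{0,n}\cup\vec\partial V_n$. The set $V_0=\bigcup_{n\ge1}V_{0,n}$ (equivalently the family $\{V_{0,n}\}_{n\ge1}$) is called the tessellation. **Algebras.** Each $x\in V$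 carries a finite dimensional Hilbert space $\mathcal H_x$, and $\mathcal A_x=\mathcal B(\mathcal H_x)$. For finite $\Lambda\subset V$, $\mathcal A_\Lambda=\bigotimes_{x\in\Lambda}\mathcal A_x$, and for $\Lambda\subset\Lambda'$ one identifies $\mathcal A_\Lambda\equiv\mathcal A_\Lambda\otimes\mathbf 1_{\Lambda'\setminus\Lambda}\subset\mathcal A_{\Lambda'}$. The quasi-local algebra $\mathcal A_V=\bigotimes_{x\in V}\mathcal A_x$ is the $C^*$-closure of $\bigcup_{\Lambda\text{ finite}}\mathcal A_\Lambda$; $\mathcal A_{\Lambda}=\bigotimes_{x\in\Lambda}\mathcal A_x\subset\mathcal A_V$ is defined analogously for any $\Lambda\subset V$. Fix a state $\varphi^0_x$ on $\mathcal A_x$ for each $x\in V$, and let $\varphi^0=\bigotimes_{x\in V}\varphi^0_x$ be the product state on $\mathcal A_V$. For $x\in V$, $\mathbb E^0_{\{x\}^c}$ is the Umegaki conditional expectation (norm one projection) from $\mathcal A_V$ onto $\mathcal A_{\{x\}^c}$ given by $\mathbb E^0_{\{x\}^c}(a_x\otimes a_{\{x\}^c})=\varphi^0_x(a_x)\,a_{\{x\}^c}$. **Amplitudes.** For each $y\in V_0$ and $x\in N_y$ an invertible operator $\widetilde K_{(x,y)}\in\mathcal A_{\{x,y\}}$ is given, such that the $C^*$-algebra $\mathcal K$ generated by all $\widetilde K_{(x,y)},\widetilde K_{(x,y)}^*$ ($y\in V_0$, $x\in N_y$) is commutative. For $y\in V_0$ let $B_{N_y}=\mathbb E^0_{\{y\}^c}\big(\big|\prod_{x\in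 N_y}\widetilde K_{(x,y)}\big|^2\big)\in\mathcal A_{N_y}$, where $|T|^2=T^*T$; it is positive and invertible. It is assumed that, for every $y\in V_0$, $B_{N_y}$ belongs to the commutant $\mathcal K'$ of $\mathcal K$ in $\mathcal A_V$. Put $K_{\{y\}\cup N_y}=\big(\prod_{x\in N_y}\widetilde K_{(x,y)}\big)B_{N_y}^{-1/2}$. By construction the family $\{K_{\{y\}\cup N_y},K_{\{y\}\cup N_y}^*:y\in V_0\}$ is commutative. For finite $\Lambda\subset V$ let $\vec\partial_0\Lambda=\bigcup_{y\in\partial\Lambda\cap V_0}N_y$ and $$K_{\Lambda\cup\vec\partial_0\Lambda}=\prod_{y\in\Lambda\cap V_0}K_{\{y\}\cup N_y}\in\mathcal A_{\Lambda\cup\vec\partial_0\Lambda}\subseteq\mathcal A_{\overline\Lambda},$$ with the convention that this is $\mathbf 1$ if $\Lambda\cap V_0=\emptyset$. (The operator is determined by $\Lambda$.) **Quasi-conditional expectation.** For unital $C^*$-algebras $C\subset B\subset A$, a quasi-conditional expectation with respect to the triplet $C\subset B\subset A$ is a completely positive unital linear map $\mathcal E:A\to B$ with $\mathcal E(ca)=c\,\mathcal E(a)$ for all $a\in A$, $c\in C$. **Backward quantum Markov field with respect to $V_0$.** A state $\varphi$ on $\mathcal A_V$ is a backward quantum Markov field with respect to the tessellation $V_0$ if for any sequence $\{\Lambda_n\}_{n\ge0}$ of finite subsets of $V$ satisfying $\Lambda_n\subset\subset\Lambda_{n+1}$ and $\vec\partial\Lambda_n\cap V_0=\emptyset$ for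 all $n$, there exists a pair $(\varphi_{\Lambda_0},\{E_{\Lambda_n,\Lambda_{n+1}}\}_{n\ge0})$, where $\varphi_{\Lambda_0}$ is a state on $\mathcal A_{\Lambda_0}$ and each $E_{\Lambda_n,\Lambda_{n+1}}$ is a quasi-conditional expectation with respect to the triplet $\mathcal A_{\Lambda_n}\subset\mathcal A_{\overline\Lambda_n}\subset\mathcal A_{\Lambda_{n+1}}$, such that $$\varphi=\lim_{n\to\infty}\varphi_{\Lambda_0}\circ E_{\Lambda_0,\Lambda_1}\circ\cdots\circ E_{\Lambda_n,\Lambda_{n+1}},$$ the limit being taken in the weak-* topology.
   Formalization: Assumes no two vertices of V_0 are adjacent (else φ̃_Λ(1) can exceed 1); to make E_{Λ_n,Λ_{n+1}} composable, each is also defined on the algebra of the closure of Λ_{n+1}, the initial state on that of the closure of Λ_0, with the limit taken pointwise on these local algebras. *)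

theory Defs
  imports "HOL-Analysis.Analysis"
begin

section \<open>Graphs and tessellations\<close>

text \<open>A simple graph whose vertex set \<open>V\<close> is the whole type \<open>'v\<close>, given by its adjacency relation.\<close>

definition inf_graph :: "('v \<Rightarrow> 'v \<Rightarrow> bool) \<Rightarrow> bool" where
  "inf_graph adj \<longleftrightarrow>
     symp adj \<and> irreflp adj \<and>
     infinite (UNIV :: 'v set) \<and>
     (\<forall>x y. adj\<^sup>*\<^sup>* x y) \<and>
     (\<forall>y. finite {x. adj x y})"

definition nbrs :: "('v \<Rightarrow> 'v \<Rightarrow> bool) \<Rightarrow> 'v \<Rightarrow> 'v set" where
  "nbrs adj y = {x. adj x y}"

definition out_boundary :: "('v \<Rightarrow> 'v \<Rightarrow> bool) \<Rightarrow> 'v set \<Rightarrow> 'v set" where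
  "out_boundary adj \<Lambda> = {y. y \<notin> \<Lambda> \<and> (\<exists>x\<in>\<Lambda>. adj x y)}"

definition gclosure :: "('v \<Rightarrow> 'v \<Rightarrow> bool) \<Rightarrow> 'v set \<Rightarrow> 'v set" where
  "gclosure adj \<Lambda> = \<Lambda> \<union> out_boundary adj \<Lambda>"

text \<open>\<open>tess_step adj y1 n\<close> is \<open>V\<^bsub>0,n+1\<^esub>\<close>: the sequence is indexed from \<open>0\<close> here.\<close>

primrec tess_step :: "('v \<Rightarrow> 'v \<Rightarrow> bool) \<Rightarrow> 'v \<Rightarrow> nat \<Rightarrow> 'v set" where
  "tess_step adj y1 0 = {y1}"
| "tess_step adj y1 (Suc n) =
     tess_step adj y1 n \<union> out_boundary adj (\<Union>y\<in>tess_step adj y1 n. {y} \<union> nbrs adj y)"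

definition tessellation :: "('v \<Rightarrow> 'v \<Rightarrow> bool) \<Rightarrow> 'v \<Rightarrow> 'v set" where
  "tessellation adj y1 = (\<Union>n. tess_step adj y1 n)"

text \<open>The tessellation consists of the vertices at even distance from \<open>y1\<close>.  Two of them can be
  adjacent if the graph has odd cycles.  Independence has to be assumed separately: for adjacent
  \<open>y, z\<close> in the tessellation, with normalized traces as site states and
  \<open>Kt y z = Kt z y = (1 + \<epsilon> \<sigma>\<^sub>y \<sigma>\<^sub>z)\<^bsup>1/2\<^esup>\<close> in terms of Pauli matrices (all other amplitudes being \<open>1\<close>),
  the functional \<open>phi_tilde\<close> below has the value \<open>1 + \<epsilon>\<^sup>2\<close> at \<open>1\<close> for all \<open>\<Lambda> \<supseteq> {y, z}\<close>.\<close>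

definition independent_in :: "('v \<Rightarrow> 'v \<Rightarrow> bool) \<Rightarrow> 'v set \<Rightarrow> bool" where
  "independent_in adj S \<longleftrightarrow> (\<forall>y\<in>S. \<forall>z\<in>S. \<not> adj y z)"


section \<open>Unital C*-algebras\<close>

class cstar_algebra = real_normed_algebra_1 + banach +
  fixes scaleC :: "complex \<Rightarrow> 'a \<Rightarrow> 'a" (infixr "*\<^sub>C" 75)
    and star :: "'a \<Rightarrow> 'a"
  assumes scaleC_add_right: "c *\<^sub>C (a + b) = c *\<^sub>C a + c *\<^sub>C b"
    and scaleC_add_left: "(c + e) *\<^sub>C a = c *\<^sub>C a + e *\<^sub>C a"
    and scaleC_scaleC: "c *\<^sub>C (e *\<^sub>C a) = (c * e) *\<^sub>C a"
    and scaleC_of_real: "of_real r *\<^sub>C a = r *\<^sub>R a"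
    and mult_scaleC_left: "(c *\<^sub>C a) * b = c *\<^sub>C (a * b)"
    and mult_scaleC_right: "a * (c *\<^sub>C b) = c *\<^sub>C (a * b)"
    and norm_scaleC: "norm (c *\<^sub>C a) = cmod c * norm a"
    and star_add: "star (a + b) = star a + star b"
    and star_scaleC: "star (c *\<^sub>C a) = cnj c *\<^sub>C star a"
    and star_mult: "star (a * b) = star b * star a"
    and star_star: "star (star a) = a"
    and cstar_identity: "norm (star a * a) = (norm a)\<^sup>2"

definition cstar_subalgebra :: "'a::cstar_algebra set \<Rightarrow> bool" where
  "cstar_subalgebra S \<longleftrightarrow> closed S \<and> 1 \<in> S \<and>
     (\<forall>a\<in>S. \<forall>b\<in>S. a + b \<in> S \<and> a * b \<in> S) \<and>
     (\<forall>c. \<forall>a\<in>S. c *\<^sub>C a \<in> S) \<and> (\<forall>a\<in>S. star a \<in> S)"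

definition commutative_on :: "'a::cstar_algebra set \<Rightarrow> bool" where
  "commutative_on S \<longleftrightarrow> (\<forall>a\<in>S. \<forall>b\<in>S. a * b = b * a)"

definition commutant :: "'a::cstar_algebra set \<Rightarrow> 'a set" where
  "commutant S = {a. \<forall>b\<in>S. a * b = b * a}"

definition invertible_elem :: "'a::cstar_algebra \<Rightarrow> bool" where
  "invertible_elem a \<longleftrightarrow> (\<exists>b. a * b = 1 \<and> b * a = 1)"

definition abs_sq :: "'a::cstar_algebra \<Rightarrow> 'a" where
  "abs_sq a = star a * a"

text \<open>Product of a finite family of pairwise commuting elements (the order is then irrelevant);
  the empty product is \<open>1\<close>.\<close>

definition cprod :: "('i \<Rightarrow> 'a::cstar_algebra) \<Rightarrow> 'i set \<Rightarrow> 'a" where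
  "cprod f F = Finite_Set.fold (\<lambda>i p. f i * p) 1 F"

definition clinear_on :: "'a::cstar_algebra set \<Rightarrow> ('a \<Rightarrow> 'a) \<Rightarrow> bool" where
  "clinear_on S f \<longleftrightarrow>
     (\<forall>a\<in>S. \<forall>b\<in>S. f (a + b) = f a + f b) \<and> (\<forall>c. \<forall>a\<in>S. f (c *\<^sub>C a) = c *\<^sub>C f a)"

text \<open>A state on the unital *-subalgebra \<open>S\<close>; only the values on \<open>S\<close> matter.\<close>

definition state_on :: "'a::cstar_algebra set \<Rightarrow> ('a \<Rightarrow> complex) \<Rightarrow> bool" where
  "state_on S \<phi> \<longleftrightarrow>
     (\<forall>a\<in>S. \<forall>b\<in>S. \<phi> (a + b) = \<phi> a + \<phi> b) \<and>
     (\<forall>c. \<forall>a\<in>S. \<phi> (c *\<^sub>C a) = c * \<phi> a) \<and>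
     (\<forall>a\<in>S. \<phi> (star a * a) \<in> \<real>\<^sub>\<ge>\<^sub>0) \<and> \<phi> 1 = 1"

text \<open>The inverse square root \<open>b\<^bsup>-1/2\<^esup>\<close> in the C*-algebra \<open>S\<close>: the positive element of \<open>S\<close> whose
  square is the inverse of \<open>b\<close>.  It exists and is unique if \<open>b \<in> S\<close> is positive and invertible.\<close>

definition positive_in :: "'a::cstar_algebra set \<Rightarrow> 'a \<Rightarrow> bool" where
  "positive_in S a \<longleftrightarrow> (\<exists>b\<in>S. a = star b * b)"

definition inv_sqrt_in :: "'a::cstar_algebra set \<Rightarrow> 'a \<Rightarrow> 'a" where
  "inv_sqrt_in S b =
     (THE c. c \<in> S \<and> positive_in S c \<and> (c * c) * b = 1 \<and> b * (c * c) = 1)"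

text \<open>\<open>X\<close> (with entries \<open>X i j\<close>, \<open>i, j < n\<close>) is a positive element of the matrix algebra \<open>M\<^sub>n(S)\<close>,
  i.e. \<open>X = C\<^sup>* C\<close> with \<open>C \<in> M\<^sub>n(S)\<close>.\<close>

definition mat_positive_in :: "nat \<Rightarrow> 'a::cstar_algebra set \<Rightarrow> (nat \<Rightarrow> nat \<Rightarrow> 'a) \<Rightarrow> bool" where
  "mat_positive_in n S X \<longleftrightarrow>
     (\<exists>C. (\<forall>i<n. \<forall>j<n. C i j \<in> S) \<and>
          (\<forall>i<n. \<forall>j<n. X i j = (\<Sum>k<n. star (C k i) * C k j)))"

definition completely_positive_on ::
    "'a::cstar_algebra set \<Rightarrow> 'a set \<Rightarrow> ('a \<Rightarrow> 'a) \<Rightarrow> bool" where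
  "completely_positive_on A B E \<longleftrightarrow>
     (\<forall>n X. mat_positive_in n A X \<longrightarrow> mat_positive_in n B (\<lambda>i j. E (X i j)))"

definition quasi_cond_exp ::
    "'a::cstar_algebra set \<Rightarrow> 'a set \<Rightarrow> 'a set \<Rightarrow> ('a \<Rightarrow> 'a) \<Rightarrow> bool" where
  "quasi_cond_exp C B A E \<longleftrightarrow>
     C \<subseteq> B \<and> B \<subseteq> A \<and>
     clinear_on A E \<and> E ` A \<subseteq> B \<and> completely_positive_on A B E \<and> E 1 = 1 \<and>
     (\<forall>c\<in>C. \<forall>a\<in>A. E (c * a) = c * E a)"


section \<open>The quasi-local algebra\<close>

text \<open>The site space \<open>\<H>\<^sub>x\<close> is identified with \<open>\<complex>\<^bsup>d x\<^esup>\<close> by an orthonormal basis labelled by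
  \<open>{..<d x}\<close>.  For finite \<open>\<Lambda>\<close> the space \<open>\<Otimes>\<^bsub>x\<in>\<Lambda>\<^esub> \<H>\<^sub>x\<close> then has an orthonormal basis labelled by the
  configurations in \<open>configs d \<Lambda>\<close>, and \<open>\<Otimes>\<^bsub>x\<in>\<Lambda>\<^esub> \<B>(\<H>\<^sub>x) = \<B>(\<Otimes>\<^bsub>x\<in>\<Lambda>\<^esub> \<H>\<^sub>x)\<close> is the algebra of
  complex matrices indexed by configurations (zero outside, so that equality is matrix equality).\<close>

type_synonym 'v cmat = "('v \<Rightarrow> nat) \<Rightarrow> ('v \<Rightarrow> nat) \<Rightarrow> complex"

definition configs :: "('v \<Rightarrow> nat) \<Rightarrow> 'v set \<Rightarrow> ('v \<Rightarrow> nat) set" where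
  "configs d \<Lambda> = (\<Pi>\<^sub>E x\<in>\<Lambda>. {..<d x})"

definition mats :: "('v \<Rightarrow> nat) \<Rightarrow> 'v set \<Rightarrow> 'v cmat set" where
  "mats d \<Lambda> = {M. \<forall>\<omega> \<eta>. \<omega> \<notin> configs d \<Lambda> \<or> \<eta> \<notin> configs d \<Lambda> \<longrightarrow> M \<omega> \<eta> = 0}"

definition mat_one :: "('v \<Rightarrow> nat) \<Rightarrow> 'v set \<Rightarrow> 'v cmat" where
  "mat_one d \<Lambda> = (\<lambda>\<omega> \<eta>. if \<omega> \<in> configs d \<Lambda> \<and> \<eta> = \<omega> then 1 else 0)"

definition mat_mult :: "('v \<Rightarrow> nat) \<Rightarrow> 'v set \<Rightarrow> 'v cmat \<Rightarrow> 'v cmat \<Rightarrow> 'v cmat" where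
  "mat_mult d \<Lambda> M N = (\<lambda>\<omega> \<eta>. \<Sum>\<zeta>\<in>configs d \<Lambda>. M \<omega> \<zeta> * N \<zeta> \<eta>)"

definition mat_adj :: "'v cmat \<Rightarrow> 'v cmat" where
  "mat_adj M = (\<lambda>\<omega> \<eta>. cnj (M \<eta> \<omega>))"

text \<open>The identification \<open>M \<mapsto> M \<otimes> \<one>\<^bsub>\<Lambda>' - \<Lambda>\<^esub>\<close> for \<open>\<Lambda> \<subseteq> \<Lambda>'\<close>.\<close>

definition ampliate :: "('v \<Rightarrow> nat) \<Rightarrow> 'v set \<Rightarrow> 'v set \<Rightarrow> 'v cmat \<Rightarrow> 'v cmat" where
  "ampliate d \<Lambda> \<Lambda>' M = (\<lambda>\<omega> \<eta>.
     if \<omega> \<in> configs d \<Lambda>' \<and> \<eta> \<in> configs d \<Lambda>' \<and> (\<forall>x\<in>\<Lambda>' - \<Lambda>. \<omega> x = \<eta> x)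
     then M (restrict \<omega> \<Lambda>) (restrict \<eta> \<Lambda>) else 0)"

definition star_embedding ::
    "('v \<Rightarrow> nat) \<Rightarrow> 'v set \<Rightarrow> ('v cmat \<Rightarrow> 'a::cstar_algebra) \<Rightarrow> bool" where
  "star_embedding d \<Lambda> \<rho> \<longleftrightarrow>
     inj_on \<rho> (mats d \<Lambda>) \<and> \<rho> (mat_one d \<Lambda>) = 1 \<and>
     (\<forall>M\<in>mats d \<Lambda>. \<forall>N\<in>mats d \<Lambda>.
        \<rho> (\<lambda>\<omega> \<eta>. M \<omega> \<eta> + N \<omega> \<eta>) = \<rho> M + \<rho> N \<and>
        \<rho> (mat_mult d \<Lambda> M N) = \<rho> M * \<rho> N) \<and>
     (\<forall>c. \<forall>M\<in>mats d \<Lambda>. \<rho> (\<lambda>\<omega> \<eta>. c * M \<omega> \<eta>) = c *\<^sub>C \<rho> M) \<and>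
     (\<forall>M\<in>mats d \<Lambda>. \<rho> (mat_adj M) = star (\<rho> M))"

definition local_alg ::
    "('v \<Rightarrow> nat) \<Rightarrow> ('v set \<Rightarrow> 'v cmat \<Rightarrow> 'a::cstar_algebra) \<Rightarrow> 'v set \<Rightarrow> 'a set" where
  "local_alg d \<pi> \<Lambda> = \<pi> \<Lambda> ` mats d \<Lambda>"

text \<open>\<open>\<A>\<^sub>\<Lambda>\<close> for an arbitrary, possibly infinite region \<open>\<Lambda>\<close>.\<close>

definition region_alg ::
    "('v \<Rightarrow> nat) \<Rightarrow> ('v set \<Rightarrow> 'v cmat \<Rightarrow> 'a::cstar_algebra) \<Rightarrow> 'v set \<Rightarrow> 'a set" where
  "region_alg d \<pi> \<Lambda> = closure (\<Union>F\<in>{F. finite F \<and> F \<subseteq> \<Lambda>}. local_alg d \<pi> F)"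

text \<open>The C*-algebra \<open>'a\<close>, together with the embeddings \<open>\<pi> \<Lambda>\<close>, is the quasi-local algebra \<open>\<A>\<^sub>V\<close>:
  the C*-closure of the union of the local algebras under the identifications above.  A *-embedding
  of a full matrix algebra is isometric, so this fixes \<open>\<A>\<^sub>V\<close> and its local algebras up to
  isomorphism.\<close>

definition quasi_local_algebra ::
    "('v \<Rightarrow> nat) \<Rightarrow> ('v set \<Rightarrow> 'v cmat \<Rightarrow> 'a::cstar_algebra) \<Rightarrow> bool" where
  "quasi_local_algebra d \<pi> \<longleftrightarrow>
     (\<forall>x. 0 < d x) \<and>
     (\<forall>\<Lambda>. finite \<Lambda> \<longrightarrow> star_embedding d \<Lambda> (\<pi> \<Lambda>)) \<and>
     (\<forall>\<Lambda> \<Lambda>' M. finite \<Lambda>' \<and> \<Lambda> \<subseteq> \<Lambda>' \<and> M \<in> mats d \<Lambda> \<longrightarrow>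
        \<pi> \<Lambda>' (ampliate d \<Lambda> \<Lambda>' M) = \<pi> \<Lambda> M) \<and>
     region_alg d \<pi> UNIV = UNIV"

text \<open>\<open>\<phi>0 = \<Otimes>\<^sub>x \<phi>x x\<close>; under the identifications, \<open>\<Otimes>\<^bsub>x\<in>F\<^esub> a\<^sub>x\<close> is the product of the commuting
  elements \<open>a\<^sub>x\<close>.\<close>

definition product_state ::
    "('v \<Rightarrow> nat) \<Rightarrow> ('v set \<Rightarrow> 'v cmat \<Rightarrow> 'a::cstar_algebra) \<Rightarrow> ('v \<Rightarrow> 'a \<Rightarrow> complex) \<Rightarrow>
     ('a \<Rightarrow> complex) \<Rightarrow> bool" where
  "product_state d \<pi> \<phi>x \<phi>0 \<longleftrightarrow>
     state_on UNIV \<phi>0 \<and>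
     (\<forall>F a. finite F \<and> (\<forall>x\<in>F. a x \<in> local_alg d \<pi> {x}) \<longrightarrow>
        \<phi>0 (cprod a F) = (\<Prod>x\<in>F. \<phi>x x (a x)))"

text \<open>\<open>E\<close> is the norm one projection \<open>\<bbbE>\<^sup>0\<close> of \<open>\<A>\<^sub>V\<close> onto \<open>\<A>\<close> of the complement of \<open>{x}\<close> that
  integrates out the site \<open>x\<close>.\<close>

definition site_cond_exp ::
    "('v \<Rightarrow> nat) \<Rightarrow> ('v set \<Rightarrow> 'v cmat \<Rightarrow> 'a::cstar_algebra) \<Rightarrow> ('v \<Rightarrow> 'a \<Rightarrow> complex) \<Rightarrow>
     'v \<Rightarrow> ('a \<Rightarrow> 'a) \<Rightarrow> bool" where
  "site_cond_exp d \<pi> \<phi>x x E \<longleftrightarrow>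
     clinear_on UNIV E \<and>
     (\<forall>a. norm (E a) \<le> norm a) \<and>
     (\<forall>a. E a \<in> region_alg d \<pi> (- {x})) \<and>
     (\<forall>b\<in>region_alg d \<pi> (- {x}). E b = b) \<and>
     (\<forall>a\<in>local_alg d \<pi> {x}. \<forall>b\<in>region_alg d \<pi> (- {x}). E (a * b) = \<phi>x x a *\<^sub>C b)"


section \<open>Amplitudes and Markov fields\<close>

text \<open>\<open>Kt x y\<close> is \<open>K\<close>-tilde of the ordered pair \<open>(x,y)\<close>, with \<open>y\<close> in the tessellation and \<open>x \<sim> y\<close>.\<close>

definition gen_alg ::
    "('v \<Rightarrow> 'v \<Rightarrow> bool) \<Rightarrow> 'v set \<Rightarrow> ('v \<Rightarrow> 'v \<Rightarrow> 'a::cstar_algebra) \<Rightarrow> 'a set" where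
  "gen_alg adj V0 Kt =
     cstar_subalgebra hull
       (\<Union>y\<in>V0. \<Union>x\<in>nbrs adj y. {Kt x y, star (Kt x y)})"

definition B_op ::
    "('v \<Rightarrow> 'v \<Rightarrow> bool) \<Rightarrow> ('v \<Rightarrow> 'a \<Rightarrow> 'a) \<Rightarrow> ('v \<Rightarrow> 'v \<Rightarrow> 'a::cstar_algebra) \<Rightarrow> 'v \<Rightarrow> 'a" where
  "B_op adj E0 Kt y = E0 y (abs_sq (cprod (\<lambda>x. Kt x y) (nbrs adj y)))"

text \<open>\<open>A\<close> is the assignment \<open>\<Lambda> \<mapsto> \<A>\<^sub>\<Lambda>\<close> of the local algebras.\<close>

definition K_site ::
    "('v \<Rightarrow> 'v \<Rightarrow> bool) \<Rightarrow> ('v set \<Rightarrow> 'a set) \<Rightarrow> ('v \<Rightarrow> 'a \<Rightarrow> 'a) \<Rightarrow>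
     ('v \<Rightarrow> 'v \<Rightarrow> 'a::cstar_algebra) \<Rightarrow> 'v \<Rightarrow> 'a" where
  "K_site adj A E0 Kt y =
     cprod (\<lambda>x. Kt x y) (nbrs adj y) * inv_sqrt_in (A (nbrs adj y)) (B_op adj E0 Kt y)"

definition K_region ::
    "('v \<Rightarrow> 'v \<Rightarrow> bool) \<Rightarrow> ('v set \<Rightarrow> 'a set) \<Rightarrow> 'v set \<Rightarrow> ('v \<Rightarrow> 'a \<Rightarrow> 'a) \<Rightarrow>
     ('v \<Rightarrow> 'v \<Rightarrow> 'a::cstar_algebra) \<Rightarrow> 'v set \<Rightarrow> 'a" where
  "K_region adj A V0 E0 Kt \<Lambda> = cprod (K_site adj A E0 Kt) (\<Lambda> \<inter> V0)"

definition phi_tilde ::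
    "('v \<Rightarrow> 'v \<Rightarrow> bool) \<Rightarrow> ('v set \<Rightarrow> 'a set) \<Rightarrow> 'v set \<Rightarrow> ('v \<Rightarrow> 'a \<Rightarrow> 'a) \<Rightarrow>
     ('v \<Rightarrow> 'v \<Rightarrow> 'a::cstar_algebra) \<Rightarrow> ('a \<Rightarrow> complex) \<Rightarrow> 'v set \<Rightarrow> 'a \<Rightarrow> complex" where
  "phi_tilde adj A V0 E0 Kt \<phi>0 \<Lambda> a =
     \<phi>0 (star (K_region adj A V0 E0 Kt \<Lambda>) * a * K_region adj A V0 E0 Kt \<Lambda>)"

text \<open>\<open>back_comp E n = E 0 \<circ> E 1 \<circ> \<dots> \<circ> E n\<close>\<close>

primrec back_comp :: "(nat \<Rightarrow> 'a \<Rightarrow> 'a) \<Rightarrow> nat \<Rightarrow> 'a \<Rightarrow> 'a" where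
  "back_comp E 0 = E 0"
| "back_comp E (Suc n) = back_comp E n \<circ> E (Suc n)"

text \<open>\<open>E n\<close> stands for \<open>E\<^bsub>\<Lambda>\<^sub>n,\<Lambda>\<^sub>n\<^sub>+\<^sub>1\<^esub>\<close>.  It takes values in the algebra of the closure of \<open>\<Lambda>\<^sub>n\<close>, so for the
  compositions to be defined, \<open>E n\<close> is required on the algebra of the closure of \<open>\<Lambda>\<^sub>n\<^sub>+\<^sub>1\<close>, and the
  initial state on that of the closure of \<open>\<Lambda>\<^sub>0\<close>; the first \<open>quasi_cond_exp\<close> below is then its
  restriction to \<open>\<A>\<^bsub>\<Lambda>\<^sub>n\<^sub>+\<^sub>1\<^esub>\<close>.  The functional \<open>\<psi> \<circ> back_comp E n\<close> lives on the algebra of the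
  closure of \<open>\<Lambda>\<^sub>n\<^sub>+\<^sub>1\<close>, so the weak-* limit is pointwise on the union of these algebras, which is
  dense in \<open>\<A>\<^sub>V\<close> unless all \<open>\<Lambda>\<^sub>n\<close> are empty.\<close>

definition backward_qmf ::
    "('v \<Rightarrow> 'v \<Rightarrow> bool) \<Rightarrow> ('v set \<Rightarrow> 'a::cstar_algebra set) \<Rightarrow> 'v set \<Rightarrow>
     ('a \<Rightarrow> complex) \<Rightarrow> bool" where
  "backward_qmf adj A V0 \<phi> \<longleftrightarrow>
     state_on UNIV \<phi> \<and>
     (\<forall>\<Lambda> :: nat \<Rightarrow> 'v set.
        (\<forall>n. finite (\<Lambda> n) \<and> gclosure adj (\<Lambda> n) \<subseteq> \<Lambda> (Suc n) \<and>
             out_boundary adj (\<Lambda> n) \<inter> V0 = {}) \<longrightarrow>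
        (\<exists>\<psi> E.
           state_on (A (gclosure adj (\<Lambda> 0))) \<psi> \<and>
           (\<forall>n. quasi_cond_exp (A (\<Lambda> n)) (A (gclosure adj (\<Lambda> n))) (A (\<Lambda> (Suc n))) (E n)) \<and>
           (\<forall>n. quasi_cond_exp (A (\<Lambda> n)) (A (gclosure adj (\<Lambda> n)))
                  (A (gclosure adj (\<Lambda> (Suc n)))) (E n)) \<and>
           (\<forall>m. \<forall>a\<in>A (gclosure adj (\<Lambda> m)).
              (\<lambda>n. \<psi> (back_comp E n a)) \<longlonglongrightarrow> \<phi> a)))"

end

theory Submission
  imports Defs
begin

text \<open>Write \<open>T\<^sub>y a = E0 y (K\<^sub>y\<^sup>* a K\<^sub>y)\<close> for the site expectation dressed with the amplitude \<open>K\<^sub>y\<close>.  The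
  normalization of \<open>K\<^sub>y\<close> makes \<open>T\<^sub>y\<close> unital, so \<open>T\<^sub>y\<close> fixes every observable localized away from
  \<open>{y} \<union> N\<^sub>y\<close>.  As \<open>\<phi>0 \<circ> E0 y = \<phi>0\<close> and the tessellation is independent, adding the vertex \<open>y\<close> to a region
  composes the perturbed state with \<open>T\<^sub>y\<close>.  Hence on a local observable the net of perturbed states
  is eventually constant, which gives convergence by density, and the composition of the \<open>T\<^sub>y\<close>, \<open>y \<in> \<Lambda>\<^sub>n\<^sub>+\<^sub>1 - \<Lambda>\<^sub>n\<close>,
  followed by plain site expectations is the required quasi-conditional expectation.

  The inverse square root of \<open>B\<^sub>y\<close> is a binomial series in \<open>1 - B\<^sub>y / r\<close>, and complete positivity reduces
  to Cholesky factorization of scalar kernels.\<close>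

section \<open>C*-algebras\<close>

text \<open>The norm of a local algebra is known only through the C*-identity and is never
  identified with an operator norm of matrices. The normalized trace supplies a comparison with the
  Hilbert-Schmidt norm, up to a constant depending on the region. The constant does no harm, because
  it stays bounded while the powers of a self-adjoint element decay. Positivity is handled
  throughout by explicit factorizations \<open>star b * b\<close>. Independence of the tessellation
  enters twice: \<open>B y\<close> contains no site of the tessellation, so it leaves
  \<open>E0 z\<close>, and the amplitude of y avoids every other site z of the tessellation, so
  \<open>T z\<close> can be inserted into a state already perturbed at y. The boundary condition on
  the regions is complementary: it keeps amplitudes of new vertices off \<Lambda> n, which yields
  the module property over the algebra of \<Lambda> n. Dressed expectations erase only sites of the
  tessellation; the other sites between two consecutive closures are erased by plain expectations,
  applied after all amplitudes acting on them have been absorbed.\<close>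

lemma scaleC_one [simp]: "1 *\<^sub>C (a::'a::cstar_algebra) = a"
  using scaleC_of_real[of 1 a] by simp

lemma scaleC_zero_left [simp]: "0 *\<^sub>C (a::'a::cstar_algebra) = 0"
  using scaleC_of_real[of 0 a] by simp

lemma scaleC_minus_one: "(-1) *\<^sub>C (a::'a::cstar_algebra) = - a"
  using scaleC_of_real[of "-1" a] by simp

lemma scaleC_sum_left:
  "(\<Sum>i\<in>I. c i) *\<^sub>C (a::'a::cstar_algebra) = (\<Sum>i\<in>I. c i *\<^sub>C a)"
  by (induction I rule: infinite_finite_induct) (auto simp: scaleC_add_left)

lemma tendsto_scaleC_left:
  assumes "(f \<longlongrightarrow> c) F"
  shows "((\<lambda>n. f n *\<^sub>C (a::'a::cstar_algebra)) \<longlongrightarrow> c *\<^sub>C a) F"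
proof -
  have "bounded_linear (\<lambda>c. c *\<^sub>C a)"
  proof (rule bounded_linear_intro[where K = "norm a"])
    show "(r *\<^sub>R c) *\<^sub>C a = r *\<^sub>R (c *\<^sub>C a)" for r c
      by (simp add: scaleR_conv_of_real[of r c] scaleC_scaleC[symmetric] scaleC_of_real)
  qed (auto simp: scaleC_add_left norm_scaleC)
  then show ?thesis
    using assms by (rule bounded_linear.tendsto)
qed

lemma star_1 [simp]: "star (1::'a::cstar_algebra) = 1"
  by (metis mult.right_neutral mult_1 star_mult star_star)

lemma star_scaleR: "star (r *\<^sub>R a) = r *\<^sub>R star (a::'a::cstar_algebra)"
  using star_scaleC[of "of_real r" a] by (simp add: scaleC_of_real)

text \<open>The C*-identity and submultiplicativity bound the square of \<open>norm b\<close> by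
  \<open>norm (star b) * norm b\<close>; using this for a and for its adjoint gives both
  inequalities.\<close>

lemma norm_star [simp]: "norm (star a) = norm (a::'a::cstar_algebra)"
proof -
  have le: "norm b \<le> norm (star b)" for b :: 'a
  proof (cases "b = 0")
    case False
    have "norm b * norm b \<le> norm (star b) * norm b"
      using norm_mult_ineq[of "star b" b] by (simp add: cstar_identity power2_eq_square)
    then show ?thesis using False by simp
  qed auto
  show ?thesis using le[of a] le[of "star a"] by (simp add: star_star)
qed

lemma bounded_linear_star: "bounded_linear (star :: 'a::cstar_algebra \<Rightarrow> 'a)"
  by (rule bounded_linear_intro[where K = 1]) (auto simp: star_add star_scaleR)

lemmas star_diff = linear_diff[OF bounded_linear.linear[OF bounded_linear_star]]
lemmas star_sum = linear_sum[OF bounded_linear.linear[OF bounded_linear_star]]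

lemma star_power: "star (a ^ n) = star (a::'a::cstar_algebra) ^ n"
  by (induction n) (auto simp: star_mult power_commutes)

lemma star_mult_self_eq_0:
  assumes "star a * a = (0::'a::cstar_algebra)"
  shows "a = 0"
  using cstar_identity[of a] assms by simp

text \<open>Closedness is left out so that the algebraic rules apply to local algebras before these
  are known to be closed.\<close>

definition star_subalg :: "'a::cstar_algebra set \<Rightarrow> bool" where
  "star_subalg S \<longleftrightarrow> 1 \<in> S \<and> (\<forall>a\<in>S. \<forall>b\<in>S. a + b \<in> S \<and> a * b \<in> S) \<and>
     (\<forall>c. \<forall>a\<in>S. c *\<^sub>C a \<in> S) \<and> (\<forall>a\<in>S. star a \<in> S)"

lemma cstar_subalgebra_iff: "cstar_subalgebra S \<longleftrightarrow> closed S \<and> star_subalg S"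
  by (auto simp: cstar_subalgebra_def star_subalg_def)

lemma star_subalg_UNIV [simp]: "star_subalg UNIV"
  by (simp add: star_subalg_def)

context
  fixes S :: "'a::cstar_algebra set"
  assumes S: "star_subalg S"
begin

lemma star_subalg_one [simp]: "1 \<in> S"
  and star_subalg_add: "a \<in> S \<Longrightarrow> b \<in> S \<Longrightarrow> a + b \<in> S"
  and star_subalg_mult: "a \<in> S \<Longrightarrow> b \<in> S \<Longrightarrow> a * b \<in> S"
  and star_subalg_scaleC: "a \<in> S \<Longrightarrow> c *\<^sub>C a \<in> S"
  and star_subalg_star: "a \<in> S \<Longrightarrow> star a \<in> S"
  using S by (auto simp: star_subalg_def)

lemma star_subalg_zero [simp]: "0 \<in> S"
  using star_subalg_scaleC[of 1 0] by simp

lemma star_subalg_scaleR: "a \<in> S \<Longrightarrow> r *\<^sub>R a \<in> S"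
  using star_subalg_scaleC[of a "of_real r"] by (simp add: scaleC_of_real)

lemma star_subalg_diff: "a \<in> S \<Longrightarrow> b \<in> S \<Longrightarrow> a - b \<in> S"
  using star_subalg_add[of a "(-1) *\<^sub>C b"] star_subalg_scaleC[of b "-1"]
  by (simp add: scaleC_minus_one)

lemma star_subalg_power: "a \<in> S \<Longrightarrow> a ^ n \<in> S"
  by (induction n) (auto intro: star_subalg_mult)

lemma star_subalg_sum: "(\<And>i. i \<in> I \<Longrightarrow> f i \<in> S) \<Longrightarrow> (\<Sum>i\<in>I. f i) \<in> S"
  by (induction I rule: infinite_finite_induct) (auto intro: star_subalg_add)

end

lemma clinear_on_sum:
  assumes "star_subalg S" "clinear_on S f" "\<And>i. i \<in> I \<Longrightarrow> g i \<in> S"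
  shows "f (\<Sum>i\<in>I. g i) = (\<Sum>i\<in>I. f (g i))"
proof -
  have f0: "f 0 = 0"
    using assms(2) star_subalg_zero[OF assms(1)] unfolding clinear_on_def by (metis scaleC_zero_left)
  show ?thesis
    using assms(3)
    by (induction I rule: infinite_finite_induct)
      (use assms(1,2) f0 in \<open>auto simp: clinear_on_def star_subalg_sum\<close>)
qed

lemma state_on_sum:
  assumes "star_subalg S" "state_on S \<phi>" "\<And>i. i \<in> I \<Longrightarrow> g i \<in> S"
  shows "\<phi> (\<Sum>i\<in>I. g i) = (\<Sum>i\<in>I. \<phi> (g i))"
proof -
  have f0: "\<phi> 0 = 0"
    using assms(2) star_subalg_zero[OF assms(1)] unfolding state_on_def by (metis mult_zero_left scaleC_zero_left)
  show ?thesis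
    using assms(3)
    by (induction I rule: infinite_finite_induct)
      (use assms(1,2) f0 in \<open>auto simp: state_on_def star_subalg_sum\<close>)
qed

section \<open>The binomial series\<close>

text \<open>The binomial series of (1 - x)^s; for x = 1 - B / r it represents (B / r)^s.\<close>

definition binpow :: "real \<Rightarrow> 'a::{real_normed_algebra_1,banach} \<Rightarrow> 'a" where
  "binpow s x = (\<Sum>n. (s gchoose n) *\<^sub>R (- x) ^ n)"

context
  fixes x :: "'a::{real_normed_algebra_1,banach}"
  assumes x: "norm x < 1"
begin

text \<open>The scalar series converges at a radius r strictly between \<open>norm x\<close> and 1,
  hence absolutely at \<open>norm x\<close>, where it dominates the terms in question.\<close>

lemma binpow_summable_norm: "summable (\<lambda>n. norm ((s gchoose n) *\<^sub>R (- x) ^ n))"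
proof -
  obtain r where r: "norm x < r" "r < 1"
    using x dense by blast
  then have "0 < r"
    by (meson le_less_trans norm_ge_zero)
  have "summable (\<lambda>n. (s gchoose n) * r ^ n)"
    using gen_binomial_real[of r s] r \<open>0 < r\<close> by (auto simp: sums_iff)
  then have "summable (\<lambda>n. norm ((s gchoose n) * norm x ^ n))"
    by (rule powser_insidea) (use r \<open>0 < r\<close> in simp)
  then show ?thesis
    by (rule summable_comparison_test'[where N = 0])
      (auto simp: abs_mult intro!: mult_left_mono norm_power_ineq[of "- x", simplified])
qed

lemma binpow_sums: "(\<lambda>n. (s gchoose n) *\<^sub>R (- x) ^ n) sums binpow s x"
  using summable_norm_cancel[OF binpow_summable_norm] by (simp add: binpow_def summable_sums)

text \<open>Absolute convergence permits the Cauchy product, and Vandermonde's identity evaluates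
  its coefficients.\<close>

lemma binpow_mult: "binpow s x * binpow t x = binpow (s + t) x"
proof -
  have "(\<Sum>i\<le>k. ((s gchoose i) *\<^sub>R (- x) ^ i) * ((t gchoose (k - i)) *\<^sub>R (- x) ^ (k - i)))
        = ((s + t) gchoose k) *\<^sub>R (- x) ^ k" for k
  proof -
    have "(\<Sum>i\<le>k. ((s gchoose i) *\<^sub>R (- x) ^ i) * ((t gchoose (k - i)) *\<^sub>R (- x) ^ (k - i)))
        = (\<Sum>i\<le>k. ((s gchoose i) * (t gchoose (k - i))) *\<^sub>R (- x) ^ k)"
      by (intro sum.cong) (auto simp flip: power_add)
    also have "\<dots> = ((s + t) gchoose k) *\<^sub>R (- x) ^ k"
      by (simp add: gbinomial_Vandermonde[of s t k, symmetric] atLeast0AtMost scaleR_sum_left[symmetric])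
    finally show ?thesis .
  qed
  then show ?thesis
    using Cauchy_product[OF binpow_summable_norm[of s] binpow_summable_norm[of t]]
    by (simp add: binpow_def)
qed

lemma binpow_0: "binpow 0 x = 1"
proof -
  have "(\<lambda>n. (0 gchoose n) *\<^sub>R (- x) ^ n) sums (\<Sum>n\<in>{0}. ((0::real) gchoose n) *\<^sub>R (- x) ^ n)"
    by (rule sums_finite) (auto simp: gbinomial_eq_0 gr0_conv_Suc elim!: not0_implies_Suc)
  then show ?thesis
    using binpow_sums[of 0] by (simp add: sums_unique2)
qed

lemma binpow_1: "binpow 1 x = 1 - x"
proof -
  have "((1::real) gchoose n) = 0" if "n \<notin> {0, 1}" for n
    using binomial_gbinomial[where 'a = real, of 1 n] that
    by (cases n) (auto simp: binomial_eq_0)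
  then have "(\<lambda>n. (1 gchoose n) *\<^sub>R (- x) ^ n) sums (\<Sum>n\<in>{0, 1}. ((1::real) gchoose n) *\<^sub>R (- x) ^ n)"
    by (intro sums_finite) auto
  then show ?thesis
    using binpow_sums[of 1] by (simp add: sums_unique2)
qed

lemma binpow_commute:
  assumes "a * x = x * a"
  shows "a * binpow s x = binpow s x * a"
proof -
  have "a * (- x) ^ n = (- x) ^ n * a" for n
    using power_commuting_commutes[of "- x" a n] assms by simp
  then have "(\<lambda>n. a * ((s gchoose n) *\<^sub>R (- x) ^ n)) = (\<lambda>n. ((s gchoose n) *\<^sub>R (- x) ^ n) * a)"
    by simp
  then show ?thesis
    using sums_mult[OF binpow_sums, of a s] sums_mult2[OF binpow_sums, of s a]
    by (simp add: sums_unique2)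
qed

end

lemma binpow_star:
  assumes "norm (x::'a::cstar_algebra) < 1" "star x = x"
  shows "star (binpow s x) = binpow s x"
proof -
  have "star (- x) = - x"
    using star_diff[of 0 x] star_diff[of 0 0] assms(2) by simp
  then have "(\<lambda>n. (s gchoose n) *\<^sub>R (- x) ^ n) sums star (binpow s x)"
    using bounded_linear.sums[OF bounded_linear_star binpow_sums[OF assms(1)], of s]
    by (simp add: star_scaleR star_power)
  then show ?thesis
    using binpow_sums[OF assms(1)] sums_unique2 by blast
qed

lemma binpow_mem:
  assumes "norm (x::'a::cstar_algebra) < 1" "x \<in> S" "star_subalg S" "closed S"
  shows "binpow s x \<in> S"
proof -
  have "- x \<in> S"
    using star_subalg_diff[OF assms(3), of 0 x] assms by simp
  then have "(\<Sum>i<n. (s gchoose i) *\<^sub>R (- x) ^ i) \<in> S" for n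
    by (intro star_subalg_sum star_subalg_scaleR star_subalg_power assms)
  then show ?thesis
    using binpow_sums[OF assms(1), of s] closed_sequentially[OF assms(4)]
    unfolding sums_def by metis
qed

text \<open>The square root of \<open>r - h\<close> shows that a state takes a value in \<open>{-r..r}\<close> on a self-adjoint \<open>h\<close>
  of norm less than \<open>r\<close>.\<close>

lemma state_on_bound:
  assumes S: "star_subalg S" "closed S" and \<phi>: "state_on S \<phi>" and a: "a \<in> S"
  shows "cmod (\<phi> (a::'a::cstar_algebra)) \<le> 2 * norm a"
proof -
  have add: "\<phi> (u + v) = \<phi> u + \<phi> v" and scale: "\<phi> (c *\<^sub>C u) = c * \<phi> u"
    and pos: "\<phi> (star u * u) \<in> \<real>\<^sub>\<ge>\<^sub>0" and one: "\<phi> 1 = 1" if "u \<in> S" "v \<in> S" for u v c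
    using \<phi> that by (auto simp: state_on_def)
  have scaleR: "\<phi> (r *\<^sub>R u) = r * \<phi> u" if "u \<in> S" for r u
    using scale[of u u "of_real r"] that by (simp add: scaleC_of_real)
  have half: "\<phi> (of_real r - h) \<in> \<real>\<^sub>\<ge>\<^sub>0" if h: "h \<in> S" "star h = h" "norm h < r" for r h
  proof -
    have r: "r > 0"
      using that norm_ge_zero[of h] by linarith
    define x where "x = h /\<^sub>R r"
    have x: "norm x < 1" "star x = x" "x \<in> S"
      using that r S by (auto simp: x_def star_scaleR field_simps intro: star_subalg_scaleR)
    note b = binpow_mem[OF x(1,3) S, of "1/2"]
    have "of_real r - h = r *\<^sub>R (1 - x)"
      using r by (simp add: x_def scaleR_diff_right of_real_def)
    also have "\<dots> = r *\<^sub>R (star (binpow (1/2) x) * binpow (1/2) x)"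
      using x by (simp add: binpow_star binpow_mult binpow_1)
    finally show ?thesis
      using pos[OF b b] r
      by (simp add: scaleR complex_nonneg_Reals_iff star_subalg_mult[OF S(1)] star_subalg_star[OF S(1)] b)
  qed
  have sa: "cmod (\<phi> h) \<le> norm h" if h: "h \<in> S" "star h = h" for h
  proof (rule dense_ge)
    fix r assume r: "norm h < r"
    have mh: "star (- h) = - h"
      using star_diff[of 0 h] star_diff[of 0 0] h(2) by simp
    note mem = h(1) star_subalg_diff[OF S(1) _ h(1), of 0] star_subalg_scaleR[OF S(1), of 1 r] S(1)
    have "\<phi> (of_real r - h) = of_real r - \<phi> h" "\<phi> (of_real r - (- h)) = of_real r + \<phi> h"
      using add[of "of_real r" h] add[of "of_real r" "- h"] one[of 1 1] scale[of h h "-1"] scaleR[of 1 r] mem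
      by (simp_all add: of_real_def scaleC_minus_one)
    then have "of_real r - \<phi> h \<in> \<real>\<^sub>\<ge>\<^sub>0" "of_real r + \<phi> h \<in> \<real>\<^sub>\<ge>\<^sub>0"
      using half[of h r] half[of "- h" r] r h mh mem by simp_all
    then show "cmod (\<phi> h) \<le> r"
      by (auto simp: complex_nonneg_Reals_iff cmod_eq_Re)
  qed
  \<comment> \<open>In the Cartesian decomposition a = h + i k both parts have norm at most
    \<open>norm a\<close>; bounding them separately produces the factor 2.\<close>
  define h k where "h = (1/2) *\<^sub>C (a + star a)" and "k = (\<i>/2) *\<^sub>C (star a - a)"
  have "star h = h" "star k = k"
    by (simp_all add: h_def k_def star_scaleC star_add star_diff star_star add.commute
        flip: scaleC_minus_one)
      (simp_all add: scaleC_scaleC scaleC_add_right diff_conv_add_uminus flip: scaleC_minus_one)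
  moreover have "h \<in> S" "k \<in> S"
    unfolding h_def k_def
    by (intro star_subalg_scaleC star_subalg_add star_subalg_diff star_subalg_star S a)+
  moreover have "norm h \<le> norm a" "norm k \<le> norm a"
    using norm_triangle_ineq[of a "star a"] norm_triangle_ineq4[of "star a" a]
    by (auto simp: h_def k_def norm_scaleC norm_divide)
  moreover have "a = h + \<i> *\<^sub>C k"
  proof -
    have "h + \<i> *\<^sub>C k = (1/2) *\<^sub>C a + (1/2) *\<^sub>C a + ((1/2) *\<^sub>C star a + (-(1/2)) *\<^sub>C star a)"
      by (simp add: h_def k_def scaleC_scaleC scaleC_add_right diff_conv_add_uminus ac_simps
          flip: scaleC_minus_one)
    then show ?thesis
      by (simp flip: scaleC_add_left)
  qed
  ultimately show ?thesis
    using sa[of h] sa[of k] norm_triangle_ineq[of "\<phi> h" "\<i> * \<phi> k"]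
    by (auto simp: add scale norm_mult star_subalg_scaleC[OF S(1)])
qed

section \<open>Products of commuting elements\<close>

lemma cprod_empty [simp]: "cprod f {} = 1"
  by (simp add: cprod_def)

lemma cprod_insert:
  assumes "finite F" "x \<notin> F"
    and "\<And>i j. i \<in> insert x F \<Longrightarrow> j \<in> insert x F \<Longrightarrow> f i * f j = f j * f i"
  shows "cprod f (insert x F) = f x * cprod f F"
proof -
  interpret comp_fun_commute_on "insert x F" "\<lambda>i p. f i * p"
    by unfold_locales (use assms(3) in \<open>auto simp: fun_eq_iff simp flip: mult.assoc\<close>)
  show ?thesis
    using assms by (simp add: cprod_def)
qed

lemma cprod_induct:
  assumes "finite F" and comm: "\<And>i j. i \<in> F \<Longrightarrow> j \<in> F \<Longrightarrow> f i * f j = f j * f i"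
    and "P 1" "\<And>i p. i \<in> F \<Longrightarrow> P p \<Longrightarrow> P (f i * p)"
  shows "P (cprod f F)"
proof -
  \<comment> \<open>Growing a subset of the fixed set F keeps the commutation hypothesis available
    at every insertion.\<close>
  have "P (cprod f G)" if "G \<subseteq> F" for G
    using finite_subset[OF that assms(1)] that
  proof (induction G rule: finite_induct)
    case (insert x G)
    then have "cprod f (insert x G) = f x * cprod f G"
      by (intro cprod_insert comm) auto
    then show ?case using insert assms by simp
  qed (simp add: assms)
  then show ?thesis by simp
qed

lemma invertible_elem_mult:
  assumes "invertible_elem a" "invertible_elem b"
  shows "invertible_elem (a * b)"
proof -
  obtain a' b' where "a * a' = 1" "a' * a = 1" "b * b' = 1" "b' * b = 1"
    using assms by (auto simp: invertible_elem_def)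
  then have "(a * b) * (b' * a') = 1" "(b' * a') * (a * b) = 1"
    by (metis mult.assoc mult_1)+
  then show ?thesis unfolding invertible_elem_def by blast
qed

section \<open>Positive semidefinite kernels\<close>

text \<open>The form itself, not just its real part, is required to be a nonnegative real; this
  makes Hermitian symmetry a consequence.\<close>

definition psd_kernel :: "'i set \<Rightarrow> ('i \<Rightarrow> 'i \<Rightarrow> complex) \<Rightarrow> bool" where
  "psd_kernel I K \<longleftrightarrow> (\<forall>v. (\<Sum>i\<in>I. \<Sum>j\<in>I. cnj (v i) * K i j * v j) \<in> \<real>\<^sub>\<ge>\<^sub>0)"

text \<open>Isolates the dependence on the value c at the new index, so that c can be chosen to
  complete the square.\<close>

lemma psd_kernel_insert_form:
  assumes "finite I" "a \<notin> I"
  shows "(\<Sum>i\<in>insert a I. \<Sum>j\<in>insert a I. cnj ((v(a := c)) i) * K i j * (v(a := c)) j) =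
     (\<Sum>i\<in>I. \<Sum>j\<in>I. cnj (v i) * K i j * v j)
       + cnj c * (\<Sum>j\<in>I. K a j * v j) + c * (\<Sum>i\<in>I. cnj (v i) * K i a) + cnj c * c * K a a"
proof -
  define w where "w = v(a := c)"
  have w: "w a = c" "\<And>i. i \<in> I \<Longrightarrow> w i = v i"
    using assms(2) by (auto simp: w_def)
  have split: "(\<Sum>i\<in>insert a I. \<Sum>j\<in>insert a I. f i j)
      = (\<Sum>i\<in>I. \<Sum>j\<in>I. f i j) + (\<Sum>j\<in>I. f a j) + (\<Sum>i\<in>I. f i a) + f a a" for f :: "'a \<Rightarrow> 'a \<Rightarrow> complex"
    using assms by (simp add: sum.distrib add_ac)
  have "(\<Sum>i\<in>I. \<Sum>j\<in>I. cnj (w i) * K i j * w j) = (\<Sum>i\<in>I. \<Sum>j\<in>I. cnj (v i) * K i j * v j)"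
    and "(\<Sum>j\<in>I. cnj (w a) * K a j * w j) = cnj c * (\<Sum>j\<in>I. K a j * v j)"
    and "(\<Sum>i\<in>I. cnj (w i) * K i a * w a) = c * (\<Sum>i\<in>I. cnj (v i) * K i a)"
    unfolding sum_distrib_left by (auto simp: w mult_ac intro!: sum.cong)
  then show ?thesis
    unfolding w_def[symmetric] split by (simp add: w mult_ac)
qed

lemma psd_kernel_subset:
  assumes "psd_kernel J K" "I \<subseteq> J" "finite J"
  shows "psd_kernel I K"
  unfolding psd_kernel_def
proof
  fix v :: "'a \<Rightarrow> complex"
  define w where "w i = (if i \<in> I then v i else 0)" for i
  have "(\<Sum>j\<in>J. cnj (w i) * K i j * w j) = (\<Sum>j\<in>I. cnj (w i) * K i j * w j)" for i
    by (rule sum.mono_neutral_right[OF assms(3,2)]) (simp add: w_def)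
  then have "(\<Sum>i\<in>J. \<Sum>j\<in>J. cnj (w i) * K i j * w j) = (\<Sum>i\<in>J. \<Sum>j\<in>I. cnj (w i) * K i j * w j)"
    by simp
  also have "\<dots> = (\<Sum>i\<in>I. \<Sum>j\<in>I. cnj (w i) * K i j * w j)"
    by (rule sum.mono_neutral_right[OF assms(3,2)]) (simp add: w_def)
  also have "\<dots> = (\<Sum>i\<in>I. \<Sum>j\<in>I. cnj (v i) * K i j * v j)"
    by (intro sum.cong refl) (simp add: w_def)
  finally show "(\<Sum>i\<in>I. \<Sum>j\<in>I. cnj (v i) * K i j * v j) \<in> \<real>\<^sub>\<ge>\<^sub>0"
    using assms(1)[unfolded psd_kernel_def, rule_format, of w] by simp
qed

lemma psd_kernel_diag:
  assumes "psd_kernel I K" "finite I" "a \<in> I"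
  shows "K a a \<in> \<real>\<^sub>\<ge>\<^sub>0"
proof -
  have "psd_kernel {a} K" using assms by (auto intro: psd_kernel_subset)
  then show ?thesis unfolding psd_kernel_def by (auto dest: spec[of _ "\<lambda>_. 1"])
qed

lemma psd_kernel_two_point:
  assumes "psd_kernel I K" "finite I" "a \<in> I" "b \<in> I" "a \<noteq> b"
  shows "K b b + cnj c * K a b + c * K b a + cnj c * c * K a a \<in> \<real>\<^sub>\<ge>\<^sub>0"
proof -
  have "psd_kernel {a, b} K" using assms by (auto intro: psd_kernel_subset)
  then have "(\<Sum>i\<in>{a, b}. \<Sum>j\<in>{a, b}. cnj (((\<lambda>_. 1)(a := c)) i) * K i j * ((\<lambda>_. 1)(a := c)) j) \<in> \<real>\<^sub>\<ge>\<^sub>0"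
    unfolding psd_kernel_def by blast
  then show ?thesis
    using psd_kernel_insert_form[of "{b}" a "\<lambda>_. 1" c K] assms(5) by (simp add: add_ac mult_ac)
qed

text \<open>The two-point forms at c = 1 and c = i are real; their imaginary parts give the two
  components of the symmetry.\<close>

lemma psd_kernel_hermitian:
  assumes "psd_kernel I K" "finite I" "a \<in> I" "b \<in> I"
  shows "K b a = cnj (K a b)"
proof (cases "a = b")
  case True
  then show ?thesis
    using psd_kernel_diag[OF assms(1-3)] by (auto simp: complex_nonneg_Reals_iff complex_eq_iff)
next
  case False
  then show ?thesis
    using psd_kernel_two_point[OF assms False, of 1] psd_kernel_two_point[OF assms False, of \<i>]
      psd_kernel_diag[OF assms(1-3)] psd_kernel_diag[OF assms(1,2,4)]
    by (auto simp: complex_nonneg_Reals_iff complex_eq_iff)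
qed

lemma psd_kernel_diag_0:
  assumes "psd_kernel I K" "finite I" "a \<in> I" "b \<in> I" "K a a = 0"
  shows "K a b = 0"
proof (rule ccontr)
  assume *: "K a b \<noteq> 0"
  then have "a \<noteq> b" using assms by auto
  define s where "s = (cmod (K a b))\<^sup>2"
  have "s > 0" using * by (simp add: s_def)
  \<comment> \<open>With this c each cross term equals -(K b b + 1), while \<open>K a a = 0\<close>
    removes the quadratic term, so the form takes the negative value -K b b - 2.\<close>
  define c where "c = - of_real ((Re (K b b) + 1) / s) * K a b"
  have ss: "K a b * cnj (K a b) = of_real s"
    by (simp add: s_def complex_norm_square del: of_real_power)
  have "c * K b a = - of_real ((Re (K b b) + 1) / s) * (K a b * cnj (K a b))"
    by (simp add: c_def psd_kernel_hermitian[OF assms(1-4)] mult.assoc)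
  then have cK: "c * K b a = - of_real (Re (K b b) + 1)"
    using \<open>s > 0\<close> unfolding ss by simp
  have "cnj c * K a b = cnj (c * K b a)"
    by (simp add: psd_kernel_hermitian[OF assms(1-4)])
  then have cK': "cnj c * K a b = - of_real (Re (K b b) + 1)"
    unfolding cK by simp
  then have "Re (K b b) - 2 * (Re (K b b) + 1) \<ge> 0"
    using psd_kernel_two_point[OF assms(1-4) \<open>a \<noteq> b\<close>, of c] assms(5) cK cK'
    by (simp add: complex_nonneg_Reals_iff)
  then show False
    using psd_kernel_diag[OF assms(1,2,4)] by (auto simp: complex_nonneg_Reals_iff)
qed

text \<open>Cholesky factorization.  Division by zero makes the Schur complement formula also cover a
  vanishing pivot, whose row and column vanish.\<close>

lemma psd_kernel_gram:
  assumes "finite I" "psd_kernel I K"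
  shows "\<exists>D. \<forall>i\<in>I. \<forall>j\<in>I. K i j = (\<Sum>k\<in>I. cnj (D k i) * D k j)"
  using assms
proof (induction I arbitrary: K rule: finite_induct)
  case (insert a I)
  let ?J = "insert a I"
  define p where "p = Re (K a a)"
  have Kaa: "K a a = of_real p" and "p \<ge> 0"
    using psd_kernel_diag[OF insert.prems, of a] insert.hyps
    by (auto simp: p_def complex_nonneg_Reals_iff complex_eq_iff)
  have herm: "K j i = cnj (K i j)" if "i \<in> ?J" "j \<in> ?J" for i j
    using psd_kernel_hermitian[OF insert.prems] insert.hyps that by blast
  have p0: "K a j = 0" if "p = 0" "j \<in> ?J" for j
    using psd_kernel_diag_0[OF insert.prems, of a j] that insert.hyps by (simp add: Kaa)
  define K' where "K' i j = K i j - K i a * K a j / K a a" for i j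
  have "psd_kernel I K'"
    unfolding psd_kernel_def
  proof
    fix v
    define L where "L = (\<Sum>j\<in>I. K a j * v j)"
    have L': "(\<Sum>i\<in>I. cnj (v i) * K i a) = cnj L"
      unfolding L_def cnj_sum by (intro sum.cong) (auto simp: herm[of a])
    have "(\<Sum>i\<in>I. \<Sum>j\<in>I. cnj (v i) * K' i j * v j) =
       (\<Sum>i\<in>I. \<Sum>j\<in>I. cnj (v i) * K i j * v j) - (\<Sum>i\<in>I. \<Sum>j\<in>I. cnj (v i) * K i a * (K a j * v j)) / K a a"
    proof -
      have "cnj (v i) * K' i j * v j = cnj (v i) * K i j * v j - cnj (v i) * K i a * (K a j * v j) / K a a" for i j
        by (simp add: K'_def ring_distribs)
      then show ?thesis
        by (simp only: sum_subtractf sum_divide_distrib)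
    qed
    also have "(\<Sum>i\<in>I. \<Sum>j\<in>I. cnj (v i) * K i a * (K a j * v j)) = cnj L * L"
      by (subst L'[symmetric]) (simp only: L_def sum_product)
    \<comment> \<open>For a positive pivot, -L / K a a is the value at the new index that minimizes
      the form, so the form of the Schur complement is a value of the form on the larger set. For p
      = 0 all quotients are 0 and both sides agree.\<close>
    also have "(\<Sum>i\<in>I. \<Sum>j\<in>I. cnj (v i) * K i j * v j) - cnj L * L / K a a =
      (\<Sum>i\<in>I. \<Sum>j\<in>I. cnj (v i) * K i j * v j)
       + cnj (- L / K a a) * L + (- L / K a a) * cnj L + cnj (- L / K a a) * (- L / K a a) * K a a"
    proof (cases "p = 0")
      case False
      then have "cnj (- L / K a a) * (- L / K a a) * K a a = cnj L * L / K a a"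
        by (simp add: Kaa)
      moreover have "cnj (- L / K a a) * L = - (cnj L * L / K a a)" "(- L / K a a) * cnj L = - (cnj L * L / K a a)"
        by (simp_all add: Kaa mult.commute)
      ultimately show ?thesis by (simp only:) simp
    qed (simp add: Kaa)
    also have "\<dots> = (\<Sum>i\<in>?J. \<Sum>j\<in>?J. cnj ((v(a := - L / K a a)) i) * K i j * (v(a := - L / K a a)) j)"
      unfolding psd_kernel_insert_form[OF insert.hyps(1,2)] L' L_def ..
    also have "\<dots> \<in> \<real>\<^sub>\<ge>\<^sub>0"
      using insert.prems unfolding psd_kernel_def by blast
    finally show "(\<Sum>i\<in>I. \<Sum>j\<in>I. cnj (v i) * K' i j * v j) \<in> \<real>\<^sub>\<ge>\<^sub>0" .
  qed
  then obtain D where D: "\<And>i j. i \<in> I \<Longrightarrow> j \<in> I \<Longrightarrow> K' i j = (\<Sum>k\<in>I. cnj (D k i) * D k j)"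
    using insert.IH by blast
  \<comment> \<open>Row a is the pivot row divided by sqrt p; the remaining rows factor the Schur
    complement and vanish in column a.\<close>
  define D' where "D' k j = (if k = a then K a j / of_real (sqrt p) else if j = a then 0 else D k j)" for k j
  have sq: "cnj (D' a i) * D' a j = K i a * K a j / K a a" if "i \<in> ?J" for i j
    using that herm[of a i] \<open>p \<ge> 0\<close> by (simp add: D'_def Kaa flip: of_real_mult)
  have "K i j = (\<Sum>k\<in>?J. cnj (D' k i) * D' k j)" if "i \<in> ?J" "j \<in> ?J" for i j
  proof (cases "i = a \<or> j = a")
    case True
    then have "(\<Sum>k\<in>I. cnj (D' k i) * D' k j) = 0"
      using insert.hyps by (intro sum.neutral) (auto simp: D'_def)
    moreover have "K i a * K a j / K a a = K i j"
      using True p0[of i] p0[of j] herm[of a i] that by (auto simp: Kaa)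
    ultimately show ?thesis
      using insert.hyps sq that by simp
  next
    case False
    have "(\<Sum>k\<in>I. cnj (D' k i) * D' k j) = K' i j"
      using False insert.hyps that D by (auto simp: D'_def intro!: sum.cong)
    then show ?thesis
      using insert.hyps sq that by (simp add: K'_def)
  qed
  then show ?case by blast
qed auto

text \<open>A Gram factor turns the form into a sum of squared moduli, one for each k in Q; the size
  of Q is unrelated to that of I.\<close>

lemma psd_kernel_gramI:
  assumes "\<And>i j. i \<in> I \<Longrightarrow> j \<in> I \<Longrightarrow> K i j = (\<Sum>k\<in>Q. cnj (D k i) * D k j)"
  shows "psd_kernel I K"
  unfolding psd_kernel_def
proof
  fix v
  have "(\<Sum>i\<in>I. \<Sum>j\<in>I. cnj (v i) * K i j * v j)
      = (\<Sum>i\<in>I. \<Sum>k\<in>Q. \<Sum>j\<in>I. cnj (D k i * v i) * (D k j * v j))"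
  proof (intro sum.cong refl)
    fix i assume "i \<in> I"
    then have "(\<Sum>j\<in>I. cnj (v i) * K i j * v j) = (\<Sum>j\<in>I. \<Sum>k\<in>Q. cnj (D k i * v i) * (D k j * v j))"
      by (intro sum.cong refl) (simp add: assms sum_distrib_left sum_distrib_right mult_ac)
    then show "(\<Sum>j\<in>I. cnj (v i) * K i j * v j) = (\<Sum>k\<in>Q. \<Sum>j\<in>I. cnj (D k i * v i) * (D k j * v j))"
      by (subst (asm) sum.swap)
  qed
  also have "\<dots> = (\<Sum>k\<in>Q. \<Sum>i\<in>I. \<Sum>j\<in>I. cnj (D k i * v i) * (D k j * v j))"
    by (rule sum.swap)
  also have "\<dots> = (\<Sum>k\<in>Q. cnj (\<Sum>i\<in>I. D k i * v i) * (\<Sum>i\<in>I. D k i * v i))"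
    by (simp add: sum_product)
  also have "\<dots> = of_real (\<Sum>k\<in>Q. (cmod (\<Sum>i\<in>I. D k i * v i))\<^sup>2)"
    unfolding of_real_sum complex_norm_square by (simp only: mult.commute)
  also have "\<dots> \<in> \<real>\<^sub>\<ge>\<^sub>0"
    by (subst nonneg_Reals_of_real_iff) (simp add: sum_nonneg)
  finally show "(\<Sum>i\<in>I. \<Sum>j\<in>I. cnj (v i) * K i j * v j) \<in> \<real>\<^sub>\<ge>\<^sub>0" .
qed

section \<open>Local algebras\<close>

locale quasi_local =
  fixes d :: "'v \<Rightarrow> nat" and \<pi> :: "'v set \<Rightarrow> 'v cmat \<Rightarrow> 'a::cstar_algebra"
  assumes quasi_local: "quasi_local_algebra d \<pi>"
begin

abbreviation alg :: "'v set \<Rightarrow> 'a set" where "alg \<equiv> local_alg d \<pi>"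

lemma d_pos: "0 < d x"
  using quasi_local by (simp add: quasi_local_algebra_def)

lemma star_embedding: "finite \<Lambda> \<Longrightarrow> star_embedding d \<Lambda> (\<pi> \<Lambda>)"
  using quasi_local by (simp add: quasi_local_algebra_def)

lemma ampliate_eq: "finite \<Lambda>' \<Longrightarrow> \<Lambda> \<subseteq> \<Lambda>' \<Longrightarrow> M \<in> mats d \<Lambda> \<Longrightarrow> \<pi> \<Lambda>' (ampliate d \<Lambda> \<Lambda>' M) = \<pi> \<Lambda> M"
  using quasi_local unfolding quasi_local_algebra_def by blast

lemma finite_configs [simp]: "finite \<Lambda> \<Longrightarrow> finite (configs d \<Lambda>)"
  by (simp add: configs_def finite_PiE)

lemma configs_nonempty: "configs d \<Lambda> \<noteq> {}"
  using d_pos by (auto simp: configs_def PiE_eq_empty_iff)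

lemma configs_restrict: "\<omega> \<in> configs d \<Lambda>' \<Longrightarrow> \<Lambda> \<subseteq> \<Lambda>' \<Longrightarrow> restrict \<omega> \<Lambda> \<in> configs d \<Lambda>"
  by (auto simp: configs_def PiE_iff)

lemma ampliate_mats: "\<Lambda> \<subseteq> \<Lambda>' \<Longrightarrow> ampliate d \<Lambda> \<Lambda>' M \<in> mats d \<Lambda>'"
  by (auto simp: mats_def ampliate_def)

lemma mat_mult_mats: "M \<in> mats d \<Lambda> \<Longrightarrow> N \<in> mats d \<Lambda> \<Longrightarrow> mat_mult d \<Lambda> M N \<in> mats d \<Lambda>"
  by (auto simp: mats_def mat_mult_def intro!: sum.neutral)

lemma mat_one_mats: "mat_one d \<Lambda> \<in> mats d \<Lambda>"
  by (auto simp: mats_def mat_one_def)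

lemma mat_adj_mats: "M \<in> mats d \<Lambda> \<Longrightarrow> mat_adj M \<in> mats d \<Lambda>"
  by (auto simp: mats_def mat_adj_def)

lemma mats_add: "M \<in> mats d \<Lambda> \<Longrightarrow> N \<in> mats d \<Lambda> \<Longrightarrow> (\<lambda>\<omega> \<eta>. M \<omega> \<eta> + N \<omega> \<eta>) \<in> mats d \<Lambda>"
  and mats_scale: "M \<in> mats d \<Lambda> \<Longrightarrow> (\<lambda>\<omega> \<eta>. c * M \<omega> \<eta>) \<in> mats d \<Lambda>"
  and mats_zero: "(\<lambda>_ _. 0) \<in> mats d \<Lambda>"
  by (auto simp: mats_def)

section \<open>The *-embedding of one finite region\<close>

context
  fixes \<Lambda> :: "'v set"
  assumes fin: "finite \<Lambda>"
begin

lemma pi_one: "\<pi> \<Lambda> (mat_one d \<Lambda>) = 1"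
  and pi_add: "M \<in> mats d \<Lambda> \<Longrightarrow> N \<in> mats d \<Lambda> \<Longrightarrow> \<pi> \<Lambda> (\<lambda>\<omega> \<eta>. M \<omega> \<eta> + N \<omega> \<eta>) = \<pi> \<Lambda> M + \<pi> \<Lambda> N"
  and pi_mult: "M \<in> mats d \<Lambda> \<Longrightarrow> N \<in> mats d \<Lambda> \<Longrightarrow> \<pi> \<Lambda> (mat_mult d \<Lambda> M N) = \<pi> \<Lambda> M * \<pi> \<Lambda> N"
  and pi_scale: "M \<in> mats d \<Lambda> \<Longrightarrow> \<pi> \<Lambda> (\<lambda>\<omega> \<eta>. c * M \<omega> \<eta>) = c *\<^sub>C \<pi> \<Lambda> M"
  and pi_adj: "M \<in> mats d \<Lambda> \<Longrightarrow> \<pi> \<Lambda> (mat_adj M) = star (\<pi> \<Lambda> M)"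
  and pi_inj: "inj_on (\<pi> \<Lambda>) (mats d \<Lambda>)"
  using star_embedding[OF fin] unfolding star_embedding_def by blast+

lemma pi_zero: "\<pi> \<Lambda> (\<lambda>_ _. 0) = 0"
  using pi_scale[of "\<lambda>_ _. 0" 0] by (simp add: mats_zero)

lemma pi_sum:
  assumes "\<And>i. i \<in> I \<Longrightarrow> M i \<in> mats d \<Lambda>"
  shows "\<pi> \<Lambda> (\<lambda>\<omega> \<eta>. \<Sum>i\<in>I. M i \<omega> \<eta>) = (\<Sum>i\<in>I. \<pi> \<Lambda> (M i))"
proof -
  have "(\<lambda>\<omega> \<eta>. \<Sum>i\<in>I. M i \<omega> \<eta>) \<in> mats d \<Lambda> \<and> ?thesis"
    using assms
  proof (induction I rule: infinite_finite_induct)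
    case (insert x F)
    then have F: "(\<lambda>\<omega> \<eta>. \<Sum>i\<in>F. M i \<omega> \<eta>) \<in> mats d \<Lambda>" "M x \<in> mats d \<Lambda>"
      "\<pi> \<Lambda> (\<lambda>\<omega> \<eta>. \<Sum>i\<in>F. M i \<omega> \<eta>) = (\<Sum>i\<in>F. \<pi> \<Lambda> (M i))"
      by auto
    have "(\<lambda>\<omega> \<eta>. \<Sum>i\<in>insert x F. M i \<omega> \<eta>) = (\<lambda>\<omega> \<eta>. M x \<omega> \<eta> + (\<Sum>i\<in>F. M i \<omega> \<eta>))"
      using insert.hyps by simp
    then show ?case
      using mats_add[OF F(2,1)] pi_add[OF F(2,1)] F(3) insert.hyps by simp
  qed (simp_all add: pi_zero mats_zero)
  then show ?thesis ..
qed

lemma alg_star_subalg: "star_subalg (alg \<Lambda>)"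
  unfolding star_subalg_def
proof (intro conjI ballI allI)
  show "1 \<in> alg \<Lambda>"
    unfolding local_alg_def by (rule image_eqI[where x = "mat_one d \<Lambda>"]) (simp_all add: pi_one mat_one_mats)
next
  fix a b assume "a \<in> alg \<Lambda>" "b \<in> alg \<Lambda>"
  then obtain M N where M: "M \<in> mats d \<Lambda>" "a = \<pi> \<Lambda> M" and N: "N \<in> mats d \<Lambda>" "b = \<pi> \<Lambda> N"
    by (auto simp: local_alg_def)
  show "a + b \<in> alg \<Lambda>"
    unfolding local_alg_def M(2) N(2) pi_add[OF M(1) N(1), symmetric] by (rule imageI[OF mats_add[OF M(1) N(1)]])
  show "a * b \<in> alg \<Lambda>"
    unfolding local_alg_def M(2) N(2) pi_mult[OF M(1) N(1), symmetric] by (rule imageI[OF mat_mult_mats[OF M(1) N(1)]])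
next
  fix c a assume "a \<in> alg \<Lambda>"
  then obtain M where M: "M \<in> mats d \<Lambda>" "a = \<pi> \<Lambda> M"
    by (auto simp: local_alg_def)
  show "c *\<^sub>C a \<in> alg \<Lambda>"
    unfolding local_alg_def M(2) pi_scale[OF M(1), symmetric] by (rule imageI[OF mats_scale[OF M(1)]])
next
  fix a assume "a \<in> alg \<Lambda>"
  then obtain M where M: "M \<in> mats d \<Lambda>" "a = \<pi> \<Lambda> M"
    by (auto simp: local_alg_def)
  show "star a \<in> alg \<Lambda>"
    unfolding local_alg_def M(2) pi_adj[OF M(1), symmetric] by (rule imageI[OF mat_adj_mats[OF M(1)]])
qed

end

lemma alg_mono:
  assumes "\<Lambda> \<subseteq> \<Lambda>'" "finite \<Lambda>'"
  shows "alg \<Lambda> \<subseteq> alg \<Lambda>'"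
proof
  fix a assume "a \<in> alg \<Lambda>"
  then obtain M where "M \<in> mats d \<Lambda>" "a = \<pi> \<Lambda> M"
    by (auto simp: local_alg_def)
  then show "a \<in> alg \<Lambda>'"
    unfolding local_alg_def using ampliate_eq[OF assms(2,1)] ampliate_mats[OF assms(1)]
    by (metis imageI)
qed

subsection \<open>Tensor products\<close>

text \<open>The Kronecker product in configuration coordinates, meant for disjoint regions. Its
  symmetry in the two factors is the reason why algebras of disjoint regions commute.\<close>

definition tens :: "'v set \<Rightarrow> 'v set \<Rightarrow> 'v cmat \<Rightarrow> 'v cmat \<Rightarrow> 'v cmat" where
  "tens \<Lambda> \<Gamma> M N = (\<lambda>\<omega> \<eta>. if \<omega> \<in> configs d (\<Lambda> \<union> \<Gamma>) \<and> \<eta> \<in> configs d (\<Lambda> \<union> \<Gamma>)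
     then M (restrict \<omega> \<Lambda>) (restrict \<eta> \<Lambda>) * N (restrict \<omega> \<Gamma>) (restrict \<eta> \<Gamma>) else 0)"

lemma mat_mult_ampliate:
  assumes "finite \<Lambda>" "finite \<Gamma>" "\<Lambda> \<inter> \<Gamma> = {}"
  shows "mat_mult d (\<Lambda> \<union> \<Gamma>) (ampliate d \<Lambda> (\<Lambda> \<union> \<Gamma>) M) (ampliate d \<Gamma> (\<Lambda> \<union> \<Gamma>) N) = tens \<Lambda> \<Gamma> M N"
proof (intro ext)
  fix \<omega> \<eta>
  let ?U = "\<Lambda> \<union> \<Gamma>"
  show "mat_mult d ?U (ampliate d \<Lambda> ?U M) (ampliate d \<Gamma> ?U N) \<omega> \<eta> = tens \<Lambda> \<Gamma> M N \<omega> \<eta>"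
  proof (cases "\<omega> \<in> configs d ?U \<and> \<eta> \<in> configs d ?U")
    case True
    \<comment> \<open>The first factor forces an intermediate configuration to agree with \<omega>
      on \<Gamma>, the second forces it to agree with \<eta> on \<Lambda>; only this one
      contributes.\<close>
    define \<zeta> where "\<zeta> = (\<lambda>x. if x \<in> \<Lambda> then \<eta> x else \<omega> x)"
    have \<zeta>: "\<zeta> \<in> configs d ?U"
      using True by (auto simp: configs_def \<zeta>_def PiE_iff extensional_def)
    have r: "restrict \<zeta> \<Lambda> = restrict \<eta> \<Lambda>" "restrict \<zeta> \<Gamma> = restrict \<omega> \<Gamma>"
      using assms(3) by (auto simp: \<zeta>_def restrict_def fun_eq_iff)
    have "ampliate d \<Lambda> ?U M \<omega> \<zeta>' * ampliate d \<Gamma> ?U N \<zeta>' \<eta> = 0"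
      if "\<zeta>' \<in> configs d ?U - {\<zeta>}" for \<zeta>'
    proof (rule ccontr)
      assume "\<not> ?thesis"
      then have "\<forall>x\<in>?U - \<Lambda>. \<omega> x = \<zeta>' x" "\<forall>x\<in>?U - \<Gamma>. \<zeta>' x = \<eta> x"
        by (auto simp: ampliate_def split: if_splits)
      then have "\<zeta>' x = \<zeta> x" for x
        using that True assms(3)
        by (cases "x \<in> ?U") (auto simp: \<zeta>_def configs_def PiE_iff extensional_def)
      then show False using that by auto
    qed
    then have "mat_mult d ?U (ampliate d \<Lambda> ?U M) (ampliate d \<Gamma> ?U N) \<omega> \<eta>
      = (\<Sum>\<zeta>'\<in>{\<zeta>}. ampliate d \<Lambda> ?U M \<omega> \<zeta>' * ampliate d \<Gamma> ?U N \<zeta>' \<eta>)"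
      unfolding mat_mult_def using \<zeta> assms by (intro sum.mono_neutral_right) auto
    also have "\<dots> = tens \<Lambda> \<Gamma> M N \<omega> \<eta>"
      using True \<zeta> assms(3) by (auto simp: ampliate_def tens_def r \<zeta>_def[THEN fun_cong])
    finally show ?thesis .
  next
    case False
    then show ?thesis by (auto simp: mat_mult_def tens_def ampliate_def)
  qed
qed

lemma tens_commute: "tens \<Lambda> \<Gamma> M N = tens \<Gamma> \<Lambda> N M"
  by (auto simp: tens_def fun_eq_iff Un_commute mult.commute)

lemma pi_tens:
  assumes "finite \<Lambda>" "finite \<Gamma>" "\<Lambda> \<inter> \<Gamma> = {}" "M \<in> mats d \<Lambda>" "N \<in> mats d \<Gamma>"
  shows "\<pi> \<Lambda> M * \<pi> \<Gamma> N = \<pi> (\<Lambda> \<union> \<Gamma>) (tens \<Lambda> \<Gamma> M N)"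
  using assms
  by (simp add: pi_mult ampliate_mats ampliate_eq flip: mat_mult_ampliate)

lemma alg_commute:
  assumes "finite \<Lambda>" "finite \<Gamma>" "\<Lambda> \<inter> \<Gamma> = {}" "a \<in> alg \<Lambda>" "b \<in> alg \<Gamma>"
  shows "a * b = b * a"
proof -
  obtain M N where "M \<in> mats d \<Lambda>" "a = \<pi> \<Lambda> M" "N \<in> mats d \<Gamma>" "b = \<pi> \<Gamma> N"
    using assms(4,5) by (auto simp: local_alg_def)
  then show ?thesis
    using assms(1-3) by (simp add: pi_tens Int_commute Un_commute tens_commute[of \<Gamma> \<Lambda>])
qed

section \<open>Matrix units and the splitting of one site\<close>

definition unit_mat :: "('v \<Rightarrow> nat) \<Rightarrow> ('v \<Rightarrow> nat) \<Rightarrow> 'v cmat" where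
  "unit_mat \<alpha> \<beta> = (\<lambda>\<omega> \<eta>. if \<omega> = \<alpha> \<and> \<eta> = \<beta> then 1 else 0)"

lemma unit_mat_mats: "\<alpha> \<in> configs d \<Lambda> \<Longrightarrow> \<beta> \<in> configs d \<Lambda> \<Longrightarrow> unit_mat \<alpha> \<beta> \<in> mats d \<Lambda>"
  by (auto simp: mats_def unit_mat_def)

definition site_index :: "'v \<Rightarrow> (nat \<times> nat) set" where
  "site_index x = {..<d x} \<times> {..<d x}"

definition site_unit :: "'v \<Rightarrow> nat \<times> nat \<Rightarrow> 'a" where
  "site_unit x i = \<pi> {x} (unit_mat (\<lambda>z\<in>{x}. fst i) (\<lambda>z\<in>{x}. snd i))"

lemma site_config: "p < d x \<Longrightarrow> (\<lambda>z\<in>{x}. p) \<in> configs d {x}"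
  by (auto simp: configs_def)

lemma finite_site_index [simp]: "finite (site_index x)"
  by (simp add: site_index_def)

lemma site_unit_alg: "i \<in> site_index x \<Longrightarrow> site_unit x i \<in> alg {x}"
  by (auto simp: site_unit_def local_alg_def site_index_def intro!: imageI unit_mat_mats site_config)

text \<open>Reduces statements about \<open>E0 x\<close> or \<phi>0 on a local algebra to products
  of a factor at x and a factor away from x, where the defining formulas apply.\<close>

lemma alg_insert_decomp:
  assumes "finite \<Lambda>" "x \<notin> \<Lambda>" "a \<in> alg (insert x \<Lambda>)"
  obtains b where "\<And>i. i \<in> site_index x \<Longrightarrow> b i \<in> alg \<Lambda>"
    and "a = (\<Sum>i\<in>site_index x. site_unit x i * b i)"
proof -
  obtain M where M: "M \<in> mats d (insert x \<Lambda>)" "a = \<pi> (insert x \<Lambda>) M"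
    using assms(3) by (auto simp: local_alg_def)
  \<comment> \<open>The block of M whose row and column configurations take the values
    \<open>fst i\<close> and \<open>snd i\<close> at x.\<close>
  define N where "N i = (\<lambda>\<omega> \<eta>. if \<omega> \<in> configs d \<Lambda> \<and> \<eta> \<in> configs d \<Lambda>
      then M (fun_upd \<omega> x (fst i)) (fun_upd \<eta> x (snd i)) else 0)" for i :: "nat \<times> nat"
  have N: "N i \<in> mats d \<Lambda>" for i
    by (auto simp: N_def mats_def)
  define T where "T i = tens {x} \<Lambda> (unit_mat (\<lambda>z\<in>{x}. fst i) (\<lambda>z\<in>{x}. snd i)) (N i)" for i :: "nat \<times> nat"
  have T: "T i \<in> mats d (insert x \<Lambda>)" for i
    by (auto simp: T_def mats_def tens_def)
  have "M = (\<lambda>\<omega> \<eta>. \<Sum>i\<in>site_index x. T i \<omega> \<eta>)"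
  proof (intro ext)
    fix \<omega> \<eta>
    show "M \<omega> \<eta> = (\<Sum>i\<in>site_index x. T i \<omega> \<eta>)"
    proof (cases "\<omega> \<in> configs d (insert x \<Lambda>) \<and> \<eta> \<in> configs d (insert x \<Lambda>)")
      case True
      have eq: "restrict \<zeta> {x} = (\<lambda>z\<in>{x}. p) \<longleftrightarrow> \<zeta> x = p" for \<zeta> :: "'v \<Rightarrow> nat" and p
        by (auto simp: restrict_def fun_eq_iff)
      have upd: "(restrict \<zeta> \<Lambda>)(x := \<zeta> x) = \<zeta>" if "\<zeta> \<in> configs d (insert x \<Lambda>)" for \<zeta>
        using that by (auto simp: configs_def PiE_iff extensional_def restrict_def fun_eq_iff)
      have r: "restrict \<zeta> \<Lambda> \<in> configs d \<Lambda>" if "\<zeta> \<in> configs d (insert x \<Lambda>)" for \<zeta>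
        using that by (rule configs_restrict) auto
      have "(\<Sum>i\<in>site_index x. T i \<omega> \<eta>) = (\<Sum>i\<in>site_index x. if i = (\<omega> x, \<eta> x) then M \<omega> \<eta> else 0)"
        using True
        by (intro sum.cong refl) (auto simp: T_def tens_def unit_mat_def eq N_def r upd)
      also have "\<dots> = M \<omega> \<eta>"
        using True by (auto simp: site_index_def configs_def PiE_iff)
      finally show ?thesis by simp
    next
      case False
      then have "M \<omega> \<eta> = 0" "T i \<omega> \<eta> = 0" for i
        using M(1) T[of i] by (auto simp: mats_def)
      then show ?thesis by simp
    qed
  qed
  then have "a = (\<Sum>i\<in>site_index x. \<pi> (insert x \<Lambda>) (T i))"
    using M(2) pi_sum[of "insert x \<Lambda>" "site_index x" T] T assms(1) by simp
  also have "\<dots> = (\<Sum>i\<in>site_index x. site_unit x i * \<pi> \<Lambda> (N i))"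
  proof (intro sum.cong refl)
    fix i assume i: "i \<in> site_index x"
    then have "unit_mat (\<lambda>z\<in>{x}. fst i) (\<lambda>z\<in>{x}. snd i) \<in> mats d {x}"
      by (intro unit_mat_mats site_config) (auto simp: site_index_def)
    then show "\<pi> (insert x \<Lambda>) (T i) = site_unit x i * \<pi> \<Lambda> (N i)"
      using assms N by (simp add: site_unit_def pi_tens T_def)
  qed
  finally show ?thesis
    using that[of "\<lambda>i. \<pi> \<Lambda> (N i)"] N by (auto simp: local_alg_def)
qed

subsection \<open>Matrix coefficients\<close>

lemma pi_expand:
  assumes "finite \<Lambda>" "M \<in> mats d \<Lambda>"
  shows "\<pi> \<Lambda> M = (\<Sum>(\<alpha>, \<beta>)\<in>configs d \<Lambda> \<times> configs d \<Lambda>. M \<alpha> \<beta> *\<^sub>C \<pi> \<Lambda> (unit_mat \<alpha> \<beta>))"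
proof -
  let ?C = "configs d \<Lambda>"
  have "M = (\<lambda>\<omega> \<eta>. \<Sum>i\<in>?C \<times> ?C. M (fst i) (snd i) * unit_mat (fst i) (snd i) \<omega> \<eta>)"
  proof (intro ext)
    fix \<omega> \<eta>
    have "(\<Sum>i\<in>?C \<times> ?C. M (fst i) (snd i) * unit_mat (fst i) (snd i) \<omega> \<eta>)
      = (\<Sum>i\<in>?C \<times> ?C. if i = (\<omega>, \<eta>) then M \<omega> \<eta> else 0)"
      by (intro sum.cong) (auto simp: unit_mat_def)
    also have "\<dots> = M \<omega> \<eta>"
      using assms by (auto simp: mats_def)
    finally show "M \<omega> \<eta> = (\<Sum>i\<in>?C \<times> ?C. M (fst i) (snd i) * unit_mat (fst i) (snd i) \<omega> \<eta>)" ..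
  qed
  then have "\<pi> \<Lambda> M = \<pi> \<Lambda> (\<lambda>\<omega> \<eta>. \<Sum>i\<in>?C \<times> ?C. M (fst i) (snd i) * unit_mat (fst i) (snd i) \<omega> \<eta>)"
    by (rule arg_cong)
  also have "\<dots> = (\<Sum>i\<in>?C \<times> ?C. \<pi> \<Lambda> (\<lambda>\<omega> \<eta>. M (fst i) (snd i) * unit_mat (fst i) (snd i) \<omega> \<eta>))"
    using assms by (intro pi_sum mats_scale unit_mat_mats) auto
  also have "\<dots> = (\<Sum>(\<alpha>, \<beta>)\<in>?C \<times> ?C. M \<alpha> \<beta> *\<^sub>C \<pi> \<Lambda> (unit_mat \<alpha> \<beta>))"
    using assms by (intro sum.cong) (auto simp: pi_scale unit_mat_mats)
  finally show ?thesis .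
qed

text \<open>The coefficient \<open>M \<alpha> \<beta>\<close> is isolated by compressing with matrix units:
  \<open>e\<^sub>\<alpha>\<^sub>\<alpha> M e\<^sub>\<beta>\<^sub>\<alpha> = M \<alpha> \<beta> e\<^sub>\<alpha>\<^sub>\<alpha>\<close>.\<close>

lemma coefficient_bound:
  assumes "finite \<Lambda>" "\<alpha> \<in> configs d \<Lambda>" "\<beta> \<in> configs d \<Lambda>" "M \<in> mats d \<Lambda>"
  shows "cmod (M \<alpha> \<beta>) \<le> norm (\<pi> \<Lambda> (unit_mat \<beta> \<alpha>)) * norm (\<pi> \<Lambda> M)"
proof -
  let ?C = "configs d \<Lambda>"
  let ?e = "\<pi> \<Lambda> (unit_mat \<alpha> \<alpha>)"
  note u = unit_mat_mats[OF assms(2,2)] unit_mat_mats[OF assms(3,2)]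
  have *: "mat_mult d \<Lambda> M (unit_mat \<beta> \<alpha>) = (\<lambda>\<omega> \<eta>. if \<eta> = \<alpha> then M \<omega> \<beta> else 0)"
  proof (intro ext)
    fix \<omega> \<eta>
    have "mat_mult d \<Lambda> M (unit_mat \<beta> \<alpha>) \<omega> \<eta> = (\<Sum>\<zeta>\<in>?C. if \<zeta> = \<beta> then (if \<eta> = \<alpha> then M \<omega> \<beta> else 0) else 0)"
      unfolding mat_mult_def by (intro sum.cong) (auto simp: unit_mat_def)
    then show "mat_mult d \<Lambda> M (unit_mat \<beta> \<alpha>) \<omega> \<eta> = (if \<eta> = \<alpha> then M \<omega> \<beta> else 0)"
      using assms by simp
  qed
  have "mat_mult d \<Lambda> (unit_mat \<alpha> \<alpha>) (mat_mult d \<Lambda> M (unit_mat \<beta> \<alpha>)) = (\<lambda>\<omega> \<eta>. M \<alpha> \<beta> * unit_mat \<alpha> \<alpha> \<omega> \<eta>)"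
  proof (intro ext)
    fix \<omega> \<eta>
    have "mat_mult d \<Lambda> (unit_mat \<alpha> \<alpha>) (mat_mult d \<Lambda> M (unit_mat \<beta> \<alpha>)) \<omega> \<eta>
      = (\<Sum>\<zeta>\<in>?C. if \<zeta> = \<alpha> then M \<alpha> \<beta> * unit_mat \<alpha> \<alpha> \<omega> \<eta> else 0)"
      unfolding * by (simp only: mat_mult_def) (intro sum.cong; auto simp: unit_mat_def)
    then show "mat_mult d \<Lambda> (unit_mat \<alpha> \<alpha>) (mat_mult d \<Lambda> M (unit_mat \<beta> \<alpha>)) \<omega> \<eta> = M \<alpha> \<beta> * unit_mat \<alpha> \<alpha> \<omega> \<eta>"
      using assms by simp
  qed
  then have "?e * (\<pi> \<Lambda> M * \<pi> \<Lambda> (unit_mat \<beta> \<alpha>)) = M \<alpha> \<beta> *\<^sub>C ?e"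
    using assms u by (simp add: mat_mult_mats flip: pi_mult pi_scale)
  then have "cmod (M \<alpha> \<beta>) * norm ?e = norm (?e * (\<pi> \<Lambda> M * \<pi> \<Lambda> (unit_mat \<beta> \<alpha>)))"
    by (simp add: norm_scaleC)
  also have "\<dots> \<le> norm ?e * (norm (\<pi> \<Lambda> M) * norm (\<pi> \<Lambda> (unit_mat \<beta> \<alpha>)))"
    by (meson mult_left_mono norm_ge_zero norm_mult_ineq order_trans)
  finally have "norm ?e * cmod (M \<alpha> \<beta>) \<le> norm ?e * (norm (\<pi> \<Lambda> (unit_mat \<beta> \<alpha>)) * norm (\<pi> \<Lambda> M))"
    by (simp add: mult_ac)
  moreover have "unit_mat \<alpha> \<alpha> \<noteq> (\<lambda>_ _. 0)"
    by (auto simp: unit_mat_def fun_eq_iff)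
  then have "?e \<noteq> 0"
    using inj_onD[OF pi_inj[OF assms(1)], of "unit_mat \<alpha> \<alpha>" "\<lambda>_ _. 0"] pi_zero[OF assms(1)] u mats_zero
    by auto
  ultimately show ?thesis by simp
qed

text \<open>Matrix coefficients are bounded by the norm, so those of a convergent sequence are
  Cauchy; their limits are the coefficients of the limit.\<close>

lemma closed_alg:
  assumes "finite \<Lambda>"
  shows "closed (alg \<Lambda>)"
  unfolding closed_sequential_limits
proof (intro allI impI)
  fix f a assume "(\<forall>n. f n \<in> alg \<Lambda>) \<and> f \<longlonglongrightarrow> a"
  then have f: "\<And>n. f n \<in> alg \<Lambda>" "f \<longlonglongrightarrow> a" by auto
  let ?C = "configs d \<Lambda>"
  have "\<exists>M. \<forall>n. M n \<in> mats d \<Lambda> \<and> f n = \<pi> \<Lambda> (M n)"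
    using f(1) unfolding local_alg_def by (intro choice) auto
  then obtain M where M: "\<And>n. M n \<in> mats d \<Lambda>" "\<And>n. f n = \<pi> \<Lambda> (M n)"
    by auto
  have diff: "(\<lambda>\<omega> \<eta>. M m \<omega> \<eta> + (-1) * M n \<omega> \<eta>) \<in> mats d \<Lambda>"
    "\<pi> \<Lambda> (\<lambda>\<omega> \<eta>. M m \<omega> \<eta> + (-1) * M n \<omega> \<eta>) = f m - f n" for m n
  proof -
    show "(\<lambda>\<omega> \<eta>. M m \<omega> \<eta> + (-1) * M n \<omega> \<eta>) \<in> mats d \<Lambda>"
      using M by (intro mats_add mats_scale)
    have "\<pi> \<Lambda> (\<lambda>\<omega> \<eta>. M m \<omega> \<eta> + (-1) * M n \<omega> \<eta>) = f m + (-1) *\<^sub>C f n"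
      unfolding M(2) pi_scale[OF assms M(1), symmetric]
      by (rule pi_add[OF assms M(1) mats_scale[OF M(1)]])
    then show "\<pi> \<Lambda> (\<lambda>\<omega> \<eta>. M m \<omega> \<eta> + (-1) * M n \<omega> \<eta>) = f m - f n"
      by (simp add: scaleC_minus_one)
  qed
  have "convergent (\<lambda>n. M n \<alpha> \<beta>)" if \<alpha>\<beta>: "\<alpha> \<in> ?C" "\<beta> \<in> ?C" for \<alpha> \<beta>
  proof (rule Cauchy_convergent, rule CauchyI)
    fix e :: real assume "e > 0"
    define K where "K = norm (\<pi> \<Lambda> (unit_mat \<beta> \<alpha>)) + 1"
    have "K > 0" by (simp add: K_def add_nonneg_pos)
    then obtain n0 where n0: "\<And>m n. m \<ge> n0 \<Longrightarrow> n \<ge> n0 \<Longrightarrow> norm (f m - f n) < e / K"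
      using CauchyD[OF LIMSEQ_imp_Cauchy[OF f(2)], of "e / K"] \<open>e > 0\<close> by auto
    have "cmod (M m \<alpha> \<beta> - M n \<alpha> \<beta>) < e" if "m \<ge> n0" "n \<ge> n0" for m n
    proof -
      have "cmod (M m \<alpha> \<beta> - M n \<alpha> \<beta>) \<le> K * norm (f m - f n)"
        using coefficient_bound[OF assms \<alpha>\<beta> diff(1)[of m n]] unfolding diff(2)
        by (simp add: K_def distrib_right add_increasing2)
      also have "\<dots> < e"
        using n0[OF that] \<open>K > 0\<close> by (simp add: field_simps)
      finally show ?thesis .
    qed
    then show "\<exists>n0. \<forall>m\<ge>n0. \<forall>n\<ge>n0. cmod (M m \<alpha> \<beta> - M n \<alpha> \<beta>) < e" by blast
  qed
  then have lim: "(\<lambda>n. M n \<alpha> \<beta>) \<longlonglongrightarrow> lim (\<lambda>n. M n \<alpha> \<beta>)" if "\<alpha> \<in> ?C" "\<beta> \<in> ?C" for \<alpha> \<beta>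
    using that by (simp add: convergent_LIMSEQ_iff)
  have "f \<longlonglongrightarrow> (\<Sum>(\<alpha>, \<beta>)\<in>?C \<times> ?C. lim (\<lambda>n. M n \<alpha> \<beta>) *\<^sub>C \<pi> \<Lambda> (unit_mat \<alpha> \<beta>))"
    unfolding M(2)[abs_def] pi_expand[OF assms M(1)]
    by (intro tendsto_sum) (auto intro!: tendsto_scaleC_left lim)
  moreover have "(\<Sum>(\<alpha>, \<beta>)\<in>?C \<times> ?C. lim (\<lambda>n. M n \<alpha> \<beta>) *\<^sub>C \<pi> \<Lambda> (unit_mat \<alpha> \<beta>)) \<in> alg \<Lambda>"
  proof (intro star_subalg_sum alg_star_subalg assms)
    fix i assume "i \<in> ?C \<times> ?C"
    then have "\<pi> \<Lambda> (unit_mat (fst i) (snd i)) \<in> alg \<Lambda>"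
      unfolding local_alg_def by (intro imageI unit_mat_mats) auto
    then show "(case i of (\<alpha>, \<beta>) \<Rightarrow> lim (\<lambda>n. M n \<alpha> \<beta>) *\<^sub>C \<pi> \<Lambda> (unit_mat \<alpha> \<beta>)) \<in> alg \<Lambda>"
      by (simp add: case_prod_unfold star_subalg_scaleC alg_star_subalg assms)
  qed
  ultimately show "a \<in> alg \<Lambda>"
    by (simp only: LIMSEQ_unique[OF f(2)])
qed

text \<open>The state is the normalized trace, whose square form is the normalized Hilbert-Schmidt
  norm. Expansion in matrix units and Cauchy-Schwarz compare it with the C*-norm.\<close>

lemma ex_faithful_state:
  assumes "finite \<Lambda>"
  obtains \<tau> K where "state_on (alg \<Lambda>) \<tau>"
    and "\<And>a. a \<in> alg \<Lambda> \<Longrightarrow> (norm a)\<^sup>2 \<le> K * Re (\<tau> (star a * a))"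
proof -
  let ?C = "configs d \<Lambda>"
  define tr where "tr M = (\<Sum>\<omega>\<in>?C. M \<omega> \<omega>) / of_nat (card ?C)" for M :: "'v cmat"
  define \<tau> where "\<tau> a = tr (inv_into (mats d \<Lambda>) (\<pi> \<Lambda>) a)" for a
  have card: "card ?C > 0"
    using assms configs_nonempty by (simp add: card_gt_0_iff)
  have \<tau>: "\<tau> (\<pi> \<Lambda> M) = tr M" if "M \<in> mats d \<Lambda>" for M
    using that pi_inj[OF assms] by (simp add: \<tau>_def)
  have sq: "\<tau> (star (\<pi> \<Lambda> M) * \<pi> \<Lambda> M)
      = of_real ((\<Sum>(\<alpha>, \<beta>)\<in>?C \<times> ?C. (cmod (M \<alpha> \<beta>))\<^sup>2) / card ?C)" if "M \<in> mats d \<Lambda>" for M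
  proof -
    have "\<tau> (star (\<pi> \<Lambda> M) * \<pi> \<Lambda> M) = tr (mat_mult d \<Lambda> (mat_adj M) M)"
      using that assms by (simp add: \<tau> mat_mult_mats mat_adj_mats flip: pi_adj pi_mult)
    also have "\<dots> = (\<Sum>\<omega>\<in>?C. \<Sum>\<zeta>\<in>?C. of_real ((cmod (M \<zeta> \<omega>))\<^sup>2)) / of_nat (card ?C)"
      unfolding tr_def mat_mult_def mat_adj_def complex_norm_square by (simp only: mult.commute)
    also have "\<dots> = of_real ((\<Sum>(\<alpha>, \<beta>)\<in>?C \<times> ?C. (cmod (M \<alpha> \<beta>))\<^sup>2) / card ?C)"
      by (subst sum.swap) (simp add: sum.cartesian_product case_prod_unfold)
    finally show ?thesis .
  qed
  have "state_on (alg \<Lambda>) \<tau>"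
    unfolding state_on_def
  proof (intro conjI ballI allI)
    fix a b assume "a \<in> alg \<Lambda>" "b \<in> alg \<Lambda>"
    then obtain M N where "M \<in> mats d \<Lambda>" "a = \<pi> \<Lambda> M" "N \<in> mats d \<Lambda>" "b = \<pi> \<Lambda> N"
      by (auto simp: local_alg_def)
    then show "\<tau> (a + b) = \<tau> a + \<tau> b"
      using assms
      by (simp add: \<tau> mats_add tr_def sum.distrib add_divide_distrib flip: pi_add)
  next
    fix c a assume "a \<in> alg \<Lambda>"
    then obtain M where "M \<in> mats d \<Lambda>" "a = \<pi> \<Lambda> M"
      by (auto simp: local_alg_def)
    then show "\<tau> (c *\<^sub>C a) = c * \<tau> a"
      using assms by (simp add: \<tau> mats_scale tr_def sum_distrib_left flip: pi_scale)
  next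
    fix a assume "a \<in> alg \<Lambda>"
    then obtain M where "M \<in> mats d \<Lambda>" "a = \<pi> \<Lambda> M"
      by (auto simp: local_alg_def)
    then show "\<tau> (star a * a) \<in> \<real>\<^sub>\<ge>\<^sub>0"
      using card by (simp only: sq nonneg_Reals_of_real_iff) (auto intro!: sum_nonneg divide_nonneg_nonneg)
  next
    have "\<tau> 1 = tr (mat_one d \<Lambda>)"
      using \<tau>[OF mat_one_mats] assms by (simp add: pi_one)
    then show "\<tau> 1 = 1"
      using card by (simp add: tr_def mat_one_def)
  qed
  moreover
  \<comment> \<open>The cardinality undoes the normalization of the trace; the sum is the second
    Cauchy-Schwarz factor.\<close>
  define K where "K = card ?C * (\<Sum>(\<alpha>, \<beta>)\<in>?C \<times> ?C. (norm (\<pi> \<Lambda> (unit_mat \<alpha> \<beta>)))\<^sup>2)"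
  have "(norm a)\<^sup>2 \<le> K * Re (\<tau> (star a * a))" if a: "a \<in> alg \<Lambda>" for a
  proof -
    obtain M where M: "M \<in> mats d \<Lambda>" "a = \<pi> \<Lambda> M"
      using a by (auto simp: local_alg_def)
    have "norm a \<le> (\<Sum>(\<alpha>, \<beta>)\<in>?C \<times> ?C. cmod (M \<alpha> \<beta>) * norm (\<pi> \<Lambda> (unit_mat \<alpha> \<beta>)))"
      unfolding M(2) pi_expand[OF assms M(1)]
      by (rule order_trans[OF norm_sum]) (simp add: norm_scaleC case_prod_unfold)
    then have "(norm a)\<^sup>2 \<le> (\<Sum>i\<in>?C \<times> ?C. cmod (M (fst i) (snd i)) * norm (\<pi> \<Lambda> (unit_mat (fst i) (snd i))))\<^sup>2"
      by (intro power_mono) (auto simp: case_prod_unfold)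
    also have "\<dots> \<le> (\<Sum>i\<in>?C \<times> ?C. (cmod (M (fst i) (snd i)))\<^sup>2) * (\<Sum>i\<in>?C \<times> ?C. (norm (\<pi> \<Lambda> (unit_mat (fst i) (snd i))))\<^sup>2)"
      by (rule Cauchy_Schwarz_ineq_sum)
    also have "\<dots> = K * Re (\<tau> (star a * a))"
      using card unfolding M(2) sq[OF M(1)] by (simp add: K_def case_prod_unfold)
    finally show ?thesis .
  qed
  ultimately show ?thesis by (rule that)
qed

end

section \<open>Inverse square roots\<close>

text \<open>For a self-adjoint element the C*-identity says that squaring squares the norm;
  iterate.\<close>

lemma norm_self_adjoint_power:
  assumes "star x = (x::'a::cstar_algebra)"
  shows "norm (x ^ 2 ^ k) = norm x ^ 2 ^ k"
proof (induction k)
  case (Suc k)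
  have "x ^ 2 ^ Suc k = star (x ^ 2 ^ k) * x ^ 2 ^ k"
    by (simp add: star_power assms power_add mult_2)
  then show ?case
    using Suc by (simp add: cstar_identity power_add mult_2 flip: power2_eq_square)
qed simp

text \<open>Together with the general bound on states, \<open>faithful\<close> makes the C*-norm on
  S equivalent to the Hilbert norm of \<tau>.\<close>

locale faithful_state =
  fixes S :: "'a::cstar_algebra set" and \<tau> :: "'a \<Rightarrow> complex" and K :: real
  assumes S: "star_subalg S" "closed S"
    and \<tau>: "state_on S \<tau>"
    and faithful: "\<And>a. a \<in> S \<Longrightarrow> (norm a)\<^sup>2 \<le> K * Re (\<tau> (star a * a))"
begin

abbreviation sq :: "'a \<Rightarrow> real" where "sq a \<equiv> Re (\<tau> (star a * a))"

lemma mem: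
  "a \<in> S \<Longrightarrow> b \<in> S \<Longrightarrow> a * b \<in> S" "a \<in> S \<Longrightarrow> b \<in> S \<Longrightarrow> a + b \<in> S"
  "a \<in> S \<Longrightarrow> b \<in> S \<Longrightarrow> a - b \<in> S" "a \<in> S \<Longrightarrow> star a \<in> S" "a \<in> S \<Longrightarrow> r *\<^sub>R a \<in> S" "1 \<in> S"
  using S by (auto intro: star_subalg_mult star_subalg_add star_subalg_diff star_subalg_star star_subalg_scaleR)

lemma \<tau>_add: "a \<in> S \<Longrightarrow> b \<in> S \<Longrightarrow> \<tau> (a + b) = \<tau> a + \<tau> b"
  and \<tau>_one: "\<tau> 1 = 1"
  using \<tau> by (auto simp: state_on_def)

lemma \<tau>_scaleR: "a \<in> S \<Longrightarrow> \<tau> (r *\<^sub>R a) = r * \<tau> a"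
  using \<tau> unfolding state_on_def by (metis scaleC_of_real)

lemma \<tau>_diff: "a \<in> S \<Longrightarrow> b \<in> S \<Longrightarrow> \<tau> (a - b) = \<tau> a - \<tau> b"
  using \<tau>_add[of a "(-1) *\<^sub>R b"] \<tau>_scaleR[of b "-1"] mem(5)[of b "-1"] by simp

lemma sq_nonneg: "a \<in> S \<Longrightarrow> 0 \<le> sq a"
  using \<tau> by (auto simp: state_on_def complex_nonneg_Reals_iff)

lemma sq_le: "a \<in> S \<Longrightarrow> sq a \<le> 2 * (norm a)\<^sup>2"
  using state_on_bound[OF S \<tau>, of "star a * a"] complex_Re_le_cmod[of "\<tau> (star a * a)"]
  by (simp add: cstar_identity mem)

text \<open>Both squares have nonnegative values under \<tau> that add up to 0, so both values
  vanish, and faithfulness kills a. In this sense positive elements cannot cancel.\<close>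

lemma sq_add_eq_0:
  assumes "a \<in> S" "b \<in> S" "star a * a + star b * b = 0"
  shows "a = 0"
proof -
  have "\<tau> 0 = 0" using \<tau>_scaleR[of 1 0] by (simp add: mem)
  then have "sq a + sq b = 0"
    using \<tau>_add[of "star a * a" "star b * b"] assms by (simp add: mem flip: plus_complex.simps)
  then have "sq a = 0"
    using sq_nonneg assms by (smt (verit))
  then show ?thesis
    using faithful[OF assms(1)] by simp
qed

lemma K_ge_1: "1 \<le> K"
  using faithful[of 1] by (simp add: mem \<tau>_one)

text \<open>In the Hilbert space norm given by \<open>\<tau>\<close> the positive operator \<open>P\<^sup>* P\<close> lies strictly between
  \<open>0\<close> and some \<open>r\<close>, so \<open>1 - P\<^sup>* P / r\<close> is a strict contraction; equivalence of norms, applied to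
  its powers of exponent \<open>2\<^sup>k\<close>, then bounds its C*-norm.\<close>

lemma invertible_contraction:
  assumes P: "P \<in> S" "invertible_elem P"
  obtains r where "r > 0" "norm (1 - (star P * P) /\<^sub>R r) < 1"
proof -
  obtain Q where Q: "P * Q = 1" "Q * P = 1"
    using P(2) by (auto simp: invertible_elem_def)
  have nz: "norm P > 0" "norm Q > 0"
    using Q by auto
  \<comment> \<open>In the norm of \<tau>, r bounds P and \<open>star P\<close> from above, and q
    bounds P from below through m = Q (P m). The factor 2 is that of the bound on states.\<close>
  define r q where "r = 2 * K * (norm P)\<^sup>2" and "q = 2 * (norm Q)\<^sup>2 * K"
  have pos: "r > 0" "q > 0"
    using nz K_ge_1 by (auto simp: r_def q_def)
  have upper: "sq (T * m) \<le> r * sq m" if "T \<in> S" "m \<in> S" "norm T = norm P" for T m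
  proof -
    have "sq (T * m) \<le> 2 * (norm (T * m))\<^sup>2"
      using that by (intro sq_le mem)
    also have "\<dots> \<le> 2 * (norm P * norm m)\<^sup>2"
      using norm_mult_ineq[of T m] that by (simp add: power_mono)
    also have "\<dots> \<le> 2 * (norm P)\<^sup>2 * (K * sq m)"
      using faithful[OF that(2)] by (simp add: power_mult_distrib mult_left_mono)
    finally show ?thesis by (simp add: r_def mult_ac)
  qed
  have lower: "sq m \<le> q * sq (P * m)" if "m \<in> S" for m
  proof -
    have "sq m \<le> 2 * (norm (Q * (P * m)))\<^sup>2"
      using sq_le[OF that] Q by (simp flip: mult.assoc)
    also have "\<dots> \<le> 2 * (norm Q * norm (P * m))\<^sup>2"
      using norm_mult_ineq[of Q "P * m"] by (simp add: power_mono)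
    also have "\<dots> \<le> 2 * (norm Q)\<^sup>2 * (K * sq (P * m))"
      using faithful[of "P * m"] that P by (simp add: power_mult_distrib mult_left_mono mem)
    finally show ?thesis by (simp add: q_def mult_ac)
  qed
  define h where "h = star P * P"
  define x where "x = 1 - h /\<^sub>R r"
  have h: "h \<in> S" "star h = h"
    using P by (auto simp: h_def mem star_mult star_star)
  have x: "x \<in> S" "star x = x"
    using h by (auto simp: x_def mem star_diff star_scaleR)
  define \<theta> where "\<theta> = 1 - 1 / (r * q)"
  have contr: "sq (x * m) \<le> \<theta> * sq m" if m: "m \<in> S" for m
  proof -
    define u where "u = star P * (P * m)"
    have xm: "x * m = m - u /\<^sub>R r"
      by (simp add: x_def h_def u_def left_diff_distrib mult.assoc)
    have mu: "star m * u = star (P * m) * (P * m)" "star u * m = star (P * m) * (P * m)"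
      by (simp_all add: u_def star_mult star_star mult.assoc)
    have *: "star (x * m) * (x * m) = star m * m - (star m * u) /\<^sub>R r - (star u * m) /\<^sub>R r + (star u * u) /\<^sub>R (r * r)"
    proof -
      have "(a - b) * (a' - b') = a * a' - a * b' - b * a' + b * b'" for a b a' b' :: 'a
        by (simp add: algebra_simps)
      then show ?thesis
        unfolding xm star_diff star_scaleR by simp
    qed
    have "star (x * m) * (x * m)
      = star m * m + (- 2 / r) *\<^sub>R (star (P * m) * (P * m)) + (1 / r\<^sup>2) *\<^sub>R (star (star P * (P * m)) * (star P * (P * m)))"
    proof -
      have "- 2 / r = - inverse r - inverse r" "1 / r\<^sup>2 = inverse (r * r)"
        by (simp_all add: field_simps power2_eq_square)
      then show ?thesis
        using * unfolding mu u_def[symmetric]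
        by (simp only: scaleR_left_diff_distrib scaleR_minus_left) simp
    qed
    then have "sq (x * m) = sq m - 2 / r * sq (P * m) + 1 / r\<^sup>2 * sq (star P * (P * m))"
      using m P by (simp add: \<tau>_add \<tau>_diff \<tau>_scaleR mem del: of_real_divide of_real_power of_real_minus)
    \<comment> \<open>The bound \<open>upper\<close> for \<open>star P\<close> at the vector P m
      costs half of the negative linear term, and the other half remains.\<close>
    also have "\<dots> \<le> sq m - 2 / r * sq (P * m) + 1 / r\<^sup>2 * (r * sq (P * m))"
      using m P pos by (intro add_left_mono mult_left_mono upper mem) auto
    also have "\<dots> = sq m - sq (P * m) / r"
      using pos by (simp add: power2_eq_square)
    also have "\<dots> \<le> sq m - (sq m / q) / r"
      using lower[OF m] pos by (intro diff_left_mono divide_right_mono) (auto simp: field_simps)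
    also have "\<dots> = \<theta> * sq m"
      by (simp add: \<theta>_def algebra_simps)
    finally show ?thesis .
  qed
  \<comment> \<open>Nonnegativity of \<theta> is the contraction estimate at m = 1, where
    \<open>sq 1 = 1\<close>.\<close>
  have \<theta>: "0 \<le> \<theta>" "\<theta> < 1"
    using contr[of 1] sq_nonneg[of "x * 1"] x by (simp_all add: mem \<tau>_one) (simp add: \<theta>_def pos)
  have powers: "x ^ n \<in> S \<and> sq (x ^ n) \<le> \<theta> ^ n" for n
  proof (induction n)
    case (Suc n)
    then have "sq (x * x ^ n) \<le> \<theta> * \<theta> ^ n"
      using contr[of "x ^ n"] \<theta>(1) by (meson mult_left_mono order_trans)
    then show ?case using Suc x by (simp add: mem)
  qed (simp add: mem \<tau>_one)
  have "norm x < 1"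
  proof (rule ccontr)
    assume "\<not> norm x < 1"
    have "(\<lambda>n. K * \<theta> ^ n) \<longlonglongrightarrow> K * 0"
      using \<theta> by (intro tendsto_mult tendsto_const LIMSEQ_realpow_zero)
    then have "eventually (\<lambda>n. K * \<theta> ^ n < 1) sequentially"
      by (rule order_tendstoD) simp
    then obtain n where n: "K * \<theta> ^ n < 1"
      by (auto simp: eventually_sequentially)
    have "1 \<le> (norm x ^ 2 ^ n)\<^sup>2"
      using \<open>\<not> norm x < 1\<close> by simp
    also have "\<dots> = (norm (x ^ 2 ^ n))\<^sup>2"
      by (simp add: norm_self_adjoint_power x(2))
    also have "\<dots> \<le> K * sq (x ^ 2 ^ n)"
      using powers by (intro faithful) auto
    also have "\<dots> \<le> K * \<theta> ^ 2 ^ n"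
      using powers K_ge_1 by (intro mult_left_mono) auto
    also have "\<dots> \<le> K * \<theta> ^ n"
      using \<theta> K_ge_1 by (intro mult_left_mono power_decreasing) (auto intro: less_imp_le)
    finally show False using n by simp
  qed
  then show ?thesis using that pos by (simp add: x_def h_def)
qed

text \<open>Real powers of B are binomial series rescaled by r^s, which settles existence. A
  competing positive root c' commutes with B and hence with the series b; so (b + c') (b - c') = 0,
  and positivity of both roots forces b = c'.\<close>

lemma inv_sqrt_in:
  assumes x: "x \<in> S" "norm x < 1" "star x = x" and r: "r > 0" and B: "B = r *\<^sub>R (1 - x)"
  defines "c \<equiv> inv_sqrt_in S B"
  shows "c \<in> S" "star c = c" "c * B * c = 1" "\<And>a. a * B = B * a \<Longrightarrow> a * c = c * a"
proof -
  define e where "e s = (r powr s) *\<^sub>R binpow s x" for s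
  note binpow = binpow_mult[OF x(2)]
  have e: "e s \<in> S" "star (e s) = e s" for s
    using x S by (auto simp: e_def mem binpow_mem star_scaleR binpow_star)
  have e_mult: "e s * e t = e (s + t)" for s t
    by (simp add: e_def binpow powr_add mult.commute)
  have e1: "e 1 = B" "e 0 = 1"
    using x r by (auto simp: e_def B binpow_1 binpow_0)
  have comm: "a * e s = e s * a" if "a * B = B * a" for a s
  proof -
    have "r *\<^sub>R (a * x) = r *\<^sub>R (x * a)"
      using that by (auto simp: B algebra_simps)
    then have "a * x = x * a" using r by (simp only: scaleR_cancel_left) auto
    then show ?thesis using x by (simp add: e_def binpow_commute)
  qed
  \<comment> \<open>Positivity of b is witnessed by its own square root
    \<open>e (-1/4)\<close>.\<close>
  define b where "b = e (-1/2)"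
  have b: "b \<in> S" "positive_in S b" "b * b * B = 1" "B * (b * b) = 1"
    using e e_mult e1 unfolding positive_in_def b_def
    by (auto intro!: bexI[of _ "e (-1/4)"] simp: e_mult simp flip: e1(1))
  have unique: "c' = b" if c': "c' \<in> S" "positive_in S c'" "c' * c' * B = 1" "B * (c' * c') = 1" for c'
  proof -
    obtain s where s: "s \<in> S" "b = star s * s" using b(2) by (auto simp: positive_in_def)
    obtain t where t: "t \<in> S" "c' = star t * t" using c'(2) by (auto simp: positive_in_def)
    have sa: "star b = b" "star c' = c'"
      by (simp_all add: s t star_mult star_star)
    have eq: "c' * c' = b * b"
      using c'(3) b(4) by (metis mult.assoc mult.right_neutral mult_1)
    have "c' * B = B * (c' * c') * (c' * B)" using c' by simp
    also have "\<dots> = B * c' * (c' * c' * B)" by (simp only: mult.assoc)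
    finally have "c' * B = B * c'" using c' by simp
    then have "c' * b = b * c'" unfolding b_def by (rule comm)
    define h where "h = b - c'"
    have h: "h \<in> S" "star h = h"
      using b c' sa by (auto simp: h_def mem star_diff)
    have h0: "(b + c') * h = 0"
      using eq \<open>c' * b = b * c'\<close> by (simp add: h_def algebra_simps)
    \<comment> \<open>The factorizations of b and c' split the vanishing element h (b + c') h into
      two squares. So s h and t h vanish, and with them (b - c') h, the square of h.\<close>
    have "star (s * h) * (s * h) + star (t * h) * (t * h) = h * ((b + c') * h)"
      by (simp add: star_mult h s(2) t(2) algebra_simps)
    then have sum0: "star (s * h) * (s * h) + star (t * h) * (t * h) = 0"
      "star (t * h) * (t * h) + star (s * h) * (s * h) = 0"
      by (simp_all add: h0 add.commute)
    have "s * h = 0" "t * h = 0"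
      by (rule sq_add_eq_0[OF _ _ sum0(1)] sq_add_eq_0[OF _ _ sum0(2)]; use s t h in \<open>simp add: mem\<close>)+
    then have "(b - c') * h = 0"
      by (simp add: s(2) t(2) left_diff_distrib mult.assoc)
    then have "star h * h = 0"
      unfolding h(2) by (simp flip: h_def)
    then show ?thesis
      using star_mult_self_eq_0[of h] by (simp add: h_def)
  qed
  have c: "c = b"
    unfolding c_def inv_sqrt_in_def
    by (rule the_equality, intro conjI b, elim conjE, rule unique)
  show "c \<in> S" "star c = c" "c * B * c = 1"
    using e by (auto simp: c b_def e_mult simp flip: e1(1)) (simp add: e1)
  show "\<And>a. a * B = B * a \<Longrightarrow> a * c = c * a"
    using comm by (simp add: c b_def)
qed

end

context quasi_local
begin

lemma faithful_state_alg:
  assumes "finite \<Lambda>"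
  obtains \<tau> K where "faithful_state (alg \<Lambda>) \<tau> K"
proof -
  obtain \<tau> K where "state_on (alg \<Lambda>) \<tau>"
    and "\<And>a. a \<in> alg \<Lambda> \<Longrightarrow> (norm a)\<^sup>2 \<le> K * Re (\<tau> (star a * a))"
    using ex_faithful_state[OF assms] by metis
  then show ?thesis
    using that[of \<tau> K] alg_star_subalg[OF assms] closed_alg[OF assms] unfolding faithful_state_def by blast
qed

end

section \<open>Complete positivity\<close>

lemma mat_positive_in_mono:
  assumes "mat_positive_in n S X" "S \<subseteq> T"
  shows "mat_positive_in n T X"
proof -
  obtain C where C: "\<forall>i<n. \<forall>j<n. C i j \<in> S"
    "\<forall>i<n. \<forall>j<n. X i j = (\<Sum>k<n. star (C k i) * C k j)"
    using assms(1) unfolding mat_positive_in_def by auto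
  then show ?thesis
    using assms(2) unfolding mat_positive_in_def by (intro exI[of _ C]) auto
qed

lemma completely_positive_on_restrict:
  "completely_positive_on A B E \<Longrightarrow> A' \<subseteq> A \<Longrightarrow> completely_positive_on A' B E"
  unfolding completely_positive_on_def by (meson mat_positive_in_mono)

lemma completely_positive_on_comp:
  "completely_positive_on A B E \<Longrightarrow> completely_positive_on B C F \<Longrightarrow> completely_positive_on A C (F \<circ> E)"
  unfolding completely_positive_on_def comp_def by fast

lemma completely_positive_on_conj:
  assumes S: "star_subalg S" "k \<in> S"
  shows "completely_positive_on S S (\<lambda>a. star k * a * k)"
  unfolding completely_positive_on_def
proof (intro allI impI)
  fix n X assume "mat_positive_in n S X"
  then obtain C where C: "\<forall>i<n. \<forall>j<n. C i j \<in> S"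
    "\<forall>i<n. \<forall>j<n. X i j = (\<Sum>l<n. star (C l i) * C l j)"
    unfolding mat_positive_in_def by auto
  show "mat_positive_in n S (\<lambda>i j. star k * X i j * k)"
    unfolding mat_positive_in_def
    by (rule exI[of _ "\<lambda>i j. C i j * k"])
      (use C S in \<open>auto intro: star_subalg_mult simp: star_mult sum_distrib_left sum_distrib_right mult.assoc\<close>)
qed

context quasi_local
begin

lemma sum_star_pi_mult:
  assumes "finite \<Gamma>" "\<And>q. q \<in> Q \<Longrightarrow> M q \<in> mats d \<Gamma>" "\<And>q. q \<in> Q \<Longrightarrow> N q \<in> mats d \<Gamma>"
  shows "(\<Sum>q\<in>Q. star (\<pi> \<Gamma> (M q)) * \<pi> \<Gamma> (N q))
    = \<pi> \<Gamma> (\<lambda>\<omega> \<eta>. \<Sum>q\<in>Q. \<Sum>\<zeta>\<in>configs d \<Gamma>. cnj (M q \<zeta> \<omega>) * N q \<zeta> \<eta>)"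
proof -
  have "(\<Sum>q\<in>Q. star (\<pi> \<Gamma> (M q)) * \<pi> \<Gamma> (N q)) = (\<Sum>q\<in>Q. \<pi> \<Gamma> (mat_mult d \<Gamma> (mat_adj (M q)) (N q)))"
    using assms by (intro sum.cong) (simp_all add: pi_adj pi_mult mat_adj_mats)
  also have "\<dots> = \<pi> \<Gamma> (\<lambda>\<omega> \<eta>. \<Sum>q\<in>Q. mat_mult d \<Gamma> (mat_adj (M q)) (N q) \<omega> \<eta>)"
    using assms by (intro pi_sum[symmetric]) (simp_all add: mat_mult_mats mat_adj_mats)
  finally show ?thesis by (simp add: mat_mult_def mat_adj_def)
qed

text \<open>A Gram matrix of vectors with arbitrarily many entries is positive in \<open>M\<^sub>n\<close>: the entries of
  its scalar matrix form a positive semidefinite kernel, whose Cholesky factor has the right format.\<close>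

lemma mat_positive_in_gram:
  assumes \<Gamma>: "finite \<Gamma>" and Q: "finite Q"
    and W: "\<And>q i. q \<in> Q \<Longrightarrow> i < n \<Longrightarrow> W q i \<in> alg \<Gamma>"
    and X: "\<And>i j. i < n \<Longrightarrow> j < n \<Longrightarrow> X i j = (\<Sum>q\<in>Q. star (W q i) * W q j)"
  shows "mat_positive_in n (alg \<Gamma>) X"
proof -
  let ?C = "configs d \<Gamma>"
  have "\<exists>M. \<forall>p. fst p \<in> Q \<and> snd p < n \<longrightarrow> M p \<in> mats d \<Gamma> \<and> W (fst p) (snd p) = \<pi> \<Gamma> (M p)"
    by (rule choice) (use W in \<open>auto simp: local_alg_def image_iff\<close>)
  then obtain M0 where M0: "\<And>p. fst p \<in> Q \<and> snd p < n \<Longrightarrow> M0 p \<in> mats d \<Gamma> \<and> W (fst p) (snd p) = \<pi> \<Gamma> (M0 p)"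
    by blast
  define M where "M q i = M0 (q, i)" for q i
  have M: "M q i \<in> mats d \<Gamma>" "W q i = \<pi> \<Gamma> (M q i)" if "q \<in> Q" "i < n" for q i
    using M0[of "(q, i)"] that by (auto simp: M_def)
  let ?I = "{..<n} \<times> ?C"
  define K where "K a b = (\<Sum>q\<in>Q. \<Sum>\<zeta>\<in>?C. cnj (M q (fst a) \<zeta> (snd a)) * M q (fst b) \<zeta> (snd b))" for a b
  have "psd_kernel ?I K"
    by (rule psd_kernel_gramI[where Q = "Q \<times> ?C" and D = "\<lambda>k a. M (fst k) (fst a) (snd k) (snd a)"])
      (simp add: K_def sum.cartesian_product case_prod_unfold)
  then obtain D where D: "\<And>a b. a \<in> ?I \<Longrightarrow> b \<in> ?I \<Longrightarrow> K a b = (\<Sum>k\<in>?I. cnj (D k a) * D k b)"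
    using psd_kernel_gram[of ?I K] \<Gamma> by auto
  \<comment> \<open>The rows of the factor D are again indexed by pairs (k, \<zeta>). Reading
    \<zeta> and \<eta> as matrix indices groups them into exactly n rows over the algebra, as
    \<open>mat_positive_in\<close> demands.\<close>
  define N where "N k j = (\<lambda>\<zeta> \<eta>. if \<zeta> \<in> ?C \<and> \<eta> \<in> ?C then D (k, \<zeta>) (j, \<eta>) else 0)" for k j
  have N: "N k j \<in> mats d \<Gamma>" for k j
    by (auto simp: N_def mats_def)
  have "X i j = (\<Sum>k<n. star (\<pi> \<Gamma> (N k i)) * \<pi> \<Gamma> (N k j))" if ij: "i < n" "j < n" for i j
  proof -
    have eq: "(\<Sum>q\<in>Q. \<Sum>\<zeta>\<in>?C. cnj (M q i \<zeta> \<omega>) * M q j \<zeta> \<eta>)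
        = (\<Sum>k<n. \<Sum>\<zeta>\<in>?C. cnj (N k i \<zeta> \<omega>) * N k j \<zeta> \<eta>)" for \<omega> \<eta>
    proof (cases "\<omega> \<in> ?C \<and> \<eta> \<in> ?C")
      case True
      then have "K (i, \<omega>) (j, \<eta>) = (\<Sum>k<n. \<Sum>\<zeta>\<in>?C. cnj (N k i \<zeta> \<omega>) * N k j \<zeta> \<eta>)"
        using ij by (simp add: D N_def sum.cartesian_product case_prod_unfold)
      then show ?thesis by (simp add: K_def)
    next
      case False
      then have "M q i \<zeta> \<omega> = 0 \<or> M q j \<zeta> \<eta> = 0" "N k i \<zeta> \<omega> = 0 \<or> N k j \<zeta> \<eta> = 0"
        if "q \<in> Q" for q k \<zeta>
        using M(1)[OF that ij(1)] M(1)[OF that ij(2)] by (auto simp: mats_def N_def)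
      then show ?thesis
        using False by (auto intro!: sum.neutral trans[OF sum.neutral sum.neutral[symmetric]] simp: N_def)
    qed
    have "X i j = (\<Sum>q\<in>Q. star (\<pi> \<Gamma> (M q i)) * \<pi> \<Gamma> (M q j))"
      using X[OF ij] M ij by simp
    also have "\<dots> = (\<Sum>k<n. star (\<pi> \<Gamma> (N k i)) * \<pi> \<Gamma> (N k j))"
      using M ij N \<Gamma> by (simp add: sum_star_pi_mult eq)
    finally show ?thesis .
  qed
  then show ?thesis
    unfolding mat_positive_in_def
    by (intro exI[of _ "\<lambda>k j. \<pi> \<Gamma> (N k j)"]) (use N in \<open>auto simp: local_alg_def\<close>)
qed

lemma local_dense_induct:
  assumes "closed {a. P a}" and "\<And>\<Lambda> a. finite \<Lambda> \<Longrightarrow> a \<in> alg \<Lambda> \<Longrightarrow> P a"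
  shows "P a"
proof -
  have "(\<Union>F\<in>{F. finite F \<and> F \<subseteq> UNIV}. alg F) \<subseteq> {a. P a}"
    using assms(2) by auto
  then have "region_alg d \<pi> UNIV \<subseteq> {a. P a}"
    unfolding region_alg_def by (rule closure_minimal[OF _ assms(1)])
  then show ?thesis
    using quasi_local by (auto simp: quasi_local_algebra_def)
qed

end

section \<open>Site expectations\<close>

locale site_expectations = quasi_local d \<pi>
  for d :: "'v \<Rightarrow> nat" and \<pi> :: "'v set \<Rightarrow> 'v cmat \<Rightarrow> 'a::cstar_algebra" +
  fixes \<phi>x :: "'v \<Rightarrow> 'a \<Rightarrow> complex" and \<phi>0 :: "'a \<Rightarrow> complex" and E0 :: "'v \<Rightarrow> 'a \<Rightarrow> 'a"
  assumes site_states: "\<And>x. state_on (alg {x}) (\<phi>x x)"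
    and phi0: "product_state d \<pi> \<phi>x \<phi>0"
    and E0: "\<And>x. site_cond_exp d \<pi> \<phi>x x (E0 x)"
begin

lemma E0_add: "E0 x (a + b) = E0 x a + E0 x b"
  and E0_scaleC: "E0 x (c *\<^sub>C a) = c *\<^sub>C E0 x a"
  and E0_norm: "norm (E0 x a) \<le> norm a"
  using E0[of x] by (auto simp: site_cond_exp_def clinear_on_def)

lemma E0_sum: "E0 x (\<Sum>i\<in>I. g i) = (\<Sum>i\<in>I. E0 x (g i))"
  using E0[of x] by (intro clinear_on_sum[of UNIV]) (auto simp: site_cond_exp_def)

lemma E0_scaleR: "E0 x (r *\<^sub>R a) = r *\<^sub>R E0 x a"
  by (simp add: E0_scaleC flip: scaleC_of_real)

lemma bounded_linear_E0: "bounded_linear (E0 x)"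
  by (rule bounded_linear_intro[where K = 1]) (auto simp: E0_add E0_scaleR E0_norm)

lemma alg_subset_region: "finite \<Gamma> \<Longrightarrow> x \<notin> \<Gamma> \<Longrightarrow> alg \<Gamma> \<subseteq> region_alg d \<pi> (- {x})"
  unfolding region_alg_def by (rule order_trans[OF _ closure_subset]) auto

lemma E0_id: "finite \<Gamma> \<Longrightarrow> x \<notin> \<Gamma> \<Longrightarrow> b \<in> alg \<Gamma> \<Longrightarrow> E0 x b = b"
  using E0[of x] alg_subset_region unfolding site_cond_exp_def by blast

lemma E0_one: "E0 x 1 = 1"
  using star_subalg_one[OF alg_star_subalg] by (intro E0_id[of "{}"]) auto

lemma E0_site_mult:
  "finite \<Gamma> \<Longrightarrow> x \<notin> \<Gamma> \<Longrightarrow> a \<in> alg {x} \<Longrightarrow> b \<in> alg \<Gamma> \<Longrightarrow> E0 x (a * b) = \<phi>x x a *\<^sub>C b"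
  using E0[of x] alg_subset_region unfolding site_cond_exp_def by blast

text \<open>The defining property places the value only in the algebra of the whole complement of x;
  the expansion at x shows that no site outside \<Lambda> is involved.\<close>

lemma E0_alg:
  assumes "finite \<Lambda>" "a \<in> alg \<Lambda>"
  shows "E0 x a \<in> alg (\<Lambda> - {x})"
proof (cases "x \<in> \<Lambda>")
  case True
  then have "a \<in> alg (insert x (\<Lambda> - {x}))" using assms by (simp add: insert_absorb)
  then obtain b where b: "\<And>i. i \<in> site_index x \<Longrightarrow> b i \<in> alg (\<Lambda> - {x})"
    "a = (\<Sum>i\<in>site_index x. site_unit x i * b i)"
    using alg_insert_decomp[of "\<Lambda> - {x}" x a] assms by auto
  have "E0 x a = (\<Sum>i\<in>site_index x. \<phi>x x (site_unit x i) *\<^sub>C b i)"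
    unfolding b(2) E0_sum
    using assms b(1) by (intro sum.cong refl E0_site_mult[of "\<Lambda> - {x}"]) (auto simp: site_unit_alg)
  then show ?thesis
    using b(1) assms by (auto intro!: star_subalg_sum star_subalg_scaleC alg_star_subalg)
next
  case False
  then show ?thesis using assms by (simp add: E0_id)
qed

text \<open>A consequence of the product formula: c commutes with the matrix units at x and can be
  moved next to the coefficients of a. Density of the local algebras extends this to every
  a.\<close>

lemma E0_module:
  assumes "finite \<Gamma>" "x \<notin> \<Gamma>" "c \<in> alg \<Gamma>"
  shows "E0 x (c * a) = c * E0 x a" "E0 x (a * c) = E0 x a * c"
proof -
  have "E0 x (c * a) = c * E0 x a \<and> E0 x (a * c) = E0 x a * c"
  proof (rule local_dense_induct[where P = "\<lambda>a. E0 x (c * a) = c * E0 x a \<and> E0 x (a * c) = E0 x a * c"])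
    show "closed {a. E0 x (c * a) = c * E0 x a \<and> E0 x (a * c) = E0 x a * c}"
      by (intro closed_Collect_conj closed_Collect_eq continuous_intros
          linear_continuous_on bounded_linear.continuous_on[OF bounded_linear_E0])
  next
    fix \<Lambda> a assume \<Lambda>: "finite \<Lambda>" "a \<in> alg \<Lambda>"
    define \<Delta> where "\<Delta> = \<Lambda> - {x}"
    have \<Delta>: "finite \<Delta>" "x \<notin> \<Delta>" "a \<in> alg (insert x \<Delta>)"
      using \<Lambda> alg_mono[of \<Lambda> "insert x \<Lambda>"] by (auto simp: \<Delta>_def)
    obtain b where b: "\<And>i. i \<in> site_index x \<Longrightarrow> b i \<in> alg \<Delta>"
      "a = (\<Sum>i\<in>site_index x. site_unit x i * b i)"
      using alg_insert_decomp[OF \<Delta>] by auto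
    have mem: "c * b i \<in> alg (\<Gamma> \<union> \<Delta>)" "b i * c \<in> alg (\<Gamma> \<union> \<Delta>)" if "i \<in> site_index x" for i
      using b(1)[OF that] assms \<Delta> alg_mono[of \<Gamma> "\<Gamma> \<union> \<Delta>"] alg_mono[of \<Delta> "\<Gamma> \<union> \<Delta>"]
      by (auto intro!: star_subalg_mult alg_star_subalg)
    have E: "E0 x (site_unit x i * f) = \<phi>x x (site_unit x i) *\<^sub>C f"
      if "i \<in> site_index x" "f \<in> alg (\<Gamma> \<union> \<Delta>)" for i f
      using that assms \<Delta> site_unit_alg by (intro E0_site_mult[of "\<Gamma> \<union> \<Delta>"]) auto
    have b': "b i \<in> alg (\<Gamma> \<union> \<Delta>)" if "i \<in> site_index x" for i
      using b(1)[OF that] assms \<Delta> alg_mono[of \<Delta> "\<Gamma> \<union> \<Delta>"] by auto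
    have comm: "c * site_unit x i = site_unit x i * c" if "i \<in> site_index x" for i
      using assms site_unit_alg[OF that] by (intro alg_commute[of \<Gamma> "{x}"]) auto
    have "E0 x (c * a) = (\<Sum>i\<in>site_index x. E0 x (site_unit x i * (c * b i)))"
      unfolding b(2) sum_distrib_left E0_sum
      by (intro sum.cong refl) (simp add: comm flip: mult.assoc)
    also have "\<dots> = c * (\<Sum>i\<in>site_index x. E0 x (site_unit x i * b i))"
      unfolding sum_distrib_left
      by (intro sum.cong refl) (simp add: E mem b' mult_scaleC_right)
    finally have l: "E0 x (c * a) = c * E0 x a"
      unfolding b(2) E0_sum .
    have "E0 x (a * c) = (\<Sum>i\<in>site_index x. E0 x (site_unit x i * (b i * c)))"
      unfolding b(2) sum_distrib_right E0_sum
      by (intro sum.cong refl) (simp add: mult.assoc)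
    also have "\<dots> = (\<Sum>i\<in>site_index x. E0 x (site_unit x i * b i)) * c"
      unfolding sum_distrib_right
      by (intro sum.cong refl) (simp add: E mem b' mult_scaleC_left)
    finally have "E0 x (a * c) = E0 x a * c"
      unfolding b(2) E0_sum .
    with l show "E0 x (c * a) = c * E0 x a \<and> E0 x (a * c) = E0 x a * c" by blast
  qed
  then show "E0 x (c * a) = c * E0 x a" "E0 x (a * c) = E0 x a * c" by auto
qed

text \<open>After expansion at x the scalars
  \<open>\<phi>x x (star (site_unit x l) * site_unit x m)\<close> appear; they form a positive
  semidefinite kernel because \<open>\<phi>x x\<close> is a state. Its Cholesky factor exhibits the
  image as a Gram matrix over the algebra of \<Gamma>, with too many rows, which
  \<open>mat_positive_in_gram\<close> compresses to n.\<close>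

lemma E0_completely_positive_insert:
  assumes \<Gamma>: "finite \<Gamma>" "x \<notin> \<Gamma>"
  shows "completely_positive_on (alg (insert x \<Gamma>)) (alg \<Gamma>) (E0 x)"
  unfolding completely_positive_on_def
proof (intro allI impI)
  fix n X assume "mat_positive_in n (alg (insert x \<Gamma>)) X"
  then obtain C where C: "\<And>i j. i < n \<Longrightarrow> j < n \<Longrightarrow> C i j \<in> alg (insert x \<Gamma>)"
    "\<And>i j. i < n \<Longrightarrow> j < n \<Longrightarrow> X i j = (\<Sum>k<n. star (C k i) * C k j)"
    unfolding mat_positive_in_def by blast
  let ?I = "site_index x" and ?u = "site_unit x"
  have "\<exists>b. \<forall>p. fst p < n \<and> snd p < n \<longrightarrow> (\<forall>l\<in>?I. b p l \<in> alg \<Gamma>) \<and> C (fst p) (snd p) = (\<Sum>l\<in>?I. ?u l * b p l)"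
  proof (rule choice, rule allI)
    fix p :: "nat \<times> nat"
    show "\<exists>b. fst p < n \<and> snd p < n \<longrightarrow> (\<forall>l\<in>?I. b l \<in> alg \<Gamma>) \<and> C (fst p) (snd p) = (\<Sum>l\<in>?I. ?u l * b l)"
      using alg_insert_decomp[OF \<Gamma>, of "C (fst p) (snd p)"] C(1)[of "fst p" "snd p"] by metis
  qed
  then obtain b0 where b0: "\<And>p. fst p < n \<and> snd p < n \<Longrightarrow> (\<forall>l\<in>?I. b0 p l \<in> alg \<Gamma>) \<and> C (fst p) (snd p) = (\<Sum>l\<in>?I. ?u l * b0 p l)"
    by blast
  define b where "b k i = b0 (k, i)" for k i
  have b: "C k i = (\<Sum>l\<in>?I. ?u l * b k i l)" "\<And>l. l \<in> ?I \<Longrightarrow> b k i l \<in> alg \<Gamma>" if "k < n" "i < n" for k i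
    using b0[of "(k, i)"] that by (auto simp: b_def)
  define G where "G l m = \<phi>x x (star (?u l) * ?u m)" for l m
  note site = alg_star_subalg[of "{x}", simplified]
  have "psd_kernel ?I G"
    unfolding psd_kernel_def
  proof
    fix v
    define w where "w = (\<Sum>l\<in>?I. v l *\<^sub>C ?u l)"
    have w: "w \<in> alg {x}"
      unfolding w_def by (intro star_subalg_sum[OF site] star_subalg_scaleC[OF site] site_unit_alg)
    have mem: "star (?u l) * ?u m \<in> alg {x}" if "l \<in> ?I" "m \<in> ?I" for l m
      using that by (intro star_subalg_mult[OF site] star_subalg_star[OF site] site_unit_alg)
    have scale: "\<phi>x x (c *\<^sub>C a) = c * \<phi>x x a" if "a \<in> alg {x}" for c a
      using site_states[of x] that by (auto simp: state_on_def)
    have "star w * w = (\<Sum>l\<in>?I. \<Sum>m\<in>?I. (cnj (v l) * v m) *\<^sub>C (star (?u l) * ?u m))"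
      by (simp add: w_def star_sum sum_product star_scaleC mult_scaleC_left mult_scaleC_right scaleC_scaleC mult.commute)
    also have "\<phi>x x \<dots> = (\<Sum>l\<in>?I. \<Sum>m\<in>?I. \<phi>x x ((cnj (v l) * v m) *\<^sub>C (star (?u l) * ?u m)))"
      using mem by (simp add: state_on_sum[OF site site_states] star_subalg_sum[OF site] star_subalg_scaleC[OF site])
    also have "\<dots> = (\<Sum>l\<in>?I. \<Sum>m\<in>?I. cnj (v l) * G l m * v m)"
      by (intro sum.cong refl) (simp add: mem scale G_def)
    finally show "(\<Sum>l\<in>?I. \<Sum>m\<in>?I. cnj (v l) * G l m * v m) \<in> \<real>\<^sub>\<ge>\<^sub>0"
      using site_states[of x] w unfolding state_on_def by metis
  qed
  then obtain D where D: "\<And>l m. l \<in> ?I \<Longrightarrow> m \<in> ?I \<Longrightarrow> G l m = (\<Sum>k\<in>?I. cnj (D k l) * D k m)"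
    using psd_kernel_gram[of ?I G] by auto
  define W where "W q i = (\<Sum>l\<in>?I. D (snd q) l *\<^sub>C b (fst q) i l)" for q i
  show "mat_positive_in n (alg \<Gamma>) (\<lambda>i j. E0 x (X i j))"
  proof (rule mat_positive_in_gram[of \<Gamma> "{..<n} \<times> ?I"])
    show "W q i \<in> alg \<Gamma>" if "q \<in> {..<n} \<times> ?I" "i < n" for q i
      unfolding W_def
      using that b(2) \<Gamma> by (intro star_subalg_sum star_subalg_scaleC alg_star_subalg) auto
  next
    fix i j assume ij: "i < n" "j < n"
    have k: "E0 x (star (C k i) * C k j) = (\<Sum>p\<in>?I. star (W (k, p) i) * W (k, p) j)" if "k < n" for k
    proof -
      have "star (C k i) * C k j = (\<Sum>l\<in>?I. \<Sum>m\<in>?I. (star (?u l) * ?u m) * (star (b k i l) * b k j m))"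
        unfolding b(1)[OF \<open>k < n\<close> ij(1)] b(1)[OF \<open>k < n\<close> ij(2)] star_sum sum_product
      proof (intro sum.cong refl)
        fix l m assume lm: "l \<in> ?I" "m \<in> ?I"
        have "star (b k i l) \<in> alg \<Gamma>"
          using b(2) that ij lm \<Gamma> by (intro star_subalg_star alg_star_subalg)
        then have "star (b k i l) * (star (?u l) * ?u m) * b k j m = (star (?u l) * ?u m) * star (b k i l) * b k j m"
          using lm \<Gamma> by (intro arg_cong[where f = "\<lambda>a. a * b k j m"] alg_commute[of \<Gamma> "{x}"] star_subalg_mult[OF site] star_subalg_star[OF site] site_unit_alg) auto
        then show "star (?u l * b k i l) * (?u m * b k j m) = (star (?u l) * ?u m) * (star (b k i l) * b k j m)"
          by (simp only: star_mult mult.assoc)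
      qed
      then have "E0 x (star (C k i) * C k j)
          = (\<Sum>l\<in>?I. \<Sum>m\<in>?I. E0 x ((star (?u l) * ?u m) * (star (b k i l) * b k j m)))"
        by (simp only: E0_sum)
      also have "\<dots> = (\<Sum>l\<in>?I. \<Sum>m\<in>?I. G l m *\<^sub>C (star (b k i l) * b k j m))"
        unfolding G_def
      proof (intro sum.cong refl E0_site_mult[OF \<Gamma>])
        fix l m assume lm: "l \<in> ?I" "m \<in> ?I"
        show "star (?u l) * ?u m \<in> alg {x}"
          using lm by (intro star_subalg_mult[OF site] star_subalg_star[OF site] site_unit_alg)
        show "star (b k i l) * b k j m \<in> alg \<Gamma>"
          using lm b(2)[OF that] ij \<Gamma> by (intro star_subalg_mult star_subalg_star alg_star_subalg)
      qed
      also have "\<dots> = (\<Sum>l\<in>?I. \<Sum>m\<in>?I. \<Sum>p\<in>?I. (cnj (D p l) * D p m) *\<^sub>C (star (b k i l) * b k j m))"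
        by (intro sum.cong refl) (simp add: D scaleC_sum_left)
      also have "\<dots> = (\<Sum>l\<in>?I. \<Sum>p\<in>?I. \<Sum>m\<in>?I. (cnj (D p l) * D p m) *\<^sub>C (star (b k i l) * b k j m))"
        by (rule sum.cong[OF refl sum.swap])
      also have "\<dots> = (\<Sum>p\<in>?I. \<Sum>l\<in>?I. \<Sum>m\<in>?I. (cnj (D p l) * D p m) *\<^sub>C (star (b k i l) * b k j m))"
        by (rule sum.swap)
      also have "\<dots> = (\<Sum>p\<in>?I. star (W (k, p) i) * W (k, p) j)"
        by (simp add: W_def star_sum sum_product star_scaleC mult_scaleC_left mult_scaleC_right scaleC_scaleC mult.commute)
      finally show ?thesis .
    qed
    have "E0 x (X i j) = (\<Sum>k<n. \<Sum>p\<in>?I. star (W (k, p) i) * W (k, p) j)"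
      unfolding C(2)[OF ij] E0_sum by (intro sum.cong refl) (simp add: k)
    then show "E0 x (X i j) = (\<Sum>q\<in>{..<n} \<times> ?I. star (W q i) * W q j)"
      by (simp add: sum.cartesian_product case_prod_unfold)
  qed (use \<Gamma> in auto)
qed

lemma E0_completely_positive:
  assumes "finite \<Lambda>"
  shows "completely_positive_on (alg \<Lambda>) (alg (\<Lambda> - {x})) (E0 x)"
  using completely_positive_on_restrict[OF E0_completely_positive_insert[of "\<Lambda> - {x}" x] alg_mono[of \<Lambda>]] assms
  by auto

subsection \<open>The product state\<close>

lemma phi0_state: "state_on UNIV \<phi>0"
  using phi0 by (simp add: product_state_def)

lemma phi0_add: "\<phi>0 (a + b) = \<phi>0 a + \<phi>0 b"
  and phi0_scaleC: "\<phi>0 (c *\<^sub>C a) = c * \<phi>0 a"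
  and phi0_pos: "\<phi>0 (star a * a) \<in> \<real>\<^sub>\<ge>\<^sub>0"
  and phi0_one: "\<phi>0 1 = 1"
  using phi0_state by (auto simp: state_on_def)

lemma phi0_sum: "\<phi>0 (\<Sum>i\<in>I. g i) = (\<Sum>i\<in>I. \<phi>0 (g i))"
  using phi0_state by (intro state_on_sum[of UNIV]) auto

lemma phi0_prod:
  assumes "finite F" "\<And>x. x \<in> F \<Longrightarrow> a x \<in> alg {x}"
  shows "\<phi>0 (cprod a F) = (\<Prod>x\<in>F. \<phi>x x (a x))"
  using phi0 assms by (auto simp: product_state_def)

lemma alg_empty: "a \<in> alg {} \<Longrightarrow> \<exists>c. a = c *\<^sub>C 1"
proof -
  assume "a \<in> alg {}"
  then obtain M where M: "M \<in> mats d {}" "a = \<pi> {} M"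
    by (auto simp: local_alg_def)
  have "M = (\<lambda>\<omega> \<eta>. M (\<lambda>_. undefined) (\<lambda>_. undefined) * mat_one d {} \<omega> \<eta>)"
  proof (intro ext)
    fix \<omega> \<eta>
    show "M \<omega> \<eta> = M (\<lambda>_. undefined) (\<lambda>_. undefined) * mat_one d {} \<omega> \<eta>"
      using M(1) by (cases "\<omega> = (\<lambda>_. undefined)"; cases "\<eta> = (\<lambda>_. undefined)")
        (simp_all add: mats_def mat_one_def configs_def)
  qed
  then have "a = M (\<lambda>_. undefined) (\<lambda>_. undefined) *\<^sub>C \<pi> {} (mat_one d {})"
    using pi_scale[of "{}" "mat_one d {}"] M(2) mat_one_mats by (metis finite.emptyI)
  then show ?thesis by (auto simp: pi_one)
qed

text \<open>The hypothesis on \<phi>0 speaks only of products of single-site elements. Each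
  induction step expands b at a site z and moves the matrix unit into the product over G, leaving an
  element of the smaller region.\<close>

lemma phi0_prod_mult:
  assumes "finite \<Lambda>" "b \<in> alg \<Lambda>" "finite G" "G \<inter> \<Lambda> = {}" "\<And>x. x \<in> G \<Longrightarrow> a x \<in> alg {x}"
  shows "\<phi>0 (cprod a G * b) = (\<Prod>x\<in>G. \<phi>x x (a x)) * \<phi>0 b"
  using assms
proof (induction \<Lambda> arbitrary: b G a rule: finite_induct)
  case empty
  then obtain c where "b = c *\<^sub>C 1" using alg_empty by blast
  then show ?case
    using phi0_prod[of G a] empty by (simp add: mult_scaleC_right phi0_scaleC phi0_one)
next
  case (insert z \<Lambda>)
  obtain e where e: "\<And>i. i \<in> site_index z \<Longrightarrow> e i \<in> alg \<Lambda>"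
    "b = (\<Sum>i\<in>site_index z. site_unit z i * e i)"
    using alg_insert_decomp[of \<Lambda> z b] insert by auto
  let ?P = "\<Prod>x\<in>G. \<phi>x x (a x)"
  have "\<phi>0 (cprod a G * (site_unit z i * e i)) = ?P * \<phi>0 (site_unit z i * e i)" if i: "i \<in> site_index z" for i
  proof -
    define a' where "a' = a(z := site_unit z i)"
    have z: "z \<notin> G" using insert by auto
    have a': "a' x \<in> alg {x}" if "x \<in> insert z G" for x
      using that i insert by (auto simp: a'_def site_unit_alg)
    have "a' x * a' y = a' y * a' x" if "x \<in> insert z G" "y \<in> insert z G" for x y
      using a'[OF that(1)] a'[OF that(2)] alg_commute[of "{x}" "{y}" "a' x" "a' y"] by (cases "x = y") auto
    then have "cprod a' (insert z G) = a' z * cprod a' G"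
      using insert.prems(2) z by (intro cprod_insert)
    moreover have "cprod a' G = cprod a G"
      unfolding cprod_def using z by (intro fold_closed_eq[where B = UNIV]) (auto simp: a'_def)
    moreover have "a' z * cprod a G = cprod a G * a' z"
    proof (rule cprod_induct[where P = "\<lambda>p. a' z * p = p * a' z"])
      show "a x * a y = a y * a x" if "x \<in> G" "y \<in> G" for x y
        using insert.prems(4)[OF that(1)] insert.prems(4)[OF that(2)] alg_commute[of "{x}" "{y}" "a x" "a y"]
        by (cases "x = y") auto
      fix x p assume x: "x \<in> G" and p: "a' z * p = p * a' z"
      have "a' z * a x = a x * a' z"
        using a'[of z] insert.prems(4)[OF x] x z by (intro alg_commute[of "{z}" "{x}"]) auto
      then show "a' z * (a x * p) = a x * p * a' z"
        using p by (metis mult.assoc)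
    qed (use insert in auto)
    ultimately have 1: "cprod a G * (site_unit z i * e i) = cprod a' (insert z G) * e i"
      by (simp add: a'_def mult.assoc)
    have "\<phi>0 (cprod a' (insert z G) * e i) = (\<Prod>x\<in>insert z G. \<phi>x x (a' x)) * \<phi>0 (e i)"
      using insert.prems insert.hyps e(1)[OF i] a' by (intro insert.IH) auto
    also have "(\<Prod>x\<in>insert z G. \<phi>x x (a' x)) = \<phi>x z (site_unit z i) * ?P"
    proof -
      have "(\<Prod>x\<in>G. \<phi>x x (a' x)) = ?P"
        using z by (intro prod.cong) (auto simp: a'_def)
      then show ?thesis using z insert.prems by (simp add: a'_def)
    qed
    finally have 2: "\<phi>0 (cprod a G * (site_unit z i * e i)) = \<phi>x z (site_unit z i) * ?P * \<phi>0 (e i)"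
      unfolding 1 .
    \<comment> \<open>The induction hypothesis with G = {z} evaluates \<phi>0 at
      \<open>site_unit z i * e i\<close>, so the site factor can be put back into b.\<close>
    have "\<phi>0 (cprod (\<lambda>_. site_unit z i) {z} * e i) = (\<Prod>x\<in>{z}. \<phi>x x (site_unit z i)) * \<phi>0 (e i)"
      using insert.hyps e(1)[OF i] site_unit_alg[OF i] by (intro insert.IH) auto
    moreover have "cprod (\<lambda>_. site_unit z i) {z} = site_unit z i"
      using cprod_insert[of "{}" z "\<lambda>_. site_unit z i"] by simp
    ultimately show ?thesis using 2 by simp
  qed
  then show ?case
    unfolding e(2) sum_distrib_left phi0_sum by (intro sum.cong refl)
qed

lemma phi0_bounded_linear: "bounded_linear \<phi>0"
proof (rule bounded_linear_intro[where K = 2])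
  show "norm (\<phi>0 a) \<le> norm a * 2" for a
    using state_on_bound[OF _ _ phi0_state, of a] by simp
  show "\<phi>0 (r *\<^sub>R a) = r *\<^sub>R \<phi>0 a" for r a
    using phi0_scaleC[of "of_real r" a] by (simp add: scaleC_of_real scaleR_conv_of_real[of r "\<phi>0 a"])
qed (rule phi0_add)

text \<open>For a matrix unit u at x and b away from x, both sides are
  \<open>\<phi>x x u * \<phi>0 b\<close>; expansion and density do the rest.\<close>

lemma phi0_E0: "\<phi>0 (E0 x a) = \<phi>0 a"
proof (rule local_dense_induct[where P = "\<lambda>a. \<phi>0 (E0 x a) = \<phi>0 a"])
  show "closed {a. \<phi>0 (E0 x a) = \<phi>0 a}"
    by (intro closed_Collect_eq continuous_intros bounded_linear.continuous_on[OF bounded_linear_E0]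
        bounded_linear.continuous_on[OF phi0_bounded_linear])
next
  fix \<Lambda> a assume \<Lambda>: "finite \<Lambda>" "a \<in> alg \<Lambda>"
  define \<Delta> where "\<Delta> = \<Lambda> - {x}"
  have \<Delta>: "finite \<Delta>" "x \<notin> \<Delta>" "a \<in> alg (insert x \<Delta>)"
    using \<Lambda> alg_mono[of \<Lambda> "insert x \<Lambda>"] by (auto simp: \<Delta>_def)
  obtain b where b: "\<And>i. i \<in> site_index x \<Longrightarrow> b i \<in> alg \<Delta>"
    "a = (\<Sum>i\<in>site_index x. site_unit x i * b i)"
    using alg_insert_decomp[OF \<Delta>] by auto
  have "\<phi>0 (E0 x (site_unit x i * b i)) = \<phi>0 (site_unit x i * b i)" if i: "i \<in> site_index x" for i
  proof -
    have "cprod (\<lambda>_. site_unit x i) {x} = site_unit x i"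
      using cprod_insert[of "{}" x "\<lambda>_. site_unit x i"] by simp
    then show ?thesis
      using phi0_prod_mult[of \<Delta> "b i" "{x}" "\<lambda>_. site_unit x i"] b(1)[OF i] \<Delta> site_unit_alg[OF i]
      by (simp add: E0_site_mult[of \<Delta>] phi0_scaleC)
  qed
  then show "\<phi>0 (E0 x a) = \<phi>0 a"
    unfolding b(2) E0_sum phi0_sum by (intro sum.cong refl)
qed

end

section \<open>Quasi-conditional expectations\<close>

lemma quasi_cond_expD:
  assumes "quasi_cond_exp C B A E"
  shows "C \<subseteq> B" "B \<subseteq> A"
    and "a \<in> A \<Longrightarrow> b \<in> A \<Longrightarrow> E (a + b) = E a + E b" "a \<in> A \<Longrightarrow> E (r *\<^sub>C a) = r *\<^sub>C E a"
    and "a \<in> A \<Longrightarrow> E a \<in> B" "completely_positive_on A B E" "E 1 = 1"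
    and "c \<in> C \<Longrightarrow> a \<in> A \<Longrightarrow> E (c * a) = c * E a"
  using assms unfolding quasi_cond_exp_def clinear_on_def by blast+

lemma quasi_cond_expI:
  assumes "C \<subseteq> B" "B \<subseteq> A"
    and "\<And>a b. a \<in> A \<Longrightarrow> b \<in> A \<Longrightarrow> E (a + b) = E a + E b" "\<And>r a. a \<in> A \<Longrightarrow> E (r *\<^sub>C a) = r *\<^sub>C E a"
    and "\<And>a. a \<in> A \<Longrightarrow> E a \<in> B" "completely_positive_on A B E" "E 1 = 1"
    and "\<And>c a. c \<in> C \<Longrightarrow> a \<in> A \<Longrightarrow> E (c * a) = c * E a"
  shows "quasi_cond_exp C B A E"
  using assms unfolding quasi_cond_exp_def clinear_on_def by blast

text \<open>Keeping the same C for both maps lets a long composition of site maps remain a module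
  map over one fixed algebra.\<close>

lemma quasi_cond_exp_comp:
  assumes E: "quasi_cond_exp C B A E" and F: "quasi_cond_exp C B' B F"
  shows "quasi_cond_exp C B' A (F \<circ> E)"
proof (rule quasi_cond_expI)
  show "completely_positive_on A B' (F \<circ> E)"
    using quasi_cond_expD(6)[OF E] quasi_cond_expD(6)[OF F] by (rule completely_positive_on_comp)
  show "C \<subseteq> B'" "B' \<subseteq> A"
    using quasi_cond_expD(1,2)[OF E] quasi_cond_expD(1,2)[OF F] by auto
qed (simp_all add: quasi_cond_expD(3-5,7,8)[OF E] quasi_cond_expD(3-5,7,8)[OF F])

lemma quasi_cond_exp_restrict:
  assumes E: "quasi_cond_exp C B A E" and A': "B \<subseteq> A'" "A' \<subseteq> A"
  shows "quasi_cond_exp C B A' E"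
proof (rule quasi_cond_expI)
  show "completely_positive_on A' B E"
    using quasi_cond_expD(6)[OF E] A'(2) by (rule completely_positive_on_restrict)
qed (use A' in \<open>auto simp: quasi_cond_expD(3-5,7,8)[OF E] subset_iff dest: quasi_cond_expD(1)[OF E, THEN subsetD]\<close>)

lemma quasi_cond_exp_id: "C \<subseteq> A \<Longrightarrow> quasi_cond_exp C A A (\<lambda>a. a)"
  by (auto simp: quasi_cond_exp_def clinear_on_def completely_positive_on_def)

section \<open>Amplitudes\<close>

locale amplitudes = site_expectations d \<pi> \<phi>x \<phi>0 E0
  for d :: "'v \<Rightarrow> nat" and \<pi> :: "'v set \<Rightarrow> 'v cmat \<Rightarrow> 'a::cstar_algebra"
    and \<phi>x :: "'v \<Rightarrow> 'a \<Rightarrow> complex" and \<phi>0 :: "'a \<Rightarrow> complex" and E0 :: "'v \<Rightarrow> 'a \<Rightarrow> 'a" +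
  fixes adj :: "'v \<Rightarrow> 'v \<Rightarrow> bool" and V0 :: "'v set" and Kt :: "'v \<Rightarrow> 'v \<Rightarrow> 'a"
  assumes graph: "inf_graph adj"
    and indep: "independent_in adj V0"
    and Kt_local: "\<And>x y. y \<in> V0 \<Longrightarrow> x \<in> nbrs adj y \<Longrightarrow> Kt x y \<in> alg {x, y}"
    and Kt_inv: "\<And>x y. y \<in> V0 \<Longrightarrow> x \<in> nbrs adj y \<Longrightarrow> invertible_elem (Kt x y)"
    and K_comm: "commutative_on (gen_alg adj V0 Kt)"
    and B_comm: "\<And>y. y \<in> V0 \<Longrightarrow> B_op adj E0 Kt y \<in> commutant (gen_alg adj V0 Kt)"
begin

abbreviation "nb y \<equiv> insert y (nbrs adj y)"
abbreviation "gen \<equiv> gen_alg adj V0 Kt"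
abbreviation "B \<equiv> B_op adj E0 Kt"
abbreviation "K \<equiv> K_site adj alg E0 Kt"

definition P :: "'v \<Rightarrow> 'a" where
  "P y = cprod (\<lambda>x. Kt x y) (nbrs adj y)"

definition Bisq :: "'v \<Rightarrow> 'a" where
  "Bisq y = inv_sqrt_in (alg (nbrs adj y)) (B y)"

section \<open>Neighbourhoods and commutation of the amplitudes\<close>

lemma finite_nbrs [simp]: "finite (nbrs adj y)"
  using graph by (simp add: inf_graph_def nbrs_def)

lemma nbrs_irrefl [simp]: "y \<notin> nbrs adj y"
  using graph by (simp add: inf_graph_def nbrs_def irreflp_def)

lemma nbrs_sym: "x \<in> nbrs adj y \<longleftrightarrow> y \<in> nbrs adj x"
  using graph by (auto simp: inf_graph_def nbrs_def symp_def)

lemma V0_nbrs: "y \<in> V0 \<Longrightarrow> z \<in> V0 \<Longrightarrow> z \<notin> nbrs adj y"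
  using indep by (auto simp: independent_in_def nbrs_def)

lemma gen_star_subalg: "star_subalg gen"
proof -
  have inter: "cstar_subalgebra (\<Inter>T)" if "\<forall>t\<in>T. cstar_subalgebra t" for T :: "'a set set"
  proof -
    have T: "star_subalg t" "closed t" if "t \<in> T" for t
      using that \<open>\<forall>t\<in>T. cstar_subalgebra t\<close> by (auto simp: cstar_subalgebra_iff)
    show ?thesis
      unfolding cstar_subalgebra_iff star_subalg_def
      by (intro conjI closed_Inter ballI allI InterI)
        (simp_all add: T star_subalg_one star_subalg_add star_subalg_mult star_subalg_scaleC star_subalg_star)
  qed
  have "cstar_subalgebra gen"
    unfolding gen_alg_def by (rule hull_in) (rule inter)
  then show ?thesis by (simp add: cstar_subalgebra_iff)
qed

lemma Kt_gen: "y \<in> V0 \<Longrightarrow> x \<in> nbrs adj y \<Longrightarrow> Kt x y \<in> gen"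
  unfolding gen_alg_def by (rule hull_inc) auto

lemma gen_commute: "a \<in> gen \<Longrightarrow> b \<in> gen \<Longrightarrow> a * b = b * a"
  using K_comm by (auto simp: commutative_on_def)

lemma P_mem:
  assumes "y \<in> V0"
  shows "P y \<in> gen" "P y \<in> alg (nb y)" "invertible_elem (P y)"
proof -
  have Kt_alg: "Kt x y \<in> alg (nb y)" if "x \<in> nbrs adj y" for x
    using Kt_local[OF assms that] alg_mono[of "{x, y}" "nb y"] that by auto
  have comm: "Kt x y * Kt z y = Kt z y * Kt x y" if "x \<in> nbrs adj y" "z \<in> nbrs adj y" for x z
    using that assms by (intro gen_commute Kt_gen)
  have "invertible_elem (1::'a)"
    unfolding invertible_elem_def by (rule exI[of _ 1]) simp
  note one = this star_subalg_one[OF gen_star_subalg] star_subalg_one[OF alg_star_subalg]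
  have "P y \<in> gen \<and> P y \<in> alg (nb y) \<and> invertible_elem (P y)"
    unfolding P_def
  proof (rule cprod_induct[where P = "\<lambda>p. p \<in> gen \<and> p \<in> alg (nb y) \<and> invertible_elem p"])
    fix x p assume "x \<in> nbrs adj y" "p \<in> gen \<and> p \<in> alg (nb y) \<and> invertible_elem p"
    then show "Kt x y * p \<in> gen \<and> Kt x y * p \<in> alg (nb y) \<and> invertible_elem (Kt x y * p)"
      using Kt_gen[OF assms] Kt_alg Kt_inv[OF assms]
      by (simp add: star_subalg_mult[OF gen_star_subalg] star_subalg_mult[OF alg_star_subalg] invertible_elem_mult)
  qed (simp_all add: comm one)
  then show "P y \<in> gen" "P y \<in> alg (nb y)" "invertible_elem (P y)" by auto
qed

lemma B_eq: "B y = E0 y (star (P y) * P y)"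
  by (simp add: B_op_def abs_sq_def P_def)

lemma B_alg: "y \<in> V0 \<Longrightarrow> B y \<in> alg (nbrs adj y)"
  using E0_alg[of "nb y" "star (P y) * P y" y] P_mem
  by (simp add: B_eq star_subalg_mult star_subalg_star alg_star_subalg)

text \<open>Complete positivity of \<open>E0 y\<close> for 1 by 1 matrices factors
  \<open>B y\<close> as \<open>star c * c\<close>.\<close>

lemma B_self_adjoint:
  assumes "y \<in> V0"
  shows "star (B y) = B y"
proof -
  have "mat_positive_in 1 (alg (nb y)) (\<lambda>_ _. star (P y) * P y)"
    unfolding mat_positive_in_def by (rule exI[of _ "\<lambda>_ _. P y"]) (simp add: P_mem assms)
  then have "mat_positive_in 1 (alg (nbrs adj y)) (\<lambda>_ _. B y)"
    using E0_completely_positive[of "nb y" y] by (simp add: completely_positive_on_def B_eq)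
  then obtain c where "B y = star c * c"
    by (auto simp: mat_positive_in_def)
  then show ?thesis by (simp add: star_mult star_star)
qed

text \<open>As \<open>E0 y\<close> is unital and contractive, it carries the bound \<open>\<parallel>1 - P\<^sup>* P / r\<parallel> < 1\<close> over to \<open>B y\<close>.\<close>

lemma Bisq:
  assumes "y \<in> V0"
  shows "Bisq y \<in> alg (nbrs adj y)" "star (Bisq y) = Bisq y" "Bisq y * B y * Bisq y = 1"
    "a * B y = B y * a \<Longrightarrow> a * Bisq y = Bisq y * a"
proof -
  obtain \<tau> k where "faithful_state (alg (nb y)) \<tau> k"
    using faithful_state_alg[of "nb y"] by auto
  then obtain r where r: "r > 0" "norm (1 - (star (P y) * P y) /\<^sub>R r) < 1"
    using faithful_state.invertible_contraction P_mem[OF assms] by metis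
  \<comment> \<open>The first faithful state lives on the algebra containing \<open>P y\<close>;
    this second one, on the neighbours alone, serves the uniqueness of the root there.\<close>
  obtain \<tau>' k' where f: "faithful_state (alg (nbrs adj y)) \<tau>' k'"
    using faithful_state_alg[of "nbrs adj y"] by auto
  define x where "x = 1 - B y /\<^sub>R r"
  have "x = E0 y (1 - (star (P y) * P y) /\<^sub>R r)"
    by (simp add: x_def B_eq E0_one E0_scaleR linear_diff[OF bounded_linear.linear[OF bounded_linear_E0]])
  then have "norm x < 1"
    using r(2) E0_norm le_less_trans by metis
  moreover have "x \<in> alg (nbrs adj y)"
    unfolding x_def using B_alg[OF assms]
    by (intro star_subalg_diff star_subalg_scaleR star_subalg_one alg_star_subalg) auto
  moreover have "star x = x"
    by (simp add: x_def star_diff star_scaleR B_self_adjoint assms)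
  moreover have "B y = r *\<^sub>R (1 - x)"
    using r(1) by (simp add: x_def)
  ultimately show "Bisq y \<in> alg (nbrs adj y)" "star (Bisq y) = Bisq y" "Bisq y * B y * Bisq y = 1"
    "a * B y = B y * a \<Longrightarrow> a * Bisq y = Bisq y * a"
    unfolding Bisq_def using faithful_state.inv_sqrt_in[OF f _ _ _ r(1)] by metis+
qed

lemma Bisq_gen_commute: "y \<in> V0 \<Longrightarrow> a \<in> gen \<Longrightarrow> a * Bisq y = Bisq y * a"
  using B_comm[of y] by (intro Bisq(4)) (auto simp: commutant_def)

text \<open>\<open>B y\<close> commutes with \<open>|P z|\<^sup>2\<close> and does not involve the site \<open>z\<close> that \<open>E0 z\<close> integrates out.\<close>

lemma B_commute:
  assumes "y \<in> V0" "z \<in> V0"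
  shows "B y * B z = B z * B y"
proof -
  have "star (P z) * P z \<in> gen"
    by (intro star_subalg_mult star_subalg_star gen_star_subalg P_mem assms)
  then have "B y * (star (P z) * P z) = (star (P z) * P z) * B y"
    using B_comm[OF assms(1)] by (simp add: commutant_def)
  then show ?thesis
    using E0_module[of "nbrs adj y" z "B y" "star (P z) * P z"] V0_nbrs[OF assms] B_alg[OF assms(1)]
    by (simp add: B_eq[of z])
qed

text \<open>The commutation rule of \<open>Bisq\<close> is used twice, replacing first one and then
  the other operator by its inverse root.\<close>

lemma Bisq_commute: "y \<in> V0 \<Longrightarrow> z \<in> V0 \<Longrightarrow> Bisq y * Bisq z = Bisq z * Bisq y"
  by (metis Bisq(4) B_commute)

lemma K_eq: "K y = P y * Bisq y"
  by (simp add: K_site_def P_def Bisq_def)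

lemma K_commute:
  assumes "y \<in> V0" "z \<in> V0"
  shows "K y * K z = K z * K y"
proof -
  have "K y * K z = P y * (Bisq y * P z) * Bisq z"
    by (simp add: K_eq mult.assoc)
  also have "\<dots> = (P y * P z) * (Bisq y * Bisq z)"
    using Bisq_gen_commute[OF assms(1) P_mem(1)[OF assms(2)]] by (metis mult.assoc)
  also have "\<dots> = (P z * P y) * (Bisq z * Bisq y)"
    using Bisq_commute[OF assms] gen_commute[OF P_mem(1) P_mem(1)] assms by simp
  also have "\<dots> = P z * (Bisq z * P y) * Bisq y"
    using Bisq_gen_commute[OF assms(2) P_mem(1)[OF assms(1)]] by (metis mult.assoc)
  also have "\<dots> = K z * K y"
    by (simp add: K_eq mult.assoc)
  finally show ?thesis .
qed

lemma K_alg: "y \<in> V0 \<Longrightarrow> K y \<in> alg (nb y)"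
  using P_mem(2)[of y] Bisq(1)[of y] alg_mono[of "nbrs adj y" "nb y"]
  by (auto simp: K_eq intro!: star_subalg_mult alg_star_subalg)

text \<open>\<open>Bisq y\<close> is localized on the neighbours of y, so it leaves
  \<open>E0 y\<close> on both sides and meets \<open>B y\<close> in between.\<close>

lemma E0_abs_K:
  assumes "y \<in> V0"
  shows "E0 y (star (K y) * K y) = 1"
proof -
  have "star (K y) * K y = Bisq y * (star (P y) * P y) * Bisq y"
    by (simp add: K_eq star_mult Bisq(2) assms mult.assoc)
  then show ?thesis
    using E0_module[of "nbrs adj y" y "Bisq y"] Bisq[OF assms] by (simp flip: B_eq)
qed

section \<open>Dressed site expectations\<close>

definition T :: "'v \<Rightarrow> 'a \<Rightarrow> 'a" where
  "T y a = E0 y (star (K y) * a * K y)"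

lemma T_one: "y \<in> V0 \<Longrightarrow> T y 1 = 1"
  by (simp add: T_def E0_abs_K)

text \<open>Locality moves c past the amplitude, and the module property moves it out of
  \<open>E0 y\<close>. The first step uses disjointness from all of \<open>nb y\<close>, not just
  from y; this is why the final maps are only quasi-conditional expectations.\<close>

lemma T_module:
  assumes "y \<in> V0" "finite F" "nb y \<inter> F = {}" "c \<in> alg F"
  shows "T y (c * a) = c * T y a"
proof -
  have "star (K y) * c = c * star (K y)"
    using assms K_alg[OF assms(1)]
    by (intro alg_commute[of "nb y" F] star_subalg_star alg_star_subalg) auto
  then have "star (K y) * (c * a) * K y = c * (star (K y) * a * K y)"
    by (metis mult.assoc)
  then show ?thesis
    using assms E0_module(1)[of F y c] by (simp add: T_def)
qed

lemma T_local:
  "y \<in> V0 \<Longrightarrow> finite F \<Longrightarrow> nb y \<inter> F = {} \<Longrightarrow> a \<in> alg F \<Longrightarrow> T y a = a"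
  using T_module[of y F a 1] by (simp add: T_one)

lemma quasi_cond_exp_E0:
  assumes "finite \<Gamma>" "\<Lambda> \<subseteq> \<Gamma>" "x \<notin> \<Lambda>"
  shows "quasi_cond_exp (alg \<Lambda>) (alg (\<Gamma> - {x})) (alg \<Gamma>) (E0 x)"
  unfolding quasi_cond_exp_def
proof (intro conjI ballI)
  show "alg \<Lambda> \<subseteq> alg (\<Gamma> - {x})" "alg (\<Gamma> - {x}) \<subseteq> alg \<Gamma>"
    using assms by (simp_all add: alg_mono subset_Diff_insert)
  show "E0 x ` alg \<Gamma> \<subseteq> alg (\<Gamma> - {x})"
    using E0_alg assms by blast
  show "E0 x (c * a) = c * E0 x a" if "c \<in> alg \<Lambda>" for c a
    using assms that finite_subset by (intro E0_module[of \<Lambda>]) auto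
qed (simp_all add: clinear_on_def E0_add E0_scaleC E0_one E0_completely_positive assms)

text \<open>The amplitude may spread an observable over the neighbours of y, hence the condition
  \<open>nb y \<subseteq> \<Gamma>\<close>, while only y itself is erased.\<close>

lemma quasi_cond_exp_T:
  assumes y: "y \<in> V0" "nb y \<subseteq> \<Gamma>" "nb y \<inter> \<Lambda> = {}" and \<Gamma>: "finite \<Gamma>" "\<Lambda> \<subseteq> \<Gamma>"
  shows "quasi_cond_exp (alg \<Lambda>) (alg (\<Gamma> - {y})) (alg \<Gamma>) (T y)"
  unfolding quasi_cond_exp_def
proof (intro conjI ballI)
  have K: "K y \<in> alg \<Gamma>"
    using K_alg[OF y(1)] alg_mono[OF y(2) \<Gamma>(1)] by auto
  note E = quasi_cond_exp_E0[OF \<Gamma>, of y]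
  show "alg \<Lambda> \<subseteq> alg (\<Gamma> - {y})" "alg (\<Gamma> - {y}) \<subseteq> alg \<Gamma>"
    using E y by (auto simp: quasi_cond_exp_def)
  show "clinear_on (alg \<Gamma>) (T y)"
    by (simp add: clinear_on_def T_def ring_distribs E0_add E0_scaleC mult_scaleC_left mult_scaleC_right)
  show "T y ` alg \<Gamma> \<subseteq> alg (\<Gamma> - {y})"
    using K \<Gamma>(1)
    by (auto simp: T_def intro!: E0_alg star_subalg_mult star_subalg_star alg_star_subalg)
  show "completely_positive_on (alg \<Gamma>) (alg (\<Gamma> - {y})) (T y)"
    using completely_positive_on_comp[OF completely_positive_on_conj[OF alg_star_subalg K]
        E0_completely_positive[of \<Gamma> y]] \<Gamma>
    by (simp add: comp_def T_def[abs_def])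
  show "T y 1 = 1"
    by (rule T_one[OF y(1)])
  show "T y (c * a) = c * T y a" if "c \<in> alg \<Lambda>" for c a
    using y \<Gamma> that finite_subset by (intro T_module) auto
qed

lemma quasi_cond_exp_foldr_E0:
  assumes "finite \<Gamma>" "\<Lambda> \<subseteq> \<Gamma>" "set xs \<inter> \<Lambda> = {}"
  shows "quasi_cond_exp (alg \<Lambda>) (alg (\<Gamma> - set xs)) (alg \<Gamma>) (foldr E0 xs)"
  using assms(3)
proof (induction xs)
  case Nil
  then show ?case using quasi_cond_exp_id[OF alg_mono[OF assms(2,1)]] by (simp add: id_def)
next
  case (Cons x xs)
  have "quasi_cond_exp (alg \<Lambda>) (alg (\<Gamma> - set xs - {x})) (alg (\<Gamma> - set xs)) (E0 x)"
    using Cons assms by (intro quasi_cond_exp_E0) auto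
  moreover have "quasi_cond_exp (alg \<Lambda>) (alg (\<Gamma> - set xs)) (alg \<Gamma>) (foldr E0 xs)"
    using Cons by simp
  ultimately have "quasi_cond_exp (alg \<Lambda>) (alg (\<Gamma> - set xs - {x})) (alg \<Gamma>) (E0 x \<circ> foldr E0 xs)"
    by (rule quasi_cond_exp_comp[rotated])
  moreover have "\<Gamma> - set (x # xs) = \<Gamma> - set xs - {x}"
    by auto
  ultimately show ?case
    by (simp only: foldr.simps)
qed

lemma quasi_cond_exp_foldr_T:
  assumes "finite \<Gamma>" "\<Lambda> \<subseteq> \<Gamma>" "distinct ys" "set ys \<subseteq> V0"
    and "\<And>y. y \<in> set ys \<Longrightarrow> nb y \<subseteq> \<Gamma>" "\<And>y. y \<in> set ys \<Longrightarrow> nb y \<inter> \<Lambda> = {}"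
  shows "quasi_cond_exp (alg \<Lambda>) (alg (\<Gamma> - set ys)) (alg \<Gamma>) (foldr T ys)"
  using assms(3-)
proof (induction ys)
  case Nil
  then show ?case using quasi_cond_exp_id[OF alg_mono[OF assms(2,1)]] by (simp add: id_def)
next
  case (Cons y ys)
  have "quasi_cond_exp (alg \<Lambda>) (alg (\<Gamma> - set ys - {y})) (alg (\<Gamma> - set ys)) (T y)"
  proof (rule quasi_cond_exp_T)
    \<comment> \<open>The maps for ys act first and erase their sites. By independence none of these
      sites lies in \<open>nb y\<close>, so \<open>K y\<close> still belongs to the remaining
      algebra.\<close>
    have "nb y \<inter> set ys = {}"
      using Cons.prems(1,2) V0_nbrs[of y] by auto
    then show "nb y \<subseteq> \<Gamma> - set ys"
      using Cons.prems(3)[of y] by auto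
    show "\<Lambda> \<subseteq> \<Gamma> - set ys"
      using Cons.prems(4) assms(2) by auto
  qed (use Cons.prems assms in auto)
  moreover have "quasi_cond_exp (alg \<Lambda>) (alg (\<Gamma> - set ys)) (alg \<Gamma>) (foldr T ys)"
    using Cons.prems by (intro Cons.IH) auto
  ultimately have "quasi_cond_exp (alg \<Lambda>) (alg (\<Gamma> - set ys - {y})) (alg \<Gamma>) (T y \<circ> foldr T ys)"
    by (rule quasi_cond_exp_comp[rotated])
  moreover have "\<Gamma> - set (y # ys) = \<Gamma> - set ys - {y}"
    by auto
  ultimately show ?case
    by (simp only: foldr.simps)
qed

section \<open>The perturbed states\<close>

definition R :: "'v set \<Rightarrow> 'a" where
  "R Y = cprod K Y"

definition phi :: "'v set \<Rightarrow> 'a \<Rightarrow> complex" where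
  "phi Y a = \<phi>0 (star (R Y) * a * R Y)"

lemma phi_tilde_eq: "phi_tilde adj alg V0 E0 Kt \<phi>0 \<Lambda> = phi (\<Lambda> \<inter> V0)"
  by (simp add: fun_eq_iff phi_tilde_def K_region_def phi_def R_def)

lemma R_insert: "finite Y \<Longrightarrow> insert y Y \<subseteq> V0 \<Longrightarrow> y \<notin> Y \<Longrightarrow> R (insert y Y) = K y * R Y"
  unfolding R_def by (intro cprod_insert) (auto intro!: K_commute)

lemma R_alg:
  assumes "finite Y" "Y \<subseteq> V0"
  shows "R Y \<in> alg (\<Union>y\<in>Y. nb y)"
  unfolding R_def
proof (rule cprod_induct)
  show "1 \<in> alg (\<Union>y\<in>Y. nb y)"
    using assms by (intro star_subalg_one alg_star_subalg) auto
  fix y p assume "y \<in> Y" "p \<in> alg (\<Union>y\<in>Y. nb y)"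
  then show "K y * p \<in> alg (\<Union>y\<in>Y. nb y)"
    using assms K_alg[of y] alg_mono[of "nb y" "\<Union>y\<in>Y. nb y"]
    by (intro star_subalg_mult alg_star_subalg) auto
qed (use assms in \<open>auto intro!: K_commute\<close>)

lemma phi_E0:
  assumes "finite Y" "Y \<subseteq> V0" "x \<notin> (\<Union>y\<in>Y. nb y)"
  shows "phi Y (E0 x a) = phi Y a"
proof -
  let ?F = "\<Union>y\<in>Y. nb y"
  have F: "finite ?F" using assms by auto
  have R: "R Y \<in> alg ?F" "star (R Y) \<in> alg ?F"
    using R_alg assms star_subalg_star[OF alg_star_subalg] F by blast+
  have "E0 x (star (R Y) * a * R Y) = star (R Y) * E0 x a * R Y"
    using E0_module[OF F assms(3)] R by simp
  then show ?thesis
    using phi0_E0 unfolding phi_def by metis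
qed

text \<open>By independence y lies in no \<open>nb z\<close> with z in Y, so \<open>phi Y\<close> is
  invariant under \<open>E0 y\<close>. What remains of \<open>T y\<close> is conjugation by
  \<open>K y\<close>, the additional factor of R.\<close>

lemma phi_T:
  assumes "finite Y" "insert y Y \<subseteq> V0" "y \<notin> Y"
  shows "phi Y (T y a) = phi (insert y Y) a"
proof -
  have "phi Y (T y a) = phi Y (star (K y) * a * K y)"
    unfolding T_def using assms V0_nbrs by (intro phi_E0) auto
  then show ?thesis
    by (simp add: phi_def R_insert[OF assms] star_mult mult.assoc)
qed

lemma phi_foldr_E0:
  assumes "finite Y" "Y \<subseteq> V0" "set xs \<inter> (\<Union>y\<in>Y. nb y) = {}"
  shows "phi Y (foldr E0 xs a) = phi Y a"
  using assms(3) by (induction xs) (auto simp: phi_E0[OF assms(1,2)])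

lemma phi_foldr_T:
  assumes "finite Y" "Y \<union> set ys \<subseteq> V0" "set ys \<inter> Y = {}" "distinct ys"
  shows "phi Y (foldr T ys a) = phi (Y \<union> set ys) a"
  using assms
proof (induction ys arbitrary: Y)
  case (Cons y ys)
  then have "phi Y (foldr T (y # ys) a) = phi (insert y Y) (foldr T ys a)"
    by (simp add: phi_T)
  also have "\<dots> = phi (insert y Y \<union> set ys) a"
    using Cons.prems by (intro Cons.IH) auto
  finally show ?case by simp
qed simp

section \<open>Stability on local observables\<close>

lemma phi_stable:
  assumes "finite Z" "Y \<subseteq> Z" "Z \<subseteq> V0" "finite F" "a \<in> alg F"
    and "\<And>y. y \<in> Z - Y \<Longrightarrow> nb y \<inter> F = {}"
  shows "phi Z a = phi Y a"
proof -
  have "phi (Y \<union> D) a = phi Y a" if "D \<subseteq> Z - Y" for D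
    using finite_subset[OF that finite_Diff[OF assms(1)]] that
  proof (induction D rule: finite_induct)
    case (insert y D)
    have "phi (insert y (Y \<union> D)) a = phi (Y \<union> D) (T y a)"
      using insert assms finite_subset[OF assms(2,1)] by (intro phi_T[symmetric]) auto
    also have "T y a = a"
      using insert assms by (intro T_local[of y F]) auto
    finally show ?case using insert by simp
  qed (use assms in auto)
  from this[of "Z - Y"] show ?thesis
    using assms(2) by (simp add: Un_absorb1)
qed

text \<open>Normalization is stability with F = {}: the unit belongs to the algebra of the empty
  region, so every vertex of Y may be dropped.\<close>

lemma phi_state:
  assumes "finite Y" "Y \<subseteq> V0"
  shows "state_on UNIV (phi Y)"
proof -
  have "phi Y 1 = phi {} 1"
    using assms star_subalg_one[OF alg_star_subalg[of "{}"]] by (intro phi_stable[of _ _ "{}"]) auto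
  also have "\<dots> = 1"
    by (simp add: phi_def R_def phi0_one)
  finally have "phi Y 1 = 1" .
  moreover have "phi Y (star a * a) \<in> \<real>\<^sub>\<ge>\<^sub>0" for a
    using phi0_pos[of "a * R Y"] by (simp add: phi_def star_mult mult.assoc)
  ultimately show ?thesis
    by (simp add: state_on_def phi_def ring_distribs phi0_add phi0_scaleC mult_scaleC_left mult_scaleC_right)
qed

section \<open>The limit\<close>

abbreviation "net \<equiv> (\<lambda>a \<Lambda>. phi (\<Lambda> \<inter> V0) a)"

text \<open>By symmetry of adjacency, a vertex whose closed neighbourhood meets F lies in the closed
  neighbourhood of a point of F, so all vertices that matter are already present.\<close>

lemma phi_eventually_const:
  assumes "finite F" "a \<in> alg F" "finite \<Lambda>" "(\<Union>x\<in>F. nb x) \<subseteq> \<Lambda>"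
  shows "net a \<Lambda> = net a (\<Union>x\<in>F. nb x)"
proof (rule phi_stable)
  show "nb y \<inter> F = {}" if "y \<in> \<Lambda> \<inter> V0 - (\<Union>x\<in>F. nb x) \<inter> V0" for y
    using that nbrs_sym by auto
qed (use assms in auto)

lemma net_tendsto_local:
  assumes "finite F" "a \<in> alg F"
  shows "(net a \<longlongrightarrow> net a (\<Union>x\<in>F. nb x)) (finite_subsets_at_top UNIV)"
proof (rule tendsto_eventually)
  have "finite (\<Union>x\<in>F. nb x)" using assms by auto
  then show "\<forall>\<^sub>F \<Lambda> in finite_subsets_at_top UNIV. net a \<Lambda> = net a (\<Union>x\<in>F. nb x)"
    unfolding eventually_finite_subsets_at_top
    using phi_eventually_const[OF assms] by (intro exI[of _ "\<Union>x\<in>F. nb x"]) blast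
qed

lemma net_convergent: "\<exists>l. (net a \<longlongrightarrow> l) (finite_subsets_at_top UNIV)"
proof -
  have "cauchy_filter (filtermap (net a) (finite_subsets_at_top UNIV))"
    unfolding cauchy_filter_metric_filtermap
  proof (intro allI impI)
    fix e :: real assume e: "e > 0"
    have "a \<in> closure (\<Union>F\<in>{F. finite F \<and> F \<subseteq> UNIV}. alg F)"
      using quasi_local unfolding quasi_local_algebra_def region_alg_def by blast
    \<comment> \<open>Distance e / 8 and the factor 2 in the bound on states give an error below e /
      4, uniformly in \<Lambda>; two such errors stay below e.\<close>
    then obtain b F where b: "finite F" "b \<in> alg F" "dist b a < e / 8"
      using e unfolding closure_approachable by (metis (no_types, lifting) UN_E divide_pos_pos mem_Collect_eq zero_less_numeral)
    let ?G = "\<Union>x\<in>F. nb x"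
    have close: "cmod (net a \<Lambda> - net b \<Lambda>) < e / 4" if "finite \<Lambda>" for \<Lambda>
    proof -
      have st: "state_on UNIV (phi (\<Lambda> \<inter> V0))"
        using that by (intro phi_state) auto
      then have "net (a - b) \<Lambda> = net a \<Lambda> - net b \<Lambda>"
        unfolding state_on_def by (metis UNIV_I add_diff_cancel_right' diff_add_cancel)
      then have "cmod (net a \<Lambda> - net b \<Lambda>) \<le> 2 * norm (a - b)"
        using state_on_bound[OF _ _ st, of "a - b"] by simp
      then show ?thesis using b(3) by (simp add: dist_norm norm_minus_commute)
    qed
    have near: "dist (net a \<Lambda>) (net a \<Lambda>') < e"
      if "finite \<Lambda> \<and> ?G \<subseteq> \<Lambda>" "finite \<Lambda>' \<and> ?G \<subseteq> \<Lambda>'" for \<Lambda> \<Lambda>'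
    proof -
      have "net b \<Lambda> = net b \<Lambda>'"
        using that phi_eventually_const[OF b(1,2)] by metis
      then show ?thesis
        using close[of \<Lambda>] close[of \<Lambda>'] that e
          norm_triangle_ineq4[of "net a \<Lambda> - net b \<Lambda>" "net a \<Lambda>' - net b \<Lambda>'"]
        by (simp add: dist_norm)
    qed
    have "eventually (\<lambda>\<Lambda>. finite \<Lambda> \<and> ?G \<subseteq> \<Lambda>) (finite_subsets_at_top UNIV)"
      unfolding eventually_finite_subsets_at_top using b(1) by (intro exI[of _ ?G]) auto
    then show "\<exists>P. eventually P (finite_subsets_at_top UNIV) \<and>
        (\<forall>x y. P x \<and> P y \<longrightarrow> dist (net a x) (net a y) < e)"
      using near by (intro exI[of _ "\<lambda>\<Lambda>. finite \<Lambda> \<and> ?G \<subseteq> \<Lambda>"]) simp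
  qed
  moreover have "filtermap (net a) (finite_subsets_at_top UNIV) \<noteq> bot"
    "filtermap (net a) (finite_subsets_at_top UNIV) \<le> principal UNIV"
    by (simp_all add: filtermap_bot_iff)
  ultimately obtain l where "filtermap (net a) (finite_subsets_at_top UNIV) \<le> nhds l"
    using complete_UNIV[where 'a = complex, unfolded complete_uniform, rule_format,
        of "filtermap (net a) (finite_subsets_at_top UNIV)"]
    by blast
  then show ?thesis
    by (auto simp: filterlim_def)
qed

definition limit_state :: "'a \<Rightarrow> complex" where
  "limit_state a = Lim (finite_subsets_at_top UNIV) (net a)"

lemma limit_state: "(net a \<longlongrightarrow> limit_state a) (finite_subsets_at_top UNIV)"
proof -
  obtain l where l: "(net a \<longlongrightarrow> l) (finite_subsets_at_top UNIV)"
    using net_convergent by blast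
  then show ?thesis
    unfolding limit_state_def using tendsto_Lim[OF _ l] by simp
qed

lemma limit_state_local:
  assumes "finite F" "a \<in> alg F" "finite \<Lambda>" "(\<Union>x\<in>F. nb x) \<subseteq> \<Lambda>"
  shows "limit_state a = net a \<Lambda>"
  using tendsto_unique[OF _ limit_state net_tendsto_local[OF assms(1,2)]] phi_eventually_const[OF assms]
  by simp

lemma limit_state_state: "state_on UNIV limit_state"
proof -
  have st: "\<forall>\<^sub>F \<Lambda> in finite_subsets_at_top UNIV. state_on UNIV (phi (\<Lambda> \<inter> V0))"
    unfolding eventually_finite_subsets_at_top
    by (intro exI[of _ "{}"]) (auto intro!: phi_state)
  have nb: "finite_subsets_at_top (UNIV :: 'v set) \<noteq> bot" by simp
  have "limit_state (a + b) = limit_state a + limit_state b" for a b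
  proof (rule tendsto_unique[OF nb limit_state])
    show "(net (a + b) \<longlongrightarrow> limit_state a + limit_state b) (finite_subsets_at_top UNIV)"
      by (rule Lim_transform_eventually[OF tendsto_add[OF limit_state limit_state]])
        (use st in \<open>eventually_elim; simp add: state_on_def\<close>)
  qed
  moreover have "limit_state (c *\<^sub>C a) = c * limit_state a" for c a
  proof (rule tendsto_unique[OF nb limit_state])
    show "(net (c *\<^sub>C a) \<longlongrightarrow> c * limit_state a) (finite_subsets_at_top UNIV)"
      by (rule Lim_transform_eventually[OF tendsto_mult[OF tendsto_const limit_state]])
        (use st in \<open>eventually_elim; simp add: state_on_def\<close>)
  qed
  moreover have "limit_state (star a * a) \<in> \<real>\<^sub>\<ge>\<^sub>0" for a
    by (rule Lim_in_closed_set[OF closed_nonneg_Reals_complex _ nb limit_state])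
      (use st in \<open>eventually_elim; simp add: state_on_def\<close>)
  moreover have "limit_state 1 = 1"
    using limit_state_local[of "{}" 1 "{}"] star_subalg_one[OF alg_star_subalg[of "{}"]]
    by (simp add: phi_def R_def phi0_one)
  ultimately show ?thesis
    by (simp add: state_on_def)
qed

lemma nb_subset_gclosure: "y \<in> \<Lambda> \<Longrightarrow> nb y \<subseteq> gclosure adj \<Lambda>"
  using graph by (auto simp: gclosure_def out_boundary_def nbrs_def inf_graph_def symp_def)

text \<open>This is how the restriction on the regions is used: a tessellation vertex outside
  \<Lambda> but adjacent to it would lie on the outer boundary.\<close>

lemma nb_disjoint:
  "out_boundary adj \<Lambda> \<inter> V0 = {} \<Longrightarrow> y \<in> V0 \<Longrightarrow> y \<notin> \<Lambda> \<Longrightarrow> nb y \<inter> \<Lambda> = {}"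
  by (auto simp: out_boundary_def nbrs_def)

lemma limit_state_backward_qmf: "backward_qmf adj alg V0 limit_state"
  unfolding backward_qmf_def
proof (intro conjI allI impI)
  show "state_on UNIV limit_state" by (rule limit_state_state)
next
  fix \<Lambda> :: "nat \<Rightarrow> 'v set"
  assume \<Lambda>: "\<forall>n. finite (\<Lambda> n) \<and> gclosure adj (\<Lambda> n) \<subseteq> \<Lambda> (Suc n) \<and> out_boundary adj (\<Lambda> n) \<inter> V0 = {}"
  let ?cl = "\<lambda>n. gclosure adj (\<Lambda> n)"
  have fin: "finite (\<Lambda> n)" "finite (?cl n)" and cl: "?cl n \<subseteq> \<Lambda> (Suc n)" "\<Lambda> n \<subseteq> ?cl n"
    and bd: "out_boundary adj (\<Lambda> n) \<inter> V0 = {}" for n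
    using \<Lambda> by (auto intro: finite_subset simp: gclosure_def)
  define Y where "Y n = V0 \<inter> (\<Lambda> (Suc n) - \<Lambda> n)" for n
  have "\<exists>ys. \<forall>n. set (ys n) = Y n \<and> distinct (ys n)"
    by (intro choice allI finite_distinct_list) (simp add: Y_def fin)
  then obtain ys where ys: "\<And>n. set (ys n) = Y n" "\<And>n. distinct (ys n)"
    by blast
  \<comment> \<open>These sites remain to be erased after the dressed expectations; they include the
    outer boundary of \<Lambda> (Suc n).\<close>
  have "\<exists>xs. \<forall>n. set (xs n) = ?cl (Suc n) - ?cl n - Y n"
    by (intro choice allI finite_list) (simp add: fin)
  then obtain xs where xs: "\<And>n. set (xs n) = ?cl (Suc n) - ?cl n - Y n"
    by blast
  define E where "E n = foldr E0 (xs n) \<circ> foldr T (ys n)" for n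
  \<comment> \<open>The boundary condition keeps the new tessellation vertices out of the closure of
    \<Lambda> n, so erasing them leaves that closure intact.\<close>
  have Y_disj: "Y n \<inter> ?cl n = {}" for n
    using bd[of n] by (auto simp: Y_def gclosure_def)
  text \<open>On \<open>\<A>\<close> of the closure of \<open>\<Lambda>\<^sub>n\<^sub>+\<^sub>1\<close>, this is \<open>a \<mapsto> \<bbbE>\<^sup>0(K\<^sup>* a K)\<close> with \<open>K\<close> the amplitude of
    \<open>\<Lambda>\<^sub>n\<^sub>+\<^sub>1 - \<Lambda>\<^sub>n\<close> and \<open>\<bbbE>\<^sup>0\<close> integrating out everything outside the closure of \<open>\<Lambda>\<^sub>n\<close>.\<close>
  have qce: "quasi_cond_exp (alg (\<Lambda> n)) (alg (?cl n)) (alg (?cl (Suc n))) (E n)" for n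
  proof -
    have sub: "\<Lambda> n \<subseteq> ?cl (Suc n)"
      using cl(1)[of n] cl(2)[of n] cl(2)[of "Suc n"] by blast
    have "quasi_cond_exp (alg (\<Lambda> n)) (alg (?cl (Suc n) - set (ys n))) (alg (?cl (Suc n))) (foldr T (ys n))"
    proof (rule quasi_cond_exp_foldr_T)
      fix y assume "y \<in> set (ys n)"
      then have y: "y \<in> V0" "y \<in> \<Lambda> (Suc n)" "y \<notin> \<Lambda> n"
        by (auto simp: ys Y_def)
      show "nb y \<subseteq> ?cl (Suc n)" by (rule nb_subset_gclosure[OF y(2)])
      show "nb y \<inter> \<Lambda> n = {}" by (rule nb_disjoint[OF bd y(1,3)])
    qed (use fin sub ys in \<open>auto simp: Y_def\<close>)
    moreover have "quasi_cond_exp (alg (\<Lambda> n)) (alg (?cl (Suc n) - set (ys n) - set (xs n)))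
        (alg (?cl (Suc n) - set (ys n))) (foldr E0 (xs n))"
      using fin sub cl(2)[of n] by (intro quasi_cond_exp_foldr_E0) (auto simp: xs ys Y_def)
    moreover have "?cl (Suc n) - set (ys n) - set (xs n) = ?cl n"
      using cl(1)[of n] cl(2)[of "Suc n"] Y_disj[of n] by (auto simp: xs ys)
    ultimately show ?thesis
      unfolding E_def using quasi_cond_exp_comp by metis
  qed
  \<comment> \<open>Amplitudes of \<Lambda> n live on its closure, so the plain expectations do not
    change its perturbed state, and the dressed ones add exactly the missing vertices. Iteration
    makes the backward composition telescope.\<close>
  have step: "net (E n a) (\<Lambda> n) = net a (\<Lambda> (Suc n))" for n a
  proof -
    have "(\<Union>y\<in>\<Lambda> n \<inter> V0. nb y) \<subseteq> ?cl n"
      using nb_subset_gclosure by blast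
    then have "net (E n a) (\<Lambda> n) = net (foldr T (ys n) a) (\<Lambda> n)"
      unfolding E_def comp_def using fin by (intro phi_foldr_E0) (auto simp: xs)
    also have "\<dots> = phi (\<Lambda> n \<inter> V0 \<union> set (ys n)) a"
      using fin ys by (intro phi_foldr_T) (auto simp: Y_def)
    also have "\<Lambda> n \<inter> V0 \<union> set (ys n) = \<Lambda> (Suc n) \<inter> V0"
      using cl(1)[of n] cl(2)[of n] by (auto simp: ys Y_def)
    finally show ?thesis .
  qed
  have net_back_comp: "net (back_comp E n a) (\<Lambda> 0) = net a (\<Lambda> (Suc n))" for n a
    by (induction n arbitrary: a) (simp_all add: step)
  have mono: "\<Lambda> m \<subseteq> \<Lambda> n" if "m \<le> n" for m n
    using lift_Suc_mono_le[of \<Lambda>, OF _ that] cl by blast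
  have lim: "net a (\<Lambda> n) = limit_state a" if a: "a \<in> alg (?cl m)" and "m < n" for a m n
  proof -
    \<comment> \<open>\<Lambda> n need not contain the neighbourhoods at which the limit is
      attained, so they are adjoined. The tessellation vertices gained in this way do not touch
      \<Lambda> n, which contains the support of a.\<close>
    let ?M = "\<Lambda> n \<union> (\<Union>x\<in>?cl m. nb x)"
    have "net a ?M = net a (\<Lambda> n)"
    proof (rule phi_stable[OF _ _ _ fin(2)[of m] a])
      fix y assume "y \<in> ?M \<inter> V0 - \<Lambda> n \<inter> V0"
      then have "nb y \<inter> \<Lambda> n = {}" using nb_disjoint[OF bd] by blast
      moreover have "?cl m \<subseteq> \<Lambda> n" using cl(1)[of m] mono[of "Suc m" n] that by auto
      ultimately show "nb y \<inter> ?cl m = {}" by blast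
    qed (use fin in auto)
    moreover have "limit_state a = net a ?M"
      using fin a by (intro limit_state_local[of "?cl m"]) auto
    ultimately show ?thesis by simp
  qed
  show "\<exists>\<psi> E. state_on (alg (?cl 0)) \<psi> \<and>
      (\<forall>n. quasi_cond_exp (alg (\<Lambda> n)) (alg (?cl n)) (alg (\<Lambda> (Suc n))) (E n)) \<and>
      (\<forall>n. quasi_cond_exp (alg (\<Lambda> n)) (alg (?cl n)) (alg (?cl (Suc n))) (E n)) \<and>
      (\<forall>m. \<forall>a\<in>alg (?cl m). (\<lambda>n. \<psi> (back_comp E n a)) \<longlonglongrightarrow> limit_state a)"
  proof (rule exI[of _ "phi (\<Lambda> 0 \<inter> V0)"], rule exI[of _ E], intro conjI allI ballI)
    show "state_on (alg (?cl 0)) (phi (\<Lambda> 0 \<inter> V0))"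
      using phi_state[of "\<Lambda> 0 \<inter> V0"] fin by (simp add: state_on_def)
    show "quasi_cond_exp (alg (\<Lambda> n)) (alg (?cl n)) (alg (\<Lambda> (Suc n))) (E n)" for n
      using quasi_cond_exp_restrict[OF qce alg_mono[OF cl(1)] alg_mono[OF cl(2)]] fin by blast
    show "quasi_cond_exp (alg (\<Lambda> n)) (alg (?cl n)) (alg (?cl (Suc n))) (E n)" for n
      by (rule qce)
    show "(\<lambda>n. net (back_comp E n a) (\<Lambda> 0)) \<longlonglongrightarrow> limit_state a" if "a \<in> alg (?cl m)" for m a
      unfolding net_back_comp
      \<comment> \<open>\<open>back_comp E n\<close> reaches the region \<Lambda> (Suc n), so n
        \<ge> m already gives the strict inequality required by \<open>lim\<close>.\<close>
      by (rule tendsto_eventually, rule eventually_sequentiallyI[of m], rule lim[OF that]) simp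
  qed
qed

end

theorem theorem6p2:
  fixes adj :: "'v \<Rightarrow> 'v \<Rightarrow> bool"
    and y1 :: 'v
    and V0 :: "'v set"
    and d :: "'v \<Rightarrow> nat"
    and \<pi> :: "'v set \<Rightarrow> 'v cmat \<Rightarrow> 'a::cstar_algebra"
    and A :: "'v set \<Rightarrow> 'a set"
    and \<phi>x :: "'v \<Rightarrow> 'a \<Rightarrow> complex"
    and \<phi>0 :: "'a \<Rightarrow> complex"
    and E0 :: "'v \<Rightarrow> 'a \<Rightarrow> 'a"
    and Kt :: "'v \<Rightarrow> 'v \<Rightarrow> 'a"
  assumes graph: "inf_graph adj"
    and V0: "V0 = tessellation adj y1"
    and V0_indep: "independent_in adj V0"
    and algebra: "quasi_local_algebra d \<pi>"
    and A: "A = local_alg d \<pi>"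
    and site_states: "\<And>x. state_on (A {x}) (\<phi>x x)"
    and phi0: "product_state d \<pi> \<phi>x \<phi>0"
    and E0: "\<And>x. site_cond_exp d \<pi> \<phi>x x (E0 x)"
    and Kt_local: "\<And>x y. y \<in> V0 \<Longrightarrow> x \<in> nbrs adj y \<Longrightarrow> Kt x y \<in> A {x, y}"
    and Kt_inv: "\<And>x y. y \<in> V0 \<Longrightarrow> x \<in> nbrs adj y \<Longrightarrow> invertible_elem (Kt x y)"
    and K_comm: "commutative_on (gen_alg adj V0 Kt)"
    and B_comm: "\<And>y. y \<in> V0 \<Longrightarrow> B_op adj E0 Kt y \<in> commutant (gen_alg adj V0 Kt)"
  shows "(\<forall>\<Lambda>. finite \<Lambda> \<longrightarrow> state_on UNIV (phi_tilde adj A V0 E0 Kt \<phi>0 \<Lambda>)) \<and>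
    (\<exists>\<phi>. (\<forall>a. ((\<lambda>\<Lambda>. phi_tilde adj A V0 E0 Kt \<phi>0 \<Lambda> a) \<longlongrightarrow> \<phi> a)
                 (finite_subsets_at_top UNIV)) \<and>
         backward_qmf adj A V0 \<phi>)"
proof -
  interpret amplitudes d \<pi> \<phi>x \<phi>0 E0 adj V0 Kt
    using assms(1,3-12) unfolding A by unfold_locales
  show ?thesis
    unfolding A phi_tilde_eq
    using phi_state limit_state limit_state_backward_qmf by (intro conjI exI[of _ limit_state]) auto
qed

end
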